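(* Let $R$ be a ring and let $A$ be a monogenic $R$-algebra of rank $n$ with generator $a$ (so that $R[x]\to A$, $x\mapsto a$, is surjective). Given a closure datum $(G,\varphi)$ for $A$ over $R$, we may compose $\varphi$ with the projection $(R[x]^{\otimes n})^G\to(A^{\otimes n})^G$ induced by $x\mapsto a$ to obtain an $R$-algebra homomorphism $(R[x]^{\otimes n})^G\to R$ such that $e_k(x)\mapsto s_k(a)$ for all $k\in\{1,\dots,n\}$. If $G$ is a subgroup of $\mathrm{S}_n$ for which $(R,G)$ is benign, then this operation forms a one-to-one correspondence between $G$-closure data for $A$ over $R$ and $R$-algebra homomorphisms $(R[x]^{\otimes n})^G\to R$ sending $e_k(x)\mapsto s_k(a)$ for all $k\in\{1,\dots,n\}$.
   Context: All rings and algebras are commutative with 1. An $R$-algebra $A$ is monogenic of rank $n$ if $A\cong R[x]/(f(x))$ for some monic $f$ of degree $n$; equivalently $A$ is locally free of rank $n$ as an $R$-module and generated by one element as an $R$-algebra. Benign pair: for a ring $R$ and a subgroup $G\subseteq\mathrm{S}_n$, the pair $(R,G)$ is benign if for every $R$-algebra $B$ with an action of $G$ by $R$-algebra homomorphisms, and every $R$-algebra homomorphism $B^G\to R$, the tensor product $B\otimes_{B^G}R$ is a faithful $R$-algebra, i.e. the structure map $R\to B\otimes_{B^G}R$ is injective. For any $R$-algebra $C$, $C^{\otimes n}$ is the $n$-fold tensor power over $R$; for $c\in C$, $c^{(i)}\in C^{\otimes n}$ is the pure tensor with $c$ in position $i$ and $1$ elsewhere. $\mathrm{S}_n$ acts on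 $C^{\otimes n}$ by the $R$-algebra automorphisms with $\sigma\cdot c^{(i)}=c^{(\sigma(i))}$; $(C^{\otimes n})^G$ is the subalgebra of $G$-invariants. $e_k(c)\in (C^{\otimes n})^{\mathrm{S}_n}$ is the $k$-th elementary symmetric polynomial in $c^{(1)},\dots,c^{(n)}$. For $b\in A$, $s_k(b)\in R$ is defined by the characteristic polynomial of multiplication by $b$ on $A$: $\lambda^n-s_1(b)\lambda^{n-1}+\dots+(-1)^ns_n(b)$. A closure datum $(G,\varphi)$ for $A$ over $R$ (also: $\varphi$ is a $G$-closure datum) consists of a subgroup $G\subseteq\mathrm{S}_n$ and an $R$-algebra homomorphism $\varphi:(A^{\otimes n})^G\to R$ with $\varphi(e_k(b))=s_k(b)$ for all $b\in A$, $1\le k\le n$. *)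

theory Defs
  imports "HOL-Algebra.Algebra"
begin

section \<open>Algebras over a commutative ring\<close>

text \<open>
  An \<open>R\<close>-algebra is a module record satisfying the library locale \<^locale>\<open>algebra\<close>.
  Homomorphisms are extensional, so that equality of homomorphisms is equality of functions.
\<close>

definition alg_hom ::
    "('r, 'x) ring_scheme \<Rightarrow> ('r, 'a, 'y) module_scheme \<Rightarrow> ('r, 'b, 'z) module_scheme \<Rightarrow> ('a \<Rightarrow> 'b) set"
  where "alg_hom R A B =
    {h \<in> ring_hom A B \<inter> extensional (carrier A).
       \<forall>r\<in>carrier R. \<forall>x\<in>carrier A. h (r \<odot>\<^bsub>A\<^esub> x) = r \<odot>\<^bsub>B\<^esub> h x}"

definition alg_via :: "('c, 'x) ring_scheme \<Rightarrow> ('s \<Rightarrow> 'c) \<Rightarrow> ('s, 'c) module"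
  where "alg_via C \<theta> =
    \<lparr>carrier = carrier C, monoid.mult = monoid.mult C, one = one C, ring.zero = ring.zero C, add = add C,
     smult = (\<lambda>s c. \<theta> s \<otimes>\<^bsub>C\<^esub> c)\<rparr>"

abbreviation self_alg :: "('r, 'x) ring_scheme \<Rightarrow> ('r, 'r) module"
  where "self_alg R \<equiv> alg_via R (\<lambda>r. r)"

definition alg_quot :: "('r, 'a, 'x) module_scheme \<Rightarrow> 'a set \<Rightarrow> ('r, 'a set) module"
  where "alg_quot A I = alg_via (A Quot I) (\<lambda>r. I +>\<^bsub>A\<^esub> (r \<odot>\<^bsub>A\<^esub> \<one>\<^bsub>A\<^esub>))"

definition invariants ::
    "'g set \<Rightarrow> ('g \<Rightarrow> 'a \<Rightarrow> 'a) \<Rightarrow> ('r, 'a) module \<Rightarrow> ('r, 'a) module"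
  where "invariants G act B = B\<lparr>carrier := {x \<in> carrier B. \<forall>g\<in>G. act g x = x}\<rparr>"

section \<open>Tensor products of algebras\<close>

text \<open>
  The monoid algebra \<open>S[M]\<close>: the free \<open>S\<close>-module on the elements of \<open>M\<close>, realised as the
  finitely supported functions, with the \<open>S\<close>-bilinear multiplication extending that of \<open>M\<close>.
\<close>

definition monoid_algebra ::
    "('s, 'x) ring_scheme \<Rightarrow> ('m, 'y) monoid_scheme \<Rightarrow> ('s, 'm \<Rightarrow> 's) module"
  where "monoid_algebra S M =
    \<lparr>carrier = {f. range f \<subseteq> carrier S \<and> {m. f m \<noteq> \<zero>\<^bsub>S\<^esub>} \<subseteq> carrier M
                   \<and> finite {m. f m \<noteq> \<zero>\<^bsub>S\<^esub>}},
     monoid.mult = (\<lambda>f g m. \<Oplus>\<^bsub>S\<^esub>p\<in>{(x, y). f x \<noteq> \<zero>\<^bsub>S\<^esub> \<and> g y \<noteq> \<zero>\<^bsub>S\<^esub> \<and> x \<otimes>\<^bsub>M\<^esub> y = m}.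
                        f (fst p) \<otimes>\<^bsub>S\<^esub> g (snd p)),
     one = (\<lambda>m. if m = \<one>\<^bsub>M\<^esub> then \<one>\<^bsub>S\<^esub> else \<zero>\<^bsub>S\<^esub>),
     ring.zero = (\<lambda>m. \<zero>\<^bsub>S\<^esub>),
     add = (\<lambda>f g m. f m \<oplus>\<^bsub>S\<^esub> g m),
     smult = (\<lambda>s f m. s \<otimes>\<^bsub>S\<^esub> f m)\<rparr>"

definition basis_elt :: "('s, 'x) ring_scheme \<Rightarrow> 'm \<Rightarrow> 'm \<Rightarrow> 's"
  where "basis_elt S m = (\<lambda>m'. if m' = m then \<one>\<^bsub>S\<^esub> else \<zero>\<^bsub>S\<^esub>)"

text \<open>
  A tensor product of \<open>S\<close>-algebras is the free \<open>S\<close>-module on the tuples of elements modulo the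
  multilinearity relations.  The submodule spanned by these relations is stable under
  multiplication by basis elements, so it coincides with the ideal they generate in the monoid
  algebra of the componentwise product.
\<close>

definition bilinear_rels ::
    "('s, 'x) ring_scheme \<Rightarrow> ('s, 'b, 'y) module_scheme \<Rightarrow> ('s, 'c, 'z) module_scheme
      \<Rightarrow> ('b \<times> 'c \<Rightarrow> 's) set"
  where "bilinear_rels S B C =
    (let F = monoid_algebra S (B \<times>\<times> C); \<delta> = basis_elt S in
       {\<delta> (b \<oplus>\<^bsub>B\<^esub> b', c) \<ominus>\<^bsub>F\<^esub> (\<delta> (b, c) \<oplus>\<^bsub>F\<^esub> \<delta> (b', c)) | b b' c.
          b \<in> carrier B \<and> b' \<in> carrier B \<and> c \<in> carrier C}
     \<union> {\<delta> (b, c \<oplus>\<^bsub>C\<^esub> c') \<ominus>\<^bsub>F\<^esub> (\<delta> (b, c) \<oplus>\<^bsub>F\<^esub> \<delta> (b, c')) | b c c'.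
          b \<in> carrier B \<and> c \<in> carrier C \<and> c' \<in> carrier C}
     \<union> {\<delta> (s \<odot>\<^bsub>B\<^esub> b, c) \<ominus>\<^bsub>F\<^esub> (s \<odot>\<^bsub>F\<^esub> \<delta> (b, c)) | s b c.
          s \<in> carrier S \<and> b \<in> carrier B \<and> c \<in> carrier C}
     \<union> {\<delta> (b, s \<odot>\<^bsub>C\<^esub> c) \<ominus>\<^bsub>F\<^esub> (s \<odot>\<^bsub>F\<^esub> \<delta> (b, c)) | s b c.
          s \<in> carrier S \<and> b \<in> carrier B \<and> c \<in> carrier C})"

definition tensor_ideal ::
    "('s, 'x) ring_scheme \<Rightarrow> ('s, 'b, 'y) module_scheme \<Rightarrow> ('s, 'c, 'z) module_scheme
      \<Rightarrow> ('b \<times> 'c \<Rightarrow> 's) set"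
  where "tensor_ideal S B C = Idl\<^bsub>monoid_algebra S (B \<times>\<times> C)\<^esub> (bilinear_rels S B C)"

definition tensor_prod ::
    "('s, 'x) ring_scheme \<Rightarrow> ('s, 'b, 'y) module_scheme \<Rightarrow> ('s, 'c, 'z) module_scheme
      \<Rightarrow> ('s, ('b \<times> 'c \<Rightarrow> 's) set) module"
  where "tensor_prod S B C = alg_quot (monoid_algebra S (B \<times>\<times> C)) (tensor_ideal S B C)"

definition tensor ::
    "('s, 'x) ring_scheme \<Rightarrow> ('s, 'b, 'y) module_scheme \<Rightarrow> ('s, 'c, 'z) module_scheme
      \<Rightarrow> 'b \<Rightarrow> 'c \<Rightarrow> ('b \<times> 'c \<Rightarrow> 's) set"
  where "tensor S B C b c =
    tensor_ideal S B C +>\<^bsub>monoid_algebra S (B \<times>\<times> C)\<^esub> basis_elt S (b, c)"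

abbreviation tuples :: "('r, 'c, 'x) module_scheme \<Rightarrow> nat \<Rightarrow> (nat \<Rightarrow> 'c) monoid"
  where "tuples C n \<equiv> product_group {1..n} (\<lambda>_. C)"

definition multilinear_rels ::
    "('r, 'x) ring_scheme \<Rightarrow> ('r, 'c, 'y) module_scheme \<Rightarrow> nat \<Rightarrow> ((nat \<Rightarrow> 'c) \<Rightarrow> 'r) set"
  where "multilinear_rels R C n =
    (let F = monoid_algebra R (tuples C n); \<delta> = basis_elt R in
       {\<delta> (t(i := u \<oplus>\<^bsub>C\<^esub> v)) \<ominus>\<^bsub>F\<^esub> (\<delta> (t(i := u)) \<oplus>\<^bsub>F\<^esub> \<delta> (t(i := v))) | t i u v.
          t \<in> carrier (tuples C n) \<and> i \<in> {1..n} \<and> u \<in> carrier C \<and> v \<in> carrier C}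
     \<union> {\<delta> (t(i := r \<odot>\<^bsub>C\<^esub> u)) \<ominus>\<^bsub>F\<^esub> (r \<odot>\<^bsub>F\<^esub> \<delta> (t(i := u))) | t i r u.
          t \<in> carrier (tuples C n) \<and> i \<in> {1..n} \<and> r \<in> carrier R \<and> u \<in> carrier C})"

definition tpower_ideal ::
    "('r, 'x) ring_scheme \<Rightarrow> ('r, 'c, 'y) module_scheme \<Rightarrow> nat \<Rightarrow> ((nat \<Rightarrow> 'c) \<Rightarrow> 'r) set"
  where "tpower_ideal R C n = Idl\<^bsub>monoid_algebra R (tuples C n)\<^esub> (multilinear_rels R C n)"

definition tpower ::
    "('r, 'x) ring_scheme \<Rightarrow> ('r, 'c, 'y) module_scheme \<Rightarrow> nat
      \<Rightarrow> ('r, ((nat \<Rightarrow> 'c) \<Rightarrow> 'r) set) module"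
  where "tpower R C n = alg_quot (monoid_algebra R (tuples C n)) (tpower_ideal R C n)"

definition pure_tensor ::
    "('r, 'x) ring_scheme \<Rightarrow> ('r, 'c, 'y) module_scheme \<Rightarrow> nat \<Rightarrow> (nat \<Rightarrow> 'c)
      \<Rightarrow> ((nat \<Rightarrow> 'c) \<Rightarrow> 'r) set"
  where "pure_tensor R C n t =
    tpower_ideal R C n +>\<^bsub>monoid_algebra R (tuples C n)\<^esub> basis_elt R t"

definition tensor_at ::
    "('r, 'x) ring_scheme \<Rightarrow> ('r, 'c, 'y) module_scheme \<Rightarrow> nat \<Rightarrow> 'c \<Rightarrow> nat
      \<Rightarrow> ((nat \<Rightarrow> 'c) \<Rightarrow> 'r) set"
  where "tensor_at R C n c i = pure_tensor R C n (\<lambda>j\<in>{1..n}. if j = i then c else \<one>\<^bsub>C\<^esub>)"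

text \<open>
  The map on cosets induced by the linear action \<open>t \<mapsto> t \<circ> \<sigma>\<inverse>\<close> on the basis of tuples
  (\<open>u = t \<circ> \<sigma>\<inverse>\<close> iff \<open>t = u \<circ> \<sigma>\<close>); it sends \<open>tensor_at R C n c i\<close> to
  \<open>tensor_at R C n c (\<sigma> i)\<close>.
\<close>

definition perm_act ::
    "(nat \<Rightarrow> nat) \<Rightarrow> ((nat \<Rightarrow> 'c) \<Rightarrow> 'r) set \<Rightarrow> ((nat \<Rightarrow> 'c) \<Rightarrow> 'r) set"
  where "perm_act \<sigma> Z = (\<lambda>f u. f (u \<circ> \<sigma>)) ` Z"

abbreviation tpower_inv ::
    "('r, 'x) ring_scheme \<Rightarrow> ('r, 'c, 'y) module_scheme \<Rightarrow> nat \<Rightarrow> (nat \<Rightarrow> nat) set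
      \<Rightarrow> ('r, ((nat \<Rightarrow> 'c) \<Rightarrow> 'r) set) module"
  where "tpower_inv R C n G \<equiv> invariants G perm_act (tpower R C n)"

text \<open>The map \<open>c\<^sub>1 \<otimes> \<dots> \<otimes> c\<^sub>n \<mapsto> h c\<^sub>1 \<otimes> \<dots> \<otimes> h c\<^sub>n\<close>, evaluated on representatives.\<close>

definition tpower_map ::
    "('r, 'x) ring_scheme \<Rightarrow> ('r, 'c, 'y) module_scheme \<Rightarrow> ('r, 'd, 'z) module_scheme \<Rightarrow> nat
      \<Rightarrow> ('c \<Rightarrow> 'd) \<Rightarrow> ((nat \<Rightarrow> 'c) \<Rightarrow> 'r) set \<Rightarrow> ((nat \<Rightarrow> 'd) \<Rightarrow> 'r) set"
  where "tpower_map R C D n h Z =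
    the_elem ((\<lambda>f. \<Oplus>\<^bsub>tpower R D n\<^esub>t\<in>{t. f t \<noteq> \<zero>\<^bsub>R\<^esub>}.
      f t \<odot>\<^bsub>tpower R D n\<^esub> pure_tensor R D n (\<lambda>i\<in>{1..n}. h (t i))) ` Z)"

definition elem_sym ::
    "('r, 'x) ring_scheme \<Rightarrow> ('r, 'c, 'y) module_scheme \<Rightarrow> nat \<Rightarrow> nat \<Rightarrow> 'c
      \<Rightarrow> ((nat \<Rightarrow> 'c) \<Rightarrow> 'r) set"
  where "elem_sym R C n k c =
    (\<Oplus>\<^bsub>tpower R C n\<^esub>K\<in>{K. K \<subseteq> {1..n} \<and> card K = k}.
       \<Otimes>\<^bsub>tpower R C n\<^esub>i\<in>K. tensor_at R C n c i)"

section \<open>Benign pairs\<close>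

text \<open>
  A formula cannot range over algebras on arbitrary types, so the carriers of the algebras \<open>B\<close>
  are taken in the type \<open>(nat \<times> 'r) list\<close>.  This loses nothing.  Suppose \<open>r \<noteq> 0\<close> dies in
  \<open>B \<otimes>\<^bsub>B\<^sup>G\<^esub> R\<close>.  As \<open>\<psi>\<close> is surjective, this means that
  \<open>r \<cdot> 1 = \<Sum> b\<^sub>j k\<^sub>j\<close> in \<open>B\<close> for finitely many \<open>b\<^sub>j \<in> B\<close> and \<open>k\<^sub>j \<in> ker \<psi>\<close>.  Then \<open>r\<close> also
  dies for the \<open>R\<close>-subalgebra of \<open>B\<close> generated by the \<open>k\<^sub>j\<close> and the \<open>G\<close>-orbits of the \<open>b\<^sub>j\<close>,
  whose elements are finite sums of coefficients from \<open>R\<close> times monomials from a countable set;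
  it therefore has an isomorphic copy with carrier in \<open>(nat \<times> 'r) list\<close>.

  The structure map of \<^term>\<open>tensor_prod (invariants G act B) (self_alg B) (alg_via R \<psi>)\<close> as an
  \<open>R\<close>-algebra is \<open>r \<mapsto> 1 \<otimes> r\<close>, which equals \<open>r \<mapsto> (r \<cdot> 1) \<otimes> 1\<close> because \<open>\<psi>\<close> is
  \<open>R\<close>-linear.
\<close>

definition benign :: "('r, 'x) ring_scheme \<Rightarrow> nat \<Rightarrow> (nat \<Rightarrow> nat) set \<Rightarrow> bool"
  where "benign R n G \<longleftrightarrow>
    (\<forall>(B :: ('r, (nat \<times> 'r) list) module) act \<psi>.
       algebra R B \<and>
       group_action (sym_group n \<lparr>carrier := G\<rparr>) (carrier B) act \<and>
       (\<forall>g\<in>G. act g \<in> alg_hom R B B) \<and>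
       \<psi> \<in> alg_hom R (invariants G act B) (self_alg R) \<longrightarrow>
       inj_on (tensor (invariants G act B) (self_alg B) (alg_via R \<psi>) \<one>\<^bsub>B\<^esub>) (carrier R))"

section \<open>Characteristic polynomials\<close>

definition is_basis ::
    "('r, 'x) ring_scheme \<Rightarrow> ('r, 'a, 'y) module_scheme \<Rightarrow> nat \<Rightarrow> (nat \<Rightarrow> 'a) \<Rightarrow> bool"
  where "is_basis R A n \<epsilon> \<longleftrightarrow>
    \<epsilon> \<in> {1..n} \<rightarrow> carrier A \<and>
    (\<forall>x\<in>carrier A. \<exists>!c. c \<in> {1..n} \<rightarrow>\<^sub>E carrier R \<and> x = (\<Oplus>\<^bsub>A\<^esub>i\<in>{1..n}. c i \<odot>\<^bsub>A\<^esub> \<epsilon> i))"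

definition coords ::
    "('r, 'x) ring_scheme \<Rightarrow> ('r, 'a, 'y) module_scheme \<Rightarrow> nat \<Rightarrow> (nat \<Rightarrow> 'a) \<Rightarrow> 'a \<Rightarrow> nat \<Rightarrow> 'r"
  where "coords R A n \<epsilon> x =
    (THE c. c \<in> {1..n} \<rightarrow>\<^sub>E carrier R \<and> x = (\<Oplus>\<^bsub>A\<^esub>i\<in>{1..n}. c i \<odot>\<^bsub>A\<^esub> \<epsilon> i))"

definition ring_det :: "('s, 'x) ring_scheme \<Rightarrow> nat \<Rightarrow> (nat \<Rightarrow> nat \<Rightarrow> 's) \<Rightarrow> 's"
  where "ring_det S n M =
    (\<Oplus>\<^bsub>S\<^esub>\<sigma>\<in>{\<sigma>. \<sigma> permutes {1..n}}. add_pow S (sign \<sigma>) (\<Otimes>\<^bsub>S\<^esub>i\<in>{1..n}. M i (\<sigma> i)))"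

text \<open>
  \<open>det (\<lambda> - T)\<close> for \<open>T\<close> multiplication by \<open>b\<close>, in terms of a chosen basis of \<open>A\<close>; the choice
  does not affect the value.
\<close>

definition char_poly_mult ::
    "('r, 'x) ring_scheme \<Rightarrow> ('r, 'a, 'y) module_scheme \<Rightarrow> nat \<Rightarrow> 'a \<Rightarrow> nat \<Rightarrow> 'r"
  where "char_poly_mult R A n b =
    (let P = UP R; \<epsilon> = (SOME \<epsilon>. is_basis R A n \<epsilon>) in
       ring_det P n (\<lambda>i j. (if i = j then monom P \<one>\<^bsub>R\<^esub> 1 else \<zero>\<^bsub>P\<^esub>)
                             \<ominus>\<^bsub>P\<^esub> monom P (coords R A n \<epsilon> (b \<otimes>\<^bsub>A\<^esub> \<epsilon> j) i) 0))"

definition char_coeff ::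
    "('r, 'x) ring_scheme \<Rightarrow> ('r, 'a, 'y) module_scheme \<Rightarrow> nat \<Rightarrow> nat \<Rightarrow> 'a \<Rightarrow> 'r"
  where "char_coeff R A n k b =
    ((\<ominus>\<^bsub>R\<^esub> \<one>\<^bsub>R\<^esub>) [^]\<^bsub>R\<^esub> k) \<otimes>\<^bsub>R\<^esub> coeff (UP R) (char_poly_mult R A n b) (n - k)"

section \<open>Monogenic algebras and closure data\<close>

text \<open>Monic of degree \<open>n\<close> is phrased by coefficients because \<^const>\<open>deg\<close> is always 0 over the zero ring.\<close>

definition monic_of_degree :: "('r, 'x) ring_scheme \<Rightarrow> nat \<Rightarrow> (nat \<Rightarrow> 'r) \<Rightarrow> bool"
  where "monic_of_degree R n f \<longleftrightarrow>
    f \<in> carrier (UP R) \<and> coeff (UP R) f n = \<one>\<^bsub>R\<^esub> \<and> (\<forall>m>n. coeff (UP R) f m = \<zero>\<^bsub>R\<^esub>)"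

definition monogenic :: "('r, 'x) ring_scheme \<Rightarrow> ('r, 'a, 'y) module_scheme \<Rightarrow> nat \<Rightarrow> bool"
  where "monogenic R A n \<longleftrightarrow>
    (\<exists>f. monic_of_degree R n f \<and>
      (\<exists>h \<in> alg_hom R (alg_quot (UP R) (PIdl\<^bsub>UP R\<^esub> f)) A.
         bij_betw h (carrier (alg_quot (UP R) (PIdl\<^bsub>UP R\<^esub> f))) (carrier A)))"

definition eval_at ::
    "('r, 'x) ring_scheme \<Rightarrow> ('r, 'a, 'y) module_scheme \<Rightarrow> 'a \<Rightarrow> (nat \<Rightarrow> 'r) \<Rightarrow> 'a"
  where "eval_at R A a = eval R A (\<lambda>r. r \<odot>\<^bsub>A\<^esub> \<one>\<^bsub>A\<^esub>) a"

definition generates :: "('r, 'x) ring_scheme \<Rightarrow> ('r, 'a, 'y) module_scheme \<Rightarrow> 'a \<Rightarrow> bool"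
  where "generates R A a \<longleftrightarrow> a \<in> carrier A \<and> eval_at R A a ` carrier (UP R) = carrier A"

definition closure_data ::
    "('r, 'x) ring_scheme \<Rightarrow> ('r, 'a, 'y) module_scheme \<Rightarrow> nat \<Rightarrow> (nat \<Rightarrow> nat) set
      \<Rightarrow> (((nat \<Rightarrow> 'a) \<Rightarrow> 'r) set \<Rightarrow> 'r) set"
  where "closure_data R A n G =
    {\<phi> \<in> alg_hom R (tpower_inv R A n G) (self_alg R).
       \<forall>b\<in>carrier A. \<forall>k\<in>{1..n}. \<phi> (elem_sym R A n k b) = char_coeff R A n k b}"

definition poly_homs ::
    "('r, 'x) ring_scheme \<Rightarrow> ('r, 'a, 'y) module_scheme \<Rightarrow> nat \<Rightarrow> (nat \<Rightarrow> nat) set \<Rightarrow> 'a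
      \<Rightarrow> (((nat \<Rightarrow> nat \<Rightarrow> 'r) \<Rightarrow> 'r) set \<Rightarrow> 'r) set"
  where "poly_homs R A n G a =
    {\<psi> \<in> alg_hom R (tpower_inv R (UP R) n G) (self_alg R).
       \<forall>k\<in>{1..n}. \<psi> (elem_sym R (UP R) n k (monom (UP R) \<one>\<^bsub>R\<^esub> 1)) = char_coeff R A n k a}"

definition projection ::
    "('r, 'x) ring_scheme \<Rightarrow> ('r, 'a, 'y) module_scheme \<Rightarrow> nat \<Rightarrow> (nat \<Rightarrow> nat) set \<Rightarrow> 'a
      \<Rightarrow> ((nat \<Rightarrow> nat \<Rightarrow> 'r) \<Rightarrow> 'r) set \<Rightarrow> ((nat \<Rightarrow> 'a) \<Rightarrow> 'r) set"
  where "projection R A n G a =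
    restrict (tpower_map R (UP R) A n (eval_at R A a)) (carrier (tpower_inv R (UP R) n G))"

definition pull_back ::
    "('r, 'x) ring_scheme \<Rightarrow> ('r, 'a, 'y) module_scheme \<Rightarrow> nat \<Rightarrow> (nat \<Rightarrow> nat) set \<Rightarrow> 'a
      \<Rightarrow> (((nat \<Rightarrow> 'a) \<Rightarrow> 'r) set \<Rightarrow> 'r) \<Rightarrow> ((nat \<Rightarrow> nat \<Rightarrow> 'r) \<Rightarrow> 'r) set \<Rightarrow> 'r"
  where "pull_back R A n G a \<phi> =
    compose (carrier (tpower_inv R (UP R) n G)) \<phi> (projection R A n G a)"

end

theory Submission
  imports "Jordan_Normal_Form.Char_Poly" "HOL-Library.Poly_Mapping" Defs
begin

text \<open>Composition with the surjection \<open>R[x]\<^sup>\<otimes>\<^sup>n \<rightarrow> A\<^sup>\<otimes>\<^sup>n\<close> plainly turns closure data into homomorphisms of the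
  required kind.  It is injective because \<open>A\<close> is free over \<open>R\<close> (\<open>monogenic_ex_basis\<close>): an
  \<open>R\<close>-linear section \<open>s\<close> of \<open>R[x] \<rightarrow> A\<close> induces an \<open>R\<close>-linear section \<open>S\<close> of the map of tensor
  powers that commutes with all permutations, so the map of \<open>G\<close>-invariants is still surjective
  (\<open>hT_surj_invariants\<close>).

  Surjectivity needs the benign condition.  Let \<open>\<psi>\<close> be a homomorphism \<open>(R[x]\<^sup>\<otimes>\<^sup>n)\<^sup>G \<rightarrow> R\<close> that maps
  \<open>e\<^sub>k(x)\<close> to \<open>s\<^sub>k(a)\<close>, and let \<open>Q\<close> be the tensor product of \<open>R[x]\<^sup>\<otimes>\<^sup>n\<close> and \<open>R\<close> over \<open>(R[x]\<^sup>\<otimes>\<^sup>n)\<^sup>G\<close>,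
  with its maps \<open>i\<close> from \<open>R[x]\<^sup>\<otimes>\<^sup>n\<close> and \<open>j\<close> from \<open>R\<close>.  The pair being benign means that \<open>j\<close> is
  injective, so identities in \<open>R\<close> can be checked in \<open>Q\<close> (\<open>benign_splitting\<close>).  There
  \<open>q\<^sub>l = i (x\<^sup>(\<^sup>l\<^sup>))\<close> are elements whose elementary symmetric functions are \<open>j (s\<^sub>k(a))\<close>: the
  characteristic polynomial of \<open>a\<close> is \<open>(X - q\<^sub>1) \<dots> (X - q\<^sub>n)\<close> over \<open>Q\<close>.

  By Cayley--Hamilton this product vanishes at \<open>a\<close> in \<open>A \<otimes> Q\<close>.  Hence the values at \<open>a\<close> of the
  partial products \<open>(X - q\<^sub>1) \<dots> (X - q\<^sub>m)\<close> for \<open>m < n\<close> span \<open>A \<otimes> Q\<close>, and form a basis since there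
  are \<open>n\<close> of them.  In this basis multiplication by \<open>g(a)\<close>, for \<open>g \<in> R[x]\<close>, is triangular with diagonal
  \<open>g(q\<^sub>1), \<dots>, g(q\<^sub>n)\<close>, as successive division by \<open>X - q\<^sub>1, X - q\<^sub>2, \<dots>\<close> shows (\<open>triangularise\<close>).
  There are two consequences.
  \<^item> If \<open>g(a) = 0\<close>, then every \<open>g(q\<^sub>l)\<close> vanishes (\<open>roots_of_relations\<close>).  So \<open>i\<close> kills the kernel
    of \<open>R[x]\<^sup>\<otimes>\<^sup>n \<rightarrow> A\<^sup>\<otimes>\<^sup>n\<close>, and \<open>\<phi> = \<psi> \<circ> S\<close> is a homomorphism on \<open>(A\<^sup>\<otimes>\<^sup>n)\<^sup>G\<close> that \<open>\<psi>\<close> factors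
    through.
  \<^item> The \<open>s\<^sub>k(g(a))\<close> are the elementary symmetric functions of \<open>g(q\<^sub>1), \<dots>, g(q\<^sub>n)\<close>
    (\<open>char_poly_splits\<close>), that is \<open>i (e\<^sub>k(g))\<close>.  Hence \<open>\<phi> (e\<^sub>k(b)) = s\<^sub>k(b)\<close> for \<open>b = g(a)\<close>, an
    arbitrary element of \<open>A\<close>.

  Two points are specific to the formal setting.  The benign condition quantifies over algebras
  with carrier in \<open>(nat \<times> 'r) list\<close>, so \<open>R[x]\<^sup>\<otimes>\<^sup>n\<close> is first copied to that type
  (\<open>tpower_UP_enumeration\<close>, \<open>benign_extension\<close>).  Determinants are taken over rings with a
  carrier; their identities are inherited from a ring of class \<open>comm_ring_1\<close> that maps onto the
  ring in question (\<open>ex_class_hom\<close>).\<close>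

section \<open>Monoid algebras and linear extension\<close>

locale mon_alg = R?: cring R + M?: comm_monoid M
  for R :: "('r, 'x) ring_scheme" (structure) and M :: "('m, 'y) monoid_scheme" (structure) +
  fixes F :: "('r, 'm \<Rightarrow> 'r) module"
  defines F_def: "F \<equiv> monoid_algebra R M"
begin

abbreviation supp :: "('m \<Rightarrow> 'r) \<Rightarrow> 'm set"
  where "supp f \<equiv> {m. f m \<noteq> \<zero>\<^bsub>R\<^esub>}"

lemma in_F: "f \<in> carrier F \<longleftrightarrow> (\<forall>m. f m \<in> carrier R) \<and> supp f \<subseteq> carrier M \<and> finite (supp f)"
  by (auto simp: F_def monoid_algebra_def)

lemma F_val [simp]: "f \<in> carrier F \<Longrightarrow> f m \<in> carrier R"
  by (simp add: in_F)

lemma F_supp: "f \<in> carrier F \<Longrightarrow> supp f \<subseteq> carrier M" "f \<in> carrier F \<Longrightarrow> finite (supp f)"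
  by (simp_all add: in_F)

lemma F_ops:
  "f \<oplus>\<^bsub>F\<^esub> g = (\<lambda>m. f m \<oplus>\<^bsub>R\<^esub> g m)" "\<zero>\<^bsub>F\<^esub> = (\<lambda>m. \<zero>\<^bsub>R\<^esub>)" "s \<odot>\<^bsub>F\<^esub> f = (\<lambda>m. s \<otimes>\<^bsub>R\<^esub> f m)"
  "\<one>\<^bsub>F\<^esub> = basis_elt R \<one>\<^bsub>M\<^esub>"
  by (auto simp: F_def monoid_algebra_def basis_elt_def)

lemma basis_elt_closed [simp]: "m \<in> carrier M \<Longrightarrow> basis_elt R m \<in> carrier F"
  by (auto simp: in_F basis_elt_def intro: finite_subset[of _ "{m}"])

lemma F_add_closed: "f \<in> carrier F \<Longrightarrow> g \<in> carrier F \<Longrightarrow> f \<oplus>\<^bsub>F\<^esub> g \<in> carrier F"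
proof -
  assume f: "f \<in> carrier F" and g: "g \<in> carrier F"
  have sub: "supp (\<lambda>m. f m \<oplus>\<^bsub>R\<^esub> g m) \<subseteq> supp f \<union> supp g" by auto
  show ?thesis
    using f g finite_subset[OF sub] sub unfolding in_F F_ops by blast
qed

lemma F_smult_closed: "s \<in> carrier R \<Longrightarrow> f \<in> carrier F \<Longrightarrow> s \<odot>\<^bsub>F\<^esub> f \<in> carrier F"
proof -
  assume s: "s \<in> carrier R" and f: "f \<in> carrier F"
  have sub: "supp (\<lambda>m. s \<otimes>\<^bsub>R\<^esub> f m) \<subseteq> supp f" using s by auto
  show ?thesis
    using s f finite_subset[OF sub] sub unfolding in_F F_ops by blast
qed

lemma F_abelian_group: "abelian_group F"
proof (rule abelian_groupI)
  fix f assume f: "f \<in> carrier F"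
  have "(\<ominus>\<^bsub>R\<^esub> \<one>\<^bsub>R\<^esub>) \<odot>\<^bsub>F\<^esub> f \<in> carrier F" by (intro F_smult_closed f) simp
  moreover have "((\<ominus>\<^bsub>R\<^esub> \<one>\<^bsub>R\<^esub>) \<odot>\<^bsub>F\<^esub> f) \<oplus>\<^bsub>F\<^esub> f = \<zero>\<^bsub>F\<^esub>"
    using f by (auto simp: F_ops R.l_minus R.l_neg)
  ultimately show "\<exists>y\<in>carrier F. y \<oplus>\<^bsub>F\<^esub> f = \<zero>\<^bsub>F\<^esub>" by blast
qed (simp_all add: F_add_closed, auto simp: F_ops in_F R.a_ac)

lemma basis_induct [consumes 1, case_names zero basis add]:
  assumes "f \<in> carrier F"
    and zero: "P \<zero>\<^bsub>F\<^esub>"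
    and basis: "\<And>s m. s \<in> carrier R \<Longrightarrow> m \<in> carrier M \<Longrightarrow> P (s \<odot>\<^bsub>F\<^esub> basis_elt R m)"
    and add: "\<And>f g. f \<in> carrier F \<Longrightarrow> g \<in> carrier F \<Longrightarrow> P f \<Longrightarrow> P g \<Longrightarrow> P (f \<oplus>\<^bsub>F\<^esub> g)"
  shows "P f"
proof -
  have "finite S \<Longrightarrow> f \<in> carrier F \<Longrightarrow> supp f = S \<Longrightarrow> P f" for S f
  proof (induction S arbitrary: f rule: finite_induct)
    case empty
    then have "f = \<zero>\<^bsub>F\<^esub>" by (auto simp: F_ops)
    with zero show ?case by simp
  next
    case (insert x S)
    let ?g = "f(x := \<zero>\<^bsub>R\<^esub>)"
    have s: "supp ?g = S" using insert.hyps insert.prems(2) by auto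
    have g: "?g \<in> carrier F"
      unfolding in_F s using insert.hyps insert.prems unfolding in_F by auto
    have x: "x \<in> carrier M" using insert F_supp(1) by blast
    have eq: "f = ?g \<oplus>\<^bsub>F\<^esub> (f x \<odot>\<^bsub>F\<^esub> basis_elt R x)"
      using insert.prems(1) by (auto simp: F_ops basis_elt_def fun_eq_iff)
    show ?case
      by (subst eq) (intro add g F_smult_closed basis x basis_elt_closed
        insert.IH[OF g s] F_val insert.prems(1))
  qed
  then show ?thesis using assms(1) F_supp(2) by blast
qed

text \<open>The definition of the product sums over the pairs of support elements that multiply to \<open>m\<close>.  A
  sum over a fixed product of finite supersets of the supports lets products of different
  elements be compared term by term.\<close>

lemma F_mult_alt:
  assumes f: "f \<in> carrier F" and g: "g \<in> carrier F"
    and U: "finite U" "supp f \<subseteq> U" and W: "finite W" "supp g \<subseteq> W"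
  shows "(f \<otimes>\<^bsub>F\<^esub> g) m =
    (\<Oplus>\<^bsub>R\<^esub>p\<in>U \<times> W. if fst p \<otimes>\<^bsub>M\<^esub> snd p = m then f (fst p) \<otimes>\<^bsub>R\<^esub> g (snd p) else \<zero>\<^bsub>R\<^esub>)"
proof -
  have "(f \<otimes>\<^bsub>F\<^esub> g) m = (\<Oplus>\<^bsub>R\<^esub>p\<in>{(x, y). f x \<noteq> \<zero>\<^bsub>R\<^esub> \<and> g y \<noteq> \<zero>\<^bsub>R\<^esub> \<and> x \<otimes>\<^bsub>M\<^esub> y = m}.
                        f (fst p) \<otimes>\<^bsub>R\<^esub> g (snd p))"
    by (simp add: F_def monoid_algebra_def)
  also have "\<dots> = (\<Oplus>\<^bsub>R\<^esub>p\<in>U \<times> W. if fst p \<otimes>\<^bsub>M\<^esub> snd p = m then f (fst p) \<otimes>\<^bsub>R\<^esub> g (snd p) else \<zero>\<^bsub>R\<^esub>)"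
  proof (rule R.add.finprod_mono_neutral_cong_left)
    fix p assume "p \<in> U \<times> W - {(x, y). f x \<noteq> \<zero>\<^bsub>R\<^esub> \<and> g y \<noteq> \<zero>\<^bsub>R\<^esub> \<and> x \<otimes>\<^bsub>M\<^esub> y = m}"
    then have "fst p \<otimes>\<^bsub>M\<^esub> snd p \<noteq> m \<or> f (fst p) = \<zero>\<^bsub>R\<^esub> \<or> g (snd p) = \<zero>\<^bsub>R\<^esub>" by auto
    then show "(if fst p \<otimes>\<^bsub>M\<^esub> snd p = m then f (fst p) \<otimes>\<^bsub>R\<^esub> g (snd p) else \<zero>\<^bsub>R\<^esub>) = \<zero>\<^bsub>R\<^esub>"
      using f g by auto
  qed (use U W f g in auto)
  finally show ?thesis .
qed

lemma F_mult_closed: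
  assumes f: "f \<in> carrier F" and g: "g \<in> carrier F"
  shows "f \<otimes>\<^bsub>F\<^esub> g \<in> carrier F"
proof -
  note fs = F_supp[OF f] and gs = F_supp[OF g]
  note alt = F_mult_alt[OF f g fs(2) order_refl gs(2) order_refl]
  have 1: "(f \<otimes>\<^bsub>F\<^esub> g) m \<in> carrier R" for m
    unfolding alt by (rule R.finsum_closed) (use f g in auto)
  have sub: "supp (f \<otimes>\<^bsub>F\<^esub> g) \<subseteq> (\<lambda>p. fst p \<otimes>\<^bsub>M\<^esub> snd p) ` (supp f \<times> supp g)"
  proof
    fix m assume m: "m \<in> supp (f \<otimes>\<^bsub>F\<^esub> g)"
    show "m \<in> (\<lambda>p. fst p \<otimes>\<^bsub>M\<^esub> snd p) ` (supp f \<times> supp g)"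
    proof (rule ccontr)
      assume "m \<notin> (\<lambda>p. fst p \<otimes>\<^bsub>M\<^esub> snd p) ` (supp f \<times> supp g)"
      then have "(f \<otimes>\<^bsub>F\<^esub> g) m = \<zero>\<^bsub>R\<^esub>"
        unfolding alt by (intro R.add.finprod_one_eqI) (auto intro!: rev_image_eqI)
      with m show False by simp
    qed
  qed
  have "supp (f \<otimes>\<^bsub>F\<^esub> g) \<subseteq> carrier M" 
  proof (rule subset_trans[OF sub], safe)
    fix x y assume "f x \<noteq> \<zero>\<^bsub>R\<^esub>" "g y \<noteq> \<zero>\<^bsub>R\<^esub>"
    then have "x \<in> carrier M" "y \<in> carrier M" using fs gs by auto
    then show "fst (x, y) \<otimes>\<^bsub>M\<^esub> snd (x, y) \<in> carrier M" by simp
  qed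
  moreover have "finite (supp (f \<otimes>\<^bsub>F\<^esub> g))" by (rule finite_subset[OF sub]) (use fs gs in simp)
  ultimately show ?thesis using 1 unfolding in_F by blast
qed

lemma F_l_distr:
  assumes f: "f \<in> carrier F" and g: "g \<in> carrier F" and h: "h \<in> carrier F"
  shows "(f \<oplus>\<^bsub>F\<^esub> g) \<otimes>\<^bsub>F\<^esub> h = (f \<otimes>\<^bsub>F\<^esub> h) \<oplus>\<^bsub>F\<^esub> (g \<otimes>\<^bsub>F\<^esub> h)"
proof
  fix m
  let ?U = "supp f \<union> supp g"
  have U: "finite ?U" "supp f \<subseteq> ?U" "supp g \<subseteq> ?U" "supp (f \<oplus>\<^bsub>F\<^esub> g) \<subseteq> ?U"
    using f g F_supp by (auto simp: F_ops)
  have W: "finite (supp h)" "supp h \<subseteq> supp h" using h F_supp by auto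
  show "((f \<oplus>\<^bsub>F\<^esub> g) \<otimes>\<^bsub>F\<^esub> h) m = ((f \<otimes>\<^bsub>F\<^esub> h) \<oplus>\<^bsub>F\<^esub> (g \<otimes>\<^bsub>F\<^esub> h)) m"
    unfolding F_ops(1)[of "f \<otimes>\<^bsub>F\<^esub> h"] F_mult_alt[OF F_add_closed[OF f g] h U(1,4) W]
      F_mult_alt[OF f h U(1,2) W] F_mult_alt[OF g h U(1,3) W]
    by (subst R.finsum_addf[symmetric])
       (use f g h in \<open>auto simp: F_ops R.l_distr simp del: R.finsum_addf intro!: R.finsum_cong'\<close>)
qed

lemma F_r_distr:
  assumes f: "f \<in> carrier F" and g: "g \<in> carrier F" and h: "h \<in> carrier F"
  shows "h \<otimes>\<^bsub>F\<^esub> (f \<oplus>\<^bsub>F\<^esub> g) = (h \<otimes>\<^bsub>F\<^esub> f) \<oplus>\<^bsub>F\<^esub> (h \<otimes>\<^bsub>F\<^esub> g)"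
proof
  fix m
  let ?U = "supp f \<union> supp g"
  have U: "finite ?U" "supp f \<subseteq> ?U" "supp g \<subseteq> ?U" "supp (f \<oplus>\<^bsub>F\<^esub> g) \<subseteq> ?U"
    using f g F_supp by (auto simp: F_ops)
  have W: "finite (supp h)" "supp h \<subseteq> supp h" using h F_supp by auto
  show "(h \<otimes>\<^bsub>F\<^esub> (f \<oplus>\<^bsub>F\<^esub> g)) m = ((h \<otimes>\<^bsub>F\<^esub> f) \<oplus>\<^bsub>F\<^esub> (h \<otimes>\<^bsub>F\<^esub> g)) m"
    unfolding F_ops(1)[of "h \<otimes>\<^bsub>F\<^esub> f"] F_mult_alt[OF h F_add_closed[OF f g] W U(1,4)]
      F_mult_alt[OF h f W U(1,2)] F_mult_alt[OF h g W U(1,3)]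
    by (subst R.finsum_addf[symmetric])
       (use f g h in \<open>auto simp: F_ops R.r_distr simp del: R.finsum_addf intro!: R.finsum_cong'\<close>)
qed

lemma F_smult_mult:
  assumes s: "s \<in> carrier R" and f: "f \<in> carrier F" and g: "g \<in> carrier F"
  shows "(s \<odot>\<^bsub>F\<^esub> f) \<otimes>\<^bsub>F\<^esub> g = s \<odot>\<^bsub>F\<^esub> (f \<otimes>\<^bsub>F\<^esub> g)"
proof
  fix m
  have U: "finite (supp f)" "supp f \<subseteq> supp f" "supp (s \<odot>\<^bsub>F\<^esub> f) \<subseteq> supp f"
    using f s F_supp by (auto simp: F_ops)
  have W: "finite (supp g)" "supp g \<subseteq> supp g" using g F_supp by auto
  show "((s \<odot>\<^bsub>F\<^esub> f) \<otimes>\<^bsub>F\<^esub> g) m = (s \<odot>\<^bsub>F\<^esub> (f \<otimes>\<^bsub>F\<^esub> g)) m"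
    unfolding F_ops(3)[of s "f \<otimes>\<^bsub>F\<^esub> g"] F_mult_alt[OF F_smult_closed[OF s f] g U(1,3) W]
      F_mult_alt[OF f g U(1,2) W]
    by (subst R.finsum_rdistr)
       (use s f g U W in \<open>auto simp: F_ops R.m_assoc intro!: R.finsum_cong'\<close>)
qed

lemma F_basis_mult:
  assumes s: "s \<in> carrier R" "t \<in> carrier R" and x: "x \<in> carrier M" "y \<in> carrier M"
  shows "(s \<odot>\<^bsub>F\<^esub> basis_elt R x) \<otimes>\<^bsub>F\<^esub> (t \<odot>\<^bsub>F\<^esub> basis_elt R y)
       = (s \<otimes>\<^bsub>R\<^esub> t) \<odot>\<^bsub>F\<^esub> basis_elt R (x \<otimes>\<^bsub>M\<^esub> y)"
proof
  fix m
  have U: "finite {z}" "supp (s \<odot>\<^bsub>F\<^esub> basis_elt R z) \<subseteq> {z}" if "s \<in> carrier R" for s z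
    using that by (auto simp: F_ops basis_elt_def)
  have cl: "s \<odot>\<^bsub>F\<^esub> basis_elt R x \<in> carrier F" "t \<odot>\<^bsub>F\<^esub> basis_elt R y \<in> carrier F"
    using s x by (auto intro: F_smult_closed)
  show "((s \<odot>\<^bsub>F\<^esub> basis_elt R x) \<otimes>\<^bsub>F\<^esub> (t \<odot>\<^bsub>F\<^esub> basis_elt R y)) m
       = ((s \<otimes>\<^bsub>R\<^esub> t) \<odot>\<^bsub>F\<^esub> basis_elt R (x \<otimes>\<^bsub>M\<^esub> y)) m"
    unfolding F_mult_alt[OF cl U[OF s(1)] U[OF s(2)]]
    using s by (auto simp: F_ops basis_elt_def)
qed

text \<open>Commutativity and associativity are multilinear identities and need only be checked on
  multiples of basis elements, where they hold in \<open>M\<close>.\<close>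

lemma F_m_comm:
  assumes "f \<in> carrier F" "g \<in> carrier F"
  shows "f \<otimes>\<^bsub>F\<^esub> g = g \<otimes>\<^bsub>F\<^esub> f"
proof -
  interpret F: abelian_group F by (rule F_abelian_group)
  have z: "\<zero>\<^bsub>F\<^esub> = \<zero>\<^bsub>R\<^esub> \<odot>\<^bsub>F\<^esub> basis_elt R \<one>\<^bsub>M\<^esub>" by (auto simp: F_ops basis_elt_def)
  have b: "f \<otimes>\<^bsub>F\<^esub> (t \<odot>\<^bsub>F\<^esub> basis_elt R y) = (t \<odot>\<^bsub>F\<^esub> basis_elt R y) \<otimes>\<^bsub>F\<^esub> f"
    if "f \<in> carrier F" "t \<in> carrier R" "y \<in> carrier M" for f t y
    using that(1)
  proof (induction f rule: basis_induct)
    case zero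
    then show ?case unfolding z by (simp add: F_basis_mult that R.m_comm M.m_comm)
  next
    case (basis s m)
    then show ?case by (simp add: F_basis_mult that R.m_comm M.m_comm)
  next
    case (add f g)
    then show ?case by (simp add: F_l_distr F_r_distr that F_smult_closed)
  qed
  show ?thesis using assms(2)
  proof (induction g rule: basis_induct)
    case zero
    then show ?case unfolding z by (rule b) (use assms in auto)
  next
    case (basis s m)
    then show ?case using b assms by blast
  next
    case (add f' g)
    then show ?case by (simp add: F_l_distr F_r_distr assms(1))
  qed
qed

lemma F_m_assoc:
  assumes "f \<in> carrier F" "g \<in> carrier F" "h \<in> carrier F"
  shows "(f \<otimes>\<^bsub>F\<^esub> g) \<otimes>\<^bsub>F\<^esub> h = f \<otimes>\<^bsub>F\<^esub> (g \<otimes>\<^bsub>F\<^esub> h)"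
proof -
  have z: "\<zero>\<^bsub>F\<^esub> = \<zero>\<^bsub>R\<^esub> \<odot>\<^bsub>F\<^esub> basis_elt R \<one>\<^bsub>M\<^esub>" by (auto simp: F_ops basis_elt_def)
  note simps = F_basis_mult F_l_distr F_r_distr F_smult_closed F_mult_closed R.m_assoc M.m_assoc
  have b: "(f \<otimes>\<^bsub>F\<^esub> (s \<odot>\<^bsub>F\<^esub> basis_elt R x)) \<otimes>\<^bsub>F\<^esub> (t \<odot>\<^bsub>F\<^esub> basis_elt R y)
      = f \<otimes>\<^bsub>F\<^esub> ((s \<odot>\<^bsub>F\<^esub> basis_elt R x) \<otimes>\<^bsub>F\<^esub> (t \<odot>\<^bsub>F\<^esub> basis_elt R y))"
    if "f \<in> carrier F" "s \<in> carrier R" "t \<in> carrier R" "x \<in> carrier M" "y \<in> carrier M" for f s t x y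
    using that(1)
  proof (induction f rule: basis_induct)
    case zero
    then show ?case unfolding z using that by (simp add: simps)
  next
    case (basis s m)
    then show ?case using that by (simp add: simps)
  next
    case (add f g)
    then show ?case using that by (simp add: simps del: F_basis_mult)
  qed
  have c: "(f \<otimes>\<^bsub>F\<^esub> g) \<otimes>\<^bsub>F\<^esub> (t \<odot>\<^bsub>F\<^esub> basis_elt R y) = f \<otimes>\<^bsub>F\<^esub> (g \<otimes>\<^bsub>F\<^esub> (t \<odot>\<^bsub>F\<^esub> basis_elt R y))"
    if "g \<in> carrier F" "f \<in> carrier F" "t \<in> carrier R" "y \<in> carrier M" for f g t y
    using that(1)
  proof (induction g rule: basis_induct)
    case zero
    then show ?case unfolding z using that by (intro b) auto
  next
    case (basis s m)
    then show ?case using that by (intro b) auto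
  next
    case (add g h)
    then show ?case using that by (simp add: simps)
  qed
  show ?thesis using assms(3)
  proof (induction h rule: basis_induct)
    case zero
    then show ?case unfolding z using assms by (intro c) auto
  next
    case (basis s m)
    then show ?case using assms by (intro c) auto
  next
    case (add g h)
    then show ?case using assms by (simp add: simps)
  qed
qed

lemma F_one_closed: "\<one>\<^bsub>F\<^esub> \<in> carrier F" by (simp add: F_ops)

lemma F_smult_one: "f \<in> carrier F \<Longrightarrow> \<one>\<^bsub>R\<^esub> \<odot>\<^bsub>F\<^esub> f = f"
  by (auto simp: F_ops)

lemma F_l_one:
  assumes "f \<in> carrier F"
  shows "\<one>\<^bsub>F\<^esub> \<otimes>\<^bsub>F\<^esub> f = f"
proof -
  have z: "\<zero>\<^bsub>F\<^esub> = \<zero>\<^bsub>R\<^esub> \<odot>\<^bsub>F\<^esub> basis_elt R \<one>\<^bsub>M\<^esub>" by (auto simp: F_ops basis_elt_def)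
  have o: "\<one>\<^bsub>F\<^esub> = \<one>\<^bsub>R\<^esub> \<odot>\<^bsub>F\<^esub> basis_elt R \<one>\<^bsub>M\<^esub>" by (auto simp: F_ops basis_elt_def)
  show ?thesis using assms
  proof (induction f rule: basis_induct)
    case zero
    then show ?case unfolding z o by (simp add: F_basis_mult)
  next
    case (basis s m)
    then show ?case unfolding z o by (simp add: F_basis_mult)
  next
    case (add f g)
    then show ?case by (simp add: F_r_distr F_one_closed)
  qed
qed

theorem F_algebra: "algebra R F"
proof (rule algebraI)
  show "cring F"
    by (rule cringI[OF F_abelian_group comm_monoidI])
       (simp_all add: F_mult_closed F_one_closed F_m_assoc F_l_one F_l_distr, rule F_m_comm)
qed (simp_all add: F_smult_closed F_smult_mult F_smult_one R.is_cring,
     auto simp: F_ops R.l_distr R.r_distr R.m_assoc)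

sublocale F: algebra R F by (rule F_algebra)

lemma basis_mult:
  assumes "x \<in> carrier M" "y \<in> carrier M"
  shows "basis_elt R x \<otimes>\<^bsub>F\<^esub> basis_elt R y = basis_elt R (x \<otimes>\<^bsub>M\<^esub> y)"
  using F_basis_mult[of "\<one>\<^bsub>R\<^esub>" "\<one>\<^bsub>R\<^esub>" x y] assms by (simp add: F_smult_one)

end

definition lin_ext ::
    "('r, 'x) ring_scheme \<Rightarrow> ('r, 'd, 'z) module_scheme \<Rightarrow> ('m \<Rightarrow> 'd) \<Rightarrow> ('m \<Rightarrow> 'r) \<Rightarrow> 'd"
  where "lin_ext R D \<Phi> f = (\<Oplus>\<^bsub>D\<^esub>m\<in>{m. f m \<noteq> \<zero>\<^bsub>R\<^esub>}. f m \<odot>\<^bsub>D\<^esub> \<Phi> m)"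

locale mon_alg_ext = mon_alg R M F + D?: Module.module R D
  for R :: "('r, 'x) ring_scheme" (structure) and M :: "('m, 'y) monoid_scheme" (structure)
    and F and D :: "('r, 'd, 'z) module_scheme" (structure) +
  fixes \<Phi> :: "'m \<Rightarrow> 'd"
  assumes Phi_closed: "\<Phi> \<in> carrier M \<rightarrow> carrier D"
begin

abbreviation L where "L \<equiv> lin_ext R D \<Phi>"

lemma Phi_in [simp]: "m \<in> carrier M \<Longrightarrow> \<Phi> m \<in> carrier D"
  using Phi_closed by blast

lemma lin_ext_alt:
  assumes "f \<in> carrier F" "finite U" "supp f \<subseteq> U" "U \<subseteq> carrier M"
  shows "L f = (\<Oplus>\<^bsub>D\<^esub>m\<in>U. f m \<odot>\<^bsub>D\<^esub> \<Phi> m)"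
  unfolding lin_ext_def
  by (rule D.M.add.finprod_mono_neutral_cong_left) (use assms in \<open>auto simp: subset_iff\<close>)

lemma lin_ext_closed: "f \<in> carrier F \<Longrightarrow> L f \<in> carrier D"
  unfolding lin_ext_def using F_supp[of f] by (intro D.M.finsum_closed) auto

lemma lin_ext_add:
  assumes f: "f \<in> carrier F" and g: "g \<in> carrier F"
  shows "L (f \<oplus>\<^bsub>F\<^esub> g) = L f \<oplus>\<^bsub>D\<^esub> L g"
proof -
  let ?U = "supp f \<union> supp g"
  have U: "finite ?U" "supp f \<subseteq> ?U" "supp g \<subseteq> ?U" "supp (f \<oplus>\<^bsub>F\<^esub> g) \<subseteq> ?U" "?U \<subseteq> carrier M"
    using f g F_supp by (auto simp: F_ops)
  show ?thesis
    unfolding lin_ext_alt[OF F_add_closed[OF f g] U(1,4,5)] lin_ext_alt[OF f U(1,2,5)]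
      lin_ext_alt[OF g U(1,3,5)]
    by (subst D.M.finsum_addf[symmetric])
       (use f g U(5) in \<open>auto simp: F_ops D.smult_l_distr subset_iff simp del: D.M.finsum_addf intro!: D.M.finsum_cong'\<close>)
qed

lemma lin_ext_smult:
  assumes s: "s \<in> carrier R" and f: "f \<in> carrier F"
  shows "L (s \<odot>\<^bsub>F\<^esub> f) = s \<odot>\<^bsub>D\<^esub> L f"
proof -
  let ?U = "supp f"
  have U: "finite ?U" "supp f \<subseteq> ?U" "supp (s \<odot>\<^bsub>F\<^esub> f) \<subseteq> ?U" "?U \<subseteq> carrier M"
    using f s F_supp by (auto simp: F_ops)
  show ?thesis
    unfolding lin_ext_alt[OF F_smult_closed[OF s f] U(1,3,4)] lin_ext_alt[OF f U(1,2,4)]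
    by (subst D.finsum_smult_ldistr)
       (use s f U in \<open>auto simp: F_ops D.smult_assoc1 subset_iff intro!: D.M.finsum_cong'\<close>)
qed

lemma lin_ext_basis:
  assumes "m \<in> carrier M"
  shows "L (basis_elt R m) = \<Phi> m"
proof -
  have "L (basis_elt R m) = (\<Oplus>\<^bsub>D\<^esub>x\<in>{m}. basis_elt R m x \<odot>\<^bsub>D\<^esub> \<Phi> x)"
    by (rule lin_ext_alt[OF basis_elt_closed[OF assms]]) (use assms in \<open>auto simp: basis_elt_def\<close>)
  then show ?thesis using assms by (simp add: basis_elt_def)
qed

lemma lin_ext_zero: "L \<zero>\<^bsub>F\<^esub> = \<zero>\<^bsub>D\<^esub>"
  by (simp add: lin_ext_def F_ops)

lemma lin_ext_minus:
  assumes "f \<in> carrier F" "g \<in> carrier F"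
  shows "L (f \<ominus>\<^bsub>F\<^esub> g) = L f \<ominus>\<^bsub>D\<^esub> L g"
proof -
  have "L (f \<ominus>\<^bsub>F\<^esub> g) \<oplus>\<^bsub>D\<^esub> L g = L f"
    using assms by (subst lin_ext_add[symmetric]) (auto simp: F.minus_eq F.a_assoc F.l_neg)
  then show ?thesis
    using assms lin_ext_closed
    by (metis D.M.add.inv_solve_right D.M.minus_eq F.minus_closed)
qed

lemma lin_ext_mult:
  assumes D: "algebra R D"
    and mult: "\<And>x y. x \<in> carrier M \<Longrightarrow> y \<in> carrier M \<Longrightarrow> \<Phi> (x \<otimes>\<^bsub>M\<^esub> y) = \<Phi> x \<otimes>\<^bsub>D\<^esub> \<Phi> y"
    and "f \<in> carrier F" "g \<in> carrier F"
  shows "L (f \<otimes>\<^bsub>F\<^esub> g) = L f \<otimes>\<^bsub>D\<^esub> L g"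
proof -
  interpret D: algebra R D by (rule D)
  note simps = lin_ext_add lin_ext_smult lin_ext_closed lin_ext_zero lin_ext_basis
    F_basis_mult D.l_distr D.r_distr F.l_distr F.r_distr mult
  have b: "L (f \<otimes>\<^bsub>F\<^esub> (t \<odot>\<^bsub>F\<^esub> basis_elt R y)) = L f \<otimes>\<^bsub>D\<^esub> L (t \<odot>\<^bsub>F\<^esub> basis_elt R y)"
    if "f \<in> carrier F" "t \<in> carrier R" "y \<in> carrier M" for f t y
    using that(1)
  proof (induction f rule: basis_induct)
    case (basis s m)
    then have "s \<odot>\<^bsub>D\<^esub> \<Phi> m \<otimes>\<^bsub>D\<^esub> (t \<odot>\<^bsub>D\<^esub> \<Phi> y) = s \<odot>\<^bsub>D\<^esub> (t \<odot>\<^bsub>D\<^esub> (\<Phi> m \<otimes>\<^bsub>D\<^esub> \<Phi> y))"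
      using that by (metis D.m_comm D.smult_assoc2 D.smult_closed Phi_in)
    then show ?case using basis that by (simp add: simps D.smult_assoc1)
  qed (use that in \<open>simp_all add: simps\<close>)
  show ?thesis using assms(4)
  proof (induction g rule: basis_induct)
    case (basis s m)
    then show ?case by (intro b assms)
  qed (use assms(3) in \<open>simp_all add: simps\<close>)
qed

end

section \<open>Quotients of algebras\<close>

lemma cring_same_ops:
  assumes C: "cring C" and eq: "carrier D = carrier C" "\<And>x y. x \<otimes>\<^bsub>D\<^esub> y = x \<otimes>\<^bsub>C\<^esub> y" "\<one>\<^bsub>D\<^esub> = \<one>\<^bsub>C\<^esub>"
    "\<And>x y. x \<oplus>\<^bsub>D\<^esub> y = x \<oplus>\<^bsub>C\<^esub> y" "\<zero>\<^bsub>D\<^esub> = \<zero>\<^bsub>C\<^esub>"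
  shows "cring D"
proof -
  interpret C: cring C by (rule C)
  have "\<exists>y\<in>carrier C. y \<oplus>\<^bsub>C\<^esub> x = \<zero>\<^bsub>C\<^esub>" if "x \<in> carrier C" for x
    using that C.l_neg by blast
  then show ?thesis
    by (intro cringI abelian_groupI comm_monoidI)
       (auto simp: eq C.a_ac C.m_ac C.l_distr C.r_distr)
qed

lemma alg_via_simps [simp]:
  "carrier (alg_via C \<theta>) = carrier C" "x \<otimes>\<^bsub>alg_via C \<theta>\<^esub> y = x \<otimes>\<^bsub>C\<^esub> y" "\<one>\<^bsub>alg_via C \<theta>\<^esub> = \<one>\<^bsub>C\<^esub>"
  "x \<oplus>\<^bsub>alg_via C \<theta>\<^esub> y = x \<oplus>\<^bsub>C\<^esub> y" "\<zero>\<^bsub>alg_via C \<theta>\<^esub> = \<zero>\<^bsub>C\<^esub>" "s \<odot>\<^bsub>alg_via C \<theta>\<^esub> x = \<theta> s \<otimes>\<^bsub>C\<^esub> x"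
  by (simp_all add: alg_via_def)

lemma alg_via_algebra:
  assumes "cring S" "cring C" and \<theta>: "\<theta> \<in> ring_hom S C"
  shows "algebra S (alg_via C \<theta>)"
proof -
  interpret C: cring C by fact
  show ?thesis
    using assms(1) cring_same_ops[OF assms(2), of "alg_via C \<theta>"]
      ring_hom_closed[OF \<theta>] ring_hom_mult[OF \<theta>] ring_hom_add[OF \<theta>] ring_hom_one[OF \<theta>]
    by (intro algebraI) (simp_all add: C.l_distr C.r_distr C.m_assoc)
qed

lemma (in ring) mult_minus_distr:
  "x \<in> carrier R \<Longrightarrow> y \<in> carrier R \<Longrightarrow> z \<in> carrier R \<Longrightarrow> z \<otimes> (x \<ominus> y) = z \<otimes> x \<ominus> z \<otimes> y"
  by (simp add: minus_eq r_distr r_minus)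

lemma (in abelian_group) minus_zero_iff:
  "x \<in> carrier G \<Longrightarrow> y \<in> carrier G \<Longrightarrow> x \<ominus> y = \<zero> \<longleftrightarrow> x = y"
  by (metis add.inv_solve_right' l_zero minus_eq zero_closed)

lemma (in algebra) structure_hom: "(\<lambda>r. r \<odot>\<^bsub>M\<^esub> \<one>\<^bsub>M\<^esub>) \<in> ring_hom R M"
proof (rule ring_hom_memI)
  fix x y assume "x \<in> carrier R" "y \<in> carrier R"
  then show "(x \<otimes>\<^bsub>R\<^esub> y) \<odot>\<^bsub>M\<^esub> \<one>\<^bsub>M\<^esub> = (x \<odot>\<^bsub>M\<^esub> \<one>\<^bsub>M\<^esub>) \<otimes>\<^bsub>M\<^esub> (y \<odot>\<^bsub>M\<^esub> \<one>\<^bsub>M\<^esub>)"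
    by (simp add: smult_assoc2 smult_assoc1)
qed (simp_all add: smult_l_distr)

locale quot_alg = F?: algebra R F + ideal I F
  for R :: "('r, 'x) ring_scheme" (structure) and F :: "('r, 'f, 'y) module_scheme" (structure) and I
begin

abbreviation Q where "Q \<equiv> alg_quot F I"
abbreviation q where "q x \<equiv> I +>\<^bsub>F\<^esub> x"

lemma quot_fields:
  "carrier Q = carrier (F Quot I)" "x \<otimes>\<^bsub>Q\<^esub> y = x \<otimes>\<^bsub>F Quot I\<^esub> y" "\<one>\<^bsub>Q\<^esub> = \<one>\<^bsub>F Quot I\<^esub>"
  "x \<oplus>\<^bsub>Q\<^esub> y = x \<oplus>\<^bsub>F Quot I\<^esub> y" "\<zero>\<^bsub>Q\<^esub> = \<zero>\<^bsub>F Quot I\<^esub>"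
  "s \<odot>\<^bsub>Q\<^esub> x = q (s \<odot>\<^bsub>F\<^esub> \<one>\<^bsub>F\<^esub>) \<otimes>\<^bsub>F Quot I\<^esub> x"
  by (simp_all add: alg_quot_def)

lemma quot_algebra: "algebra R Q"
proof -
  have "q \<circ> (\<lambda>r. r \<odot>\<^bsub>F\<^esub> \<one>\<^bsub>F\<^esub>) \<in> ring_hom R (F Quot I)"
    by (rule ring_hom_trans[OF F.structure_hom rcos_ring_hom])
  then show ?thesis
    unfolding alg_quot_def
    by (intro alg_via_algebra F.R_cring quotient_is_cring F.M_cring) (simp add: comp_def)
qed

sublocale Q: algebra R Q by (rule quot_algebra)

lemma q_hom: "q \<in> ring_hom F Q"
  using rcos_ring_hom by (simp add: ring_hom_def quot_fields)

lemma q_closed [simp]: "x \<in> carrier F \<Longrightarrow> q x \<in> carrier Q"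
  by (rule ring_hom_closed[OF q_hom])

lemma q_add: "x \<in> carrier F \<Longrightarrow> y \<in> carrier F \<Longrightarrow> q (x \<oplus>\<^bsub>F\<^esub> y) = q x \<oplus>\<^bsub>Q\<^esub> q y"
  by (rule ring_hom_add[OF q_hom])

lemma q_mult: "x \<in> carrier F \<Longrightarrow> y \<in> carrier F \<Longrightarrow> q (x \<otimes>\<^bsub>F\<^esub> y) = q x \<otimes>\<^bsub>Q\<^esub> q y"
  by (rule ring_hom_mult[OF q_hom])

lemma q_one: "q \<one>\<^bsub>F\<^esub> = \<one>\<^bsub>Q\<^esub>"
  by (rule ring_hom_one[OF q_hom])

lemma q_zero: "q \<zero>\<^bsub>F\<^esub> = \<zero>\<^bsub>Q\<^esub>"
  by (rule ring_hom_zero[OF q_hom F.ring_axioms Q.ring_axioms])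

lemma q_smult: "s \<in> carrier R \<Longrightarrow> x \<in> carrier F \<Longrightarrow> q (s \<odot>\<^bsub>F\<^esub> x) = s \<odot>\<^bsub>Q\<^esub> q x"
  unfolding quot_fields(6) quot_fields(2)[symmetric]
  by (simp add: q_mult[symmetric] F.smult_assoc2)

lemma q_surj: "z \<in> carrier Q \<Longrightarrow> \<exists>x\<in>carrier F. z = q x"
  by (auto simp: quot_fields FactRing_simps)

lemma q_eq:
  assumes "x \<in> carrier F" "y \<in> carrier F"
  shows "q x = q y \<longleftrightarrow> x \<ominus>\<^bsub>F\<^esub> y \<in> I"
proof -
  have "q (x \<ominus>\<^bsub>F\<^esub> y) = I \<longleftrightarrow> x \<ominus>\<^bsub>F\<^esub> y \<in> I"
    using assms abelian_group.a_coset_join1[OF F.is_abelian_group, of I "x \<ominus>\<^bsub>F\<^esub> y"] abelian_group.a_coset_join2[OF F.is_abelian_group, of "x \<ominus>\<^bsub>F\<^esub> y" I] a_subgroup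
    by auto
  moreover have "q (x \<ominus>\<^bsub>F\<^esub> y) = I \<longleftrightarrow> q x = q y"
    using assms abelian_group.a_coset_add_inv1[OF F.is_abelian_group, of I x y] abelian_group.a_coset_add_inv2[OF F.is_abelian_group, of I x y] a_subset
    by (auto simp: a_minus_def)
  ultimately show ?thesis by simp
qed

lemma q_mem: "x \<in> carrier F \<Longrightarrow> f \<in> q x \<Longrightarrow> f \<in> carrier F \<and> q f = q x"
  using abelian_group.a_repr_independence[OF F.is_abelian_group, of f I x] a_subgroup abelian_monoid.a_r_coset_subset_G[OF abelian_group.axioms(1)[OF F.is_abelian_group], of I x] a_subset by auto

lemma q_self: "x \<in> carrier F \<Longrightarrow> x \<in> q x"
  by (rule a_rcos_self)

text \<open>Maps on quotients are given by their values on representatives, with \<open>the_elem\<close> extracting the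
  common value; this lemma computes them.\<close>

lemma the_elem_quot:
  assumes "x \<in> carrier F" and "\<And>y. y \<in> carrier F \<Longrightarrow> q y = q x \<Longrightarrow> h y = h x"
  shows "the_elem (h ` q x) = h x"
proof -
  have "h ` q x = {h x}"
    using assms q_mem[of x] q_self[of x] by blast
  then show ?thesis by simp
qed

end

section \<open>Tensor powers\<close>

text \<open>The simplifier would otherwise unfold the structure of the monoid of tuples, and rewrite the
  index range, before the lemmas on pure tensors can match.\<close>

declare One_nat_def [simp del] carrier_product_group [simp del] mult_product_group [simp del]
  one_product_group [simp del]

lemmas tuples_simps = carrier_product_group mult_product_group one_product_group

lemma tuples_comm_monoid:
  assumes "cring C"
  shows "comm_monoid (product_group J (\<lambda>_. C))"
proof -
  interpret C: cring C by fact
  show ?thesis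
    by (rule comm_monoidI) (auto simp: tuples_simps C.m_ac PiE_iff extensional_def fun_eq_iff restrict_def)
qed

locale tpow = C?: algebra R C for R :: "('r, 'x) ring_scheme" (structure)
    and C :: "('r, 'c, 'y) module_scheme" (structure) + fixes n :: nat
begin

abbreviation "M \<equiv> tuples C n"
abbreviation "F \<equiv> monoid_algebra R M"
abbreviation "J \<equiv> tpower_ideal R C n"
abbreviation "T \<equiv> tpower R C n"
abbreviation "pt \<equiv> pure_tensor R C n"

sublocale mon: mon_alg R M F
  by (intro mon_alg.intro C.R_cring tuples_comm_monoid C.M_cring) simp_all

lemma upd_closed [simp]: "t \<in> carrier M \<Longrightarrow> i \<in> {1..n} \<Longrightarrow> u \<in> carrier C \<Longrightarrow> t(i := u) \<in> carrier M"
  by (auto simp: tuples_simps PiE_iff extensional_def)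

lemma rels_closed: "multilinear_rels R C n \<subseteq> carrier F"
proof -
  have "basis_elt R t \<in> carrier F" if "t \<in> carrier M" for t using that by (rule mon.basis_elt_closed)
  then show ?thesis
    unfolding multilinear_rels_def Let_def
    by (auto intro!: mon.F.minus_closed mon.F.a_closed mon.F.smult_closed)
qed

sublocale quo: quot_alg R F J
  by (intro quot_alg.intro mon.F_algebra)
     (simp add: tpower_ideal_def mon.F.genideal_ideal[OF rels_closed])

lemma T_eq: "alg_quot F J = T" by (simp add: tpower_def)

sublocale T: algebra R T using quo.quot_algebra unfolding T_eq .

lemmas q_add = quo.q_add[unfolded T_eq] and q_mult = quo.q_mult[unfolded T_eq]
  and q_one = quo.q_one[unfolded T_eq] and q_zero = quo.q_zero[unfolded T_eq]
  and q_smult = quo.q_smult[unfolded T_eq] and q_surj = quo.q_surj[unfolded T_eq]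
  and q_closed = quo.q_closed[unfolded T_eq] and q_hom = quo.q_hom[unfolded T_eq]

lemma pt_eq: "pt t = J +>\<^bsub>F\<^esub> basis_elt R t" by (simp add: pure_tensor_def)

lemma pt_closed [simp]: "t \<in> carrier M \<Longrightarrow> pt t \<in> carrier T"
  unfolding pt_eq by (intro q_closed mon.basis_elt_closed)

lemma rel_in_ideal: "x \<in> multilinear_rels R C n \<Longrightarrow> x \<in> J"
  using mon.F.genideal_self[OF rels_closed] by (auto simp: tpower_ideal_def)

lemma pt_add:
  assumes "t \<in> carrier M" "i \<in> {1..n}" "u \<in> carrier C" "v \<in> carrier C"
  shows "pt (t(i := u \<oplus>\<^bsub>C\<^esub> v)) = pt (t(i := u)) \<oplus>\<^bsub>T\<^esub> pt (t(i := v))"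
proof -
  have cl: "basis_elt R (t(i := w)) \<in> carrier F" if "w \<in> carrier C" for w
    by (intro mon.basis_elt_closed upd_closed assms that)
  have "basis_elt R (t(i := u \<oplus>\<^bsub>C\<^esub> v)) \<ominus>\<^bsub>F\<^esub> (basis_elt R (t(i := u)) \<oplus>\<^bsub>F\<^esub> basis_elt R (t(i := v))) \<in> J"
    by (rule rel_in_ideal) (use assms in \<open>unfold multilinear_rels_def Let_def, blast\<close>)
  then show ?thesis
    unfolding pt_eq using cl assms by (subst q_add[symmetric]) (auto simp: quo.q_eq)
qed

lemma pt_smult:
  assumes "t \<in> carrier M" "i \<in> {1..n}" "r \<in> carrier R" "u \<in> carrier C"
  shows "pt (t(i := r \<odot>\<^bsub>C\<^esub> u)) = r \<odot>\<^bsub>T\<^esub> pt (t(i := u))"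
proof -
  have cl: "basis_elt R (t(i := w)) \<in> carrier F" if "w \<in> carrier C" for w
    by (intro mon.basis_elt_closed upd_closed assms that)
  have "basis_elt R (t(i := r \<odot>\<^bsub>C\<^esub> u)) \<ominus>\<^bsub>F\<^esub> (r \<odot>\<^bsub>F\<^esub> basis_elt R (t(i := u))) \<in> J"
    by (rule rel_in_ideal) (use assms in \<open>unfold multilinear_rels_def Let_def, blast\<close>)
  then show ?thesis
    unfolding pt_eq using cl assms by (subst q_smult[symmetric]) (auto simp: quo.q_eq)
qed

lemma pt_mult:
  assumes "t \<in> carrier M" "t' \<in> carrier M"
  shows "pt t \<otimes>\<^bsub>T\<^esub> pt t' = pt (t \<otimes>\<^bsub>M\<^esub> t')"
  unfolding pt_eq mon.basis_mult[OF assms, symmetric]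
  by (rule q_mult[symmetric]) (use assms in simp_all)

lemma pt_one: "pt \<one>\<^bsub>M\<^esub> = \<one>\<^bsub>T\<^esub>"
  unfolding pt_eq mon.F_ops(4)[symmetric] by (rule q_one)

text \<open>Identities of linear maps on a tensor power can be checked on multiples of pure tensors.\<close>

lemma tpow_induct [consumes 1, case_names zero pure add]:
  assumes "z \<in> carrier T"
    and zero: "P \<zero>\<^bsub>T\<^esub>"
    and basis: "\<And>s t. s \<in> carrier R \<Longrightarrow> t \<in> carrier M \<Longrightarrow> P (s \<odot>\<^bsub>T\<^esub> pt t)"
    and add: "\<And>x y. x \<in> carrier T \<Longrightarrow> y \<in> carrier T \<Longrightarrow> P x \<Longrightarrow> P y \<Longrightarrow> P (x \<oplus>\<^bsub>T\<^esub> y)"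
  shows "P z"
proof -
  obtain f where f: "f \<in> carrier F" and z: "z = J +>\<^bsub>F\<^esub> f" using q_surj assms(1) by blast
  have "P (J +>\<^bsub>F\<^esub> f)" using f
  proof (induction f rule: mon.basis_induct)
    case zero
    then show ?case using assms(2) by (simp add: q_zero)
  next
    case (basis s m)
    then show ?case using assms(3)[of s m]
      by (simp add: q_smult mon.basis_elt_closed pt_eq)
  next
    case (add f g)
    then show ?case using assms(4) by (simp add: q_add q_closed)
  qed
  then show ?thesis by (simp add: z)
qed

end

text \<open>The linear map on a tensor power that a multilinear map on tuples induces, evaluated on
  representatives.\<close>

definition tensor_ext ::
    "('r, 'x) ring_scheme \<Rightarrow> ('r, 'd, 'z) module_scheme \<Rightarrow> ('m \<Rightarrow> 'd) \<Rightarrow> ('m \<Rightarrow> 'r) set \<Rightarrow> 'd"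
  where "tensor_ext R D \<Phi> Z = the_elem (lin_ext R D \<Phi> ` Z)"

locale tpow_ext = tpow R C n + D?: Module.module R D
  for R :: "('r, 'x) ring_scheme" (structure) and C :: "('r, 'c, 'y) module_scheme" (structure)
    and n :: nat and D :: "('r, 'd, 'z) module_scheme" (structure) +
  fixes \<Phi> :: "(nat \<Rightarrow> 'c) \<Rightarrow> 'd"
  assumes Phi_closed: "\<Phi> \<in> carrier (tuples C n) \<rightarrow> carrier D"
    and Phi_add: "\<And>t i u v. t \<in> carrier (tuples C n) \<Longrightarrow> i \<in> {1..n} \<Longrightarrow> u \<in> carrier C \<Longrightarrow> v \<in> carrier C \<Longrightarrow>
      \<Phi> (t(i := u \<oplus>\<^bsub>C\<^esub> v)) = \<Phi> (t(i := u)) \<oplus>\<^bsub>D\<^esub> \<Phi> (t(i := v))"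
    and Phi_smult: "\<And>t i r u. t \<in> carrier (tuples C n) \<Longrightarrow> i \<in> {1..n} \<Longrightarrow> r \<in> carrier R \<Longrightarrow> u \<in> carrier C \<Longrightarrow>
      \<Phi> (t(i := r \<odot>\<^bsub>C\<^esub> u)) = r \<odot>\<^bsub>D\<^esub> \<Phi> (t(i := u))"
begin

sublocale ext: mon_alg_ext R M F D \<Phi>
  by (intro mon_alg_ext.intro mon.mon_alg_axioms mon_alg_ext_axioms.intro Phi_closed D.module_axioms)

text \<open>The ideal consists of combinations of products of basis elements with relations.  Such a product is
  again a relation, because multiplication of tuples is
  componentwise; so multilinearity of \<open>\<Phi>\<close> applies to it.\<close>

lemma basis_times_rel:
  assumes t': "t' \<in> carrier M" and x: "x \<in> multilinear_rels R C n"
  shows "lin_ext R D \<Phi> (basis_elt R t' \<otimes>\<^bsub>F\<^esub> x) = \<zero>\<^bsub>D\<^esub>"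
proof -
  have cl: "basis_elt R t \<in> carrier F" if "t \<in> carrier M" for t
    by (intro mon.basis_elt_closed that)
  have up: "t' \<otimes>\<^bsub>M\<^esub> (t(i := w)) = (t' \<otimes>\<^bsub>M\<^esub> t)(i := t' i \<otimes>\<^bsub>C\<^esub> w)" if "t \<in> carrier M" "i \<in> {1..n}" for t i w
    using that by (auto simp: tuples_simps fun_eq_iff)
  have ti: "t' i \<in> carrier C" if "i \<in> {1..n}" for i using t' that by (auto simp: tuples_simps PiE_iff)
  have m: "t' \<otimes>\<^bsub>M\<^esub> t \<in> carrier M" if "t \<in> carrier M" for t using t' that by (rule mon.M.m_closed)
  from x consider
    (add) t i u v where "x = basis_elt R (t(i := u \<oplus>\<^bsub>C\<^esub> v)) \<ominus>\<^bsub>F\<^esub> (basis_elt R (t(i := u)) \<oplus>\<^bsub>F\<^esub> basis_elt R (t(i := v)))"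
      "t \<in> carrier M" "i \<in> {1..n}" "u \<in> carrier C" "v \<in> carrier C"
  | (smult) t i r u where "x = basis_elt R (t(i := r \<odot>\<^bsub>C\<^esub> u)) \<ominus>\<^bsub>F\<^esub> (r \<odot>\<^bsub>F\<^esub> basis_elt R (t(i := u)))"
      "t \<in> carrier M" "i \<in> {1..n}" "r \<in> carrier R" "u \<in> carrier C"
    unfolding multilinear_rels_def Let_def by blast
  then show ?thesis
  proof cases
    case add
    have "basis_elt R t' \<otimes>\<^bsub>F\<^esub> x = basis_elt R (t' \<otimes>\<^bsub>M\<^esub> (t(i := u \<oplus>\<^bsub>C\<^esub> v))) \<ominus>\<^bsub>F\<^esub>
        (basis_elt R (t' \<otimes>\<^bsub>M\<^esub> (t(i := u))) \<oplus>\<^bsub>F\<^esub> basis_elt R (t' \<otimes>\<^bsub>M\<^esub> (t(i := v))))"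
      using add t' by (simp add: cl mon.F.mult_minus_distr mon.F.r_distr mon.basis_mult)
    then show ?thesis
      using add t' ti[of i] m[of t]
      by (simp add: up ext.lin_ext_minus ext.lin_ext_add ext.lin_ext_basis cl C.r_distr Phi_add
          D.M.minus_eq D.M.r_neg)
  next
    case smult
    have "basis_elt R t' \<otimes>\<^bsub>F\<^esub> (r \<odot>\<^bsub>F\<^esub> basis_elt R (t(i := u))) = r \<odot>\<^bsub>F\<^esub> (basis_elt R t' \<otimes>\<^bsub>F\<^esub> basis_elt R (t(i := u)))"
      using smult t' by (metis cl upd_closed mon.F.m_comm mon.F.smult_assoc2 mon.F.smult_closed)
    then have "basis_elt R t' \<otimes>\<^bsub>F\<^esub> x = basis_elt R (t' \<otimes>\<^bsub>M\<^esub> (t(i := r \<odot>\<^bsub>C\<^esub> u))) \<ominus>\<^bsub>F\<^esub>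
        (r \<odot>\<^bsub>F\<^esub> basis_elt R (t' \<otimes>\<^bsub>M\<^esub> (t(i := u))))"
      using smult t' by (simp add: cl mon.F.mult_minus_distr mon.basis_mult)
    moreover have "t' i \<otimes>\<^bsub>C\<^esub> (r \<odot>\<^bsub>C\<^esub> u) = r \<odot>\<^bsub>C\<^esub> (t' i \<otimes>\<^bsub>C\<^esub> u)"
      using smult ti by (metis C.m_comm C.smult_assoc2 C.smult_closed)
    ultimately show ?thesis
      using smult t' ti[of i] m[of t]
      by (simp add: up ext.lin_ext_minus ext.lin_ext_smult ext.lin_ext_basis cl Phi_smult
          D.M.minus_eq D.M.r_neg)
  qed
qed

text \<open>The kernel of a linear map is in general no ideal, but the elements all of whose multiples
  it kills form one.\<close>

lemma lin_ext_kills_ideal: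
  assumes "x \<in> J"
  shows "lin_ext R D \<Phi> x = \<zero>\<^bsub>D\<^esub>"
proof -
  let ?K = "{x \<in> carrier F. \<forall>g\<in>carrier F. lin_ext R D \<Phi> (g \<otimes>\<^bsub>F\<^esub> x) = \<zero>\<^bsub>D\<^esub>}"
  have "ideal ?K F"
  proof (rule idealI[OF mon.F.ring_axioms])
    show "subgroup ?K (add_monoid F)"
    proof (rule mon.F.add.subgroupI)
      fix x assume x: "x \<in> ?K"
      have "lin_ext R D \<Phi> (g \<otimes>\<^bsub>F\<^esub> (\<ominus>\<^bsub>F\<^esub> x)) = \<zero>\<^bsub>D\<^esub>" if g: "g \<in> carrier F" for g
      proof -
        have "lin_ext R D \<Phi> ((\<ominus>\<^bsub>F\<^esub> g) \<otimes>\<^bsub>F\<^esub> x) = \<zero>\<^bsub>D\<^esub>" using x g by blast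
        then show ?thesis using x g by (simp add: mon.F.l_minus mon.F.r_minus)
      qed
      then show "\<ominus>\<^bsub>F\<^esub> x \<in> ?K" using x by simp
    next
      fix x y assume "x \<in> ?K" "y \<in> ?K"
      then show "x \<oplus>\<^bsub>F\<^esub> y \<in> ?K" by (simp add: mon.F.r_distr ext.lin_ext_add)
    qed (auto simp: ext.lin_ext_zero intro!: exI[of _ "\<zero>\<^bsub>F\<^esub>"])
  next
    fix a x assume a: "a \<in> ?K" and x: "x \<in> carrier F"
    have *: "lin_ext R D \<Phi> (g \<otimes>\<^bsub>F\<^esub> (x \<otimes>\<^bsub>F\<^esub> a)) = \<zero>\<^bsub>D\<^esub>" if g: "g \<in> carrier F" for g
    proof -
      have "lin_ext R D \<Phi> ((g \<otimes>\<^bsub>F\<^esub> x) \<otimes>\<^bsub>F\<^esub> a) = \<zero>\<^bsub>D\<^esub>" using a x g by blast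
      then show ?thesis using a x g by (simp add: mon.F.m_assoc)
    qed
    then show "x \<otimes>\<^bsub>F\<^esub> a \<in> ?K" using a x by simp
    then show "a \<otimes>\<^bsub>F\<^esub> x \<in> ?K" using a x mon.F.m_comm[of a x] by simp
  qed
  moreover have "multilinear_rels R C n \<subseteq> ?K"
  proof
    fix x assume x: "x \<in> multilinear_rels R C n"
    then have xc: "x \<in> carrier F" using rels_closed by blast
    have "lin_ext R D \<Phi> (g \<otimes>\<^bsub>F\<^esub> x) = \<zero>\<^bsub>D\<^esub>" if "g \<in> carrier F" for g using that
    proof (induction g rule: mon.basis_induct)
      case zero
      then show ?case using xc by (simp add: ext.lin_ext_zero)
    next
      case (basis s m)
      then show ?case using xc basis_times_rel[OF _ x]
        by (simp add: mon.F.smult_assoc2 mon.basis_elt_closed ext.lin_ext_smult)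
    next
      case (add f g)
      then show ?case using xc by (simp add: mon.F.l_distr ext.lin_ext_add)
    qed
    with xc show "x \<in> ?K" by blast
  qed
  ultimately have "J \<subseteq> ?K" unfolding tpower_ideal_def by (rule mon.F.genideal_minimal)
  then have x: "x \<in> carrier F" and "\<forall>g\<in>carrier F. lin_ext R D \<Phi> (g \<otimes>\<^bsub>F\<^esub> x) = \<zero>\<^bsub>D\<^esub>" using assms by blast+
  from this(2) mon.F.one_closed have "lin_ext R D \<Phi> (\<one>\<^bsub>F\<^esub> \<otimes>\<^bsub>F\<^esub> x) = \<zero>\<^bsub>D\<^esub>" by (rule bspec)
  then show ?thesis using x by (simp only: mon.F.l_one)
qed

abbreviation "E \<equiv> tensor_ext R D \<Phi>"

lemma tensor_ext_coset: "f \<in> carrier F \<Longrightarrow> E (J +>\<^bsub>F\<^esub> f) = lin_ext R D \<Phi> f"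
  unfolding tensor_ext_def
proof (rule quo.the_elem_quot)
  fix y assume f: "f \<in> carrier F" and y: "y \<in> carrier F" "J +>\<^bsub>F\<^esub> y = J +>\<^bsub>F\<^esub> f"
  then have "lin_ext R D \<Phi> (y \<ominus>\<^bsub>F\<^esub> f) = \<zero>\<^bsub>D\<^esub>"
    by (intro lin_ext_kills_ideal) (simp add: quo.q_eq)
  then show "lin_ext R D \<Phi> y = lin_ext R D \<Phi> f"
    using f y by (simp add: ext.lin_ext_minus ext.lin_ext_closed D.M.minus_zero_iff)
qed

lemma tensor_ext_closed: "z \<in> carrier T \<Longrightarrow> E z \<in> carrier D"
  using q_surj[of z] by (auto simp: tensor_ext_coset ext.lin_ext_closed)

lemma tensor_ext_add:
  assumes "x \<in> carrier T" "y \<in> carrier T"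
  shows "E (x \<oplus>\<^bsub>T\<^esub> y) = E x \<oplus>\<^bsub>D\<^esub> E y"
  using q_surj[OF assms(1)] q_surj[OF assms(2)]
  by (auto simp: q_add[symmetric] tensor_ext_coset ext.lin_ext_add)

lemma tensor_ext_smult:
  assumes "s \<in> carrier R" "x \<in> carrier T"
  shows "E (s \<odot>\<^bsub>T\<^esub> x) = s \<odot>\<^bsub>D\<^esub> E x"
  using q_surj[OF assms(2)] assms(1)
  by (auto simp: q_smult[symmetric] tensor_ext_coset ext.lin_ext_smult)

lemma tensor_ext_pure: "t \<in> carrier M \<Longrightarrow> E (pt t) = \<Phi> t"
  by (simp add: pt_eq tensor_ext_coset ext.lin_ext_basis mon.basis_elt_closed)

lemma tensor_ext_zero: "E \<zero>\<^bsub>T\<^esub> = \<zero>\<^bsub>D\<^esub>"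
  by (simp add: q_zero[symmetric] tensor_ext_coset ext.lin_ext_zero)

lemma tensor_ext_ring_hom:
  assumes D: "algebra R D"
    and mult: "\<And>x y. x \<in> carrier M \<Longrightarrow> y \<in> carrier M \<Longrightarrow> \<Phi> (x \<otimes>\<^bsub>M\<^esub> y) = \<Phi> x \<otimes>\<^bsub>D\<^esub> \<Phi> y"
    and one: "\<Phi> \<one>\<^bsub>M\<^esub> = \<one>\<^bsub>D\<^esub>"
  shows "E \<in> ring_hom T D"
proof (rule ring_hom_memI)
  fix x y assume "x \<in> carrier T" "y \<in> carrier T"
  then show "E (x \<otimes>\<^bsub>T\<^esub> y) = E x \<otimes>\<^bsub>D\<^esub> E y"
    using q_surj[of x] q_surj[of y]
    by (auto simp: q_mult[symmetric] tensor_ext_coset ext.lin_ext_mult[OF D mult])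
next
  show "E \<one>\<^bsub>T\<^esub> = \<one>\<^bsub>D\<^esub>"
    using tensor_ext_pure[of "\<one>\<^bsub>M\<^esub>"] one pt_one by (simp add: mon.M.one_closed)
qed (auto intro: tensor_ext_closed tensor_ext_add)

end

section \<open>Invariants and elementary symmetric functions\<close>

lemma invariants_simps [simp]:
  "x \<otimes>\<^bsub>invariants G act B\<^esub> y = x \<otimes>\<^bsub>B\<^esub> y" "\<one>\<^bsub>invariants G act B\<^esub> = \<one>\<^bsub>B\<^esub>"
  "x \<oplus>\<^bsub>invariants G act B\<^esub> y = x \<oplus>\<^bsub>B\<^esub> y" "\<zero>\<^bsub>invariants G act B\<^esub> = \<zero>\<^bsub>B\<^esub>"
  "s \<odot>\<^bsub>invariants G act B\<^esub> x = s \<odot>\<^bsub>B\<^esub> x"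
  by (simp_all add: invariants_def)

lemma invariants_carrier:
  "x \<in> carrier (invariants G act B) \<longleftrightarrow> x \<in> carrier B \<and> (\<forall>g\<in>G. act g x = x)"
  by (simp add: invariants_def)

lemma invariants_algebra:
  assumes B: "algebra R B" and hom: "\<And>g. g \<in> G \<Longrightarrow> act g \<in> ring_hom B B"
    and lin: "\<And>g s x. g \<in> G \<Longrightarrow> s \<in> carrier R \<Longrightarrow> x \<in> carrier B \<Longrightarrow> act g (s \<odot>\<^bsub>B\<^esub> x) = s \<odot>\<^bsub>B\<^esub> act g x"
  shows "algebra R (invariants G act B)"
proof -
  interpret B: algebra R B by (rule B)
  have neg: "act g (\<ominus>\<^bsub>B\<^esub> x) = \<ominus>\<^bsub>B\<^esub> act g x" if "g \<in> G" "x \<in> carrier B" for g x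
  proof -
    interpret h: ring_hom_cring B B "act g"
      by (rule ring_hom_cringI) (use hom[OF that(1)] B.M_cring in auto)
    show ?thesis using that by simp
  qed
  have cr: "cring (invariants G act B)"
  proof (intro cringI abelian_groupI comm_monoidI)
    fix x assume "x \<in> carrier (invariants G act B)"
    then have "\<ominus>\<^bsub>B\<^esub> x \<in> carrier (invariants G act B)" "\<ominus>\<^bsub>B\<^esub> x \<oplus>\<^bsub>B\<^esub> x = \<zero>\<^bsub>B\<^esub>"
      by (auto simp: invariants_carrier neg B.M.l_neg)
    then show "\<exists>y\<in>carrier (invariants G act B). y \<oplus>\<^bsub>invariants G act B\<^esub> x = \<zero>\<^bsub>invariants G act B\<^esub>"
      by auto
  qed (auto simp: invariants_carrier ring_hom_add[OF hom] ring_hom_mult[OF hom] ring_hom_one[OF hom]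
      ring_hom_zero[OF hom B.ring_axioms B.ring_axioms] B.a_ac B.m_ac B.l_distr B.r_distr)
  show ?thesis
    by (rule algebraI[OF B.R_cring cr])
       (auto simp: invariants_carrier lin B.smult_l_distr B.smult_r_distr B.smult_assoc1 B.smult_assoc2)
qed

definition esym :: "('s, 'x) ring_scheme \<Rightarrow> nat \<Rightarrow> nat \<Rightarrow> (nat \<Rightarrow> 's) \<Rightarrow> 's"
  where "esym S n k x = (\<Oplus>\<^bsub>S\<^esub>K\<in>{K. K \<subseteq> {1..n} \<and> card K = k}. \<Otimes>\<^bsub>S\<^esub>i\<in>K. x i)"

lemma (in cring) esym_closed:
  assumes "\<And>i. i \<in> {1..n} \<Longrightarrow> x i \<in> carrier R"
  shows "esym R n k x \<in> carrier R"
  unfolding esym_def using assms by (intro finsum_closed) (auto intro!: finprod_closed)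

lemma (in cring) esym_cong:
  assumes "\<And>i. i \<in> {1..n} \<Longrightarrow> x i \<in> carrier R" "\<And>i. i \<in> {1..n} \<Longrightarrow> y i = x i"
  shows "esym R n k y = esym R n k x"
  unfolding esym_def using assms
  by (intro finsum_cong' refl) (auto intro!: finprod_closed finprod_cong' simp: subset_iff)

lemma (in ring_hom_cring) esym_hom:
  assumes "\<And>i. i \<in> {1..n} \<Longrightarrow> x i \<in> carrier R"
  shows "h (esym R n k x) = esym S n k (\<lambda>i. h (x i))"
proof -
  have "h (\<Otimes>\<^bsub>R\<^esub>i\<in>K. x i) = (\<Otimes>\<^bsub>S\<^esub>i\<in>K. h (x i))" if "K \<subseteq> {1..n}" for K
    using assms that by (subst hom_finprod) (auto simp: comp_def)
  then show ?thesis
    unfolding esym_def using assms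
    by (subst hom_finsum) (auto intro!: R.finprod_closed S.finsum_cong' S.finprod_closed simp: subset_iff)
qed

lemma (in cring) esym_permute:
  assumes x: "\<And>i. i \<in> {1..n} \<Longrightarrow> x i \<in> carrier R" and \<rho>: "\<rho> permutes {1..n}"
  shows "esym R n k (\<lambda>i. x (\<rho> i)) = esym R n k x"
proof -
  let ?S = "{K. K \<subseteq> {1..n} \<and> card K = k}"
  have inj: "inj_on \<rho> K" for K using \<rho> permutes_inj inj_on_subset by blast
  have im: "(`) \<rho> ` ?S = ?S"
  proof safe
    fix K j assume "K \<subseteq> {1..n}" "j \<in> K"
    then show "\<rho> j \<in> {1..n}" using permutes_in_image[OF \<rho>] by blast
  next
    fix K :: "nat set" show "card (\<rho> ` K) = card K" by (rule card_image[OF inj])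
  next
    fix K assume K: "K \<subseteq> {1..n}" "k = card K"
    have "K = \<rho> ` (inv' \<rho> ` K)"
      using permutes_surj[OF \<rho>] by (simp add: image_image surj_f_inv_f)
    moreover have "inv' \<rho> ` K \<subseteq> {1..n}"
      using K permutes_in_image[OF permutes_inv[OF \<rho>]] by blast
    moreover have "card (inv' \<rho> ` K) = card K"
      using permutes_inj[OF permutes_inv[OF \<rho>]] by (intro card_image) (auto intro: inj_on_subset)
    ultimately show "K \<in> (`) \<rho> ` {L. L \<subseteq> {1..n} \<and> card L = card K}" by blast
  qed
  have "esym R n k x = (\<Oplus>K\<in>(`) \<rho> ` ?S. \<Otimes>i\<in>K. x i)"
    unfolding esym_def im ..
  also have "\<dots> = (\<Oplus>K\<in>?S. \<Otimes>i\<in>\<rho> ` K. x i)"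
  proof (rule finsum_reindex)
    show "(\<lambda>K. \<Otimes>i\<in>K. x i) \<in> (`) \<rho> ` ?S \<rightarrow> carrier R"
      unfolding im using x by (auto intro!: finprod_closed)
    show "inj_on ((`) \<rho>) ?S"
      using inj_image_eq_iff[OF permutes_inj[OF \<rho>]] by (auto simp: inj_on_def)
  qed
  also have "\<dots> = esym R n k (\<lambda>i. x (\<rho> i))"
    unfolding esym_def
  proof (rule finsum_cong'[OF refl])
    have s: "\<rho> i \<in> {1..n}" if "i \<in> {1..n}" for i using that permutes_in_image[OF \<rho>] by blast
    show "(\<lambda>K. \<Otimes>i\<in>K. x (\<rho> i)) \<in> ?S \<rightarrow> carrier R"
      using x s by (auto intro!: finprod_closed)
    fix K assume "K \<in> ?S"
    then show "(\<Otimes>i\<in>\<rho> ` K. x i) = (\<Otimes>i\<in>K. x (\<rho> i))"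
      using x s inj by (intro finprod_reindex) auto
  qed
  finally show ?thesis by simp
qed

lemma elem_sym_eq: "elem_sym R C n k c = esym (tpower R C n) n k (tensor_at R C n c)"
  by (simp add: elem_sym_def esym_def)

section \<open>The symmetric group acting on a tensor power\<close>

context tpow
begin

lemma comp_closed [simp]: "\<rho> permutes {1..n} \<Longrightarrow> t \<in> carrier M \<Longrightarrow> t \<circ> \<rho> \<in> carrier M"
  using permutes_in_image[of \<rho> "{1..n}"] permutes_not_in[of \<rho> "{1..n}"]
  by (fastforce simp: tuples_simps PiE_iff extensional_def)

lemma upd_comp_inv: "\<rho> permutes {1..n} \<Longrightarrow> (t(i := w)) \<circ> inv' \<rho> = (t \<circ> inv' \<rho>)(\<rho> i := w)"
  by (auto simp: fun_eq_iff permutes_inv_eq permutes_inverses)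

lemma comp_eq_iff: "\<rho> permutes {1..n} \<Longrightarrow> u \<circ> \<rho> = t \<longleftrightarrow> u = t \<circ> inv' \<rho>"
  by (auto simp: o_assoc[symmetric] permutes_inv_o)

lemma tuple_mult_comp:
  assumes \<rho>: "\<rho> permutes {1..n}"
  shows "(x \<otimes>\<^bsub>M\<^esub> y) \<circ> \<rho> = (x \<circ> \<rho>) \<otimes>\<^bsub>M\<^esub> (y \<circ> \<rho>)"
  using permutes_in_image[OF \<rho>] permutes_not_in[OF \<rho>]
  by (auto simp: tuples_simps fun_eq_iff restrict_def)

lemma tuple_one_comp:
  assumes \<rho>: "\<rho> permutes {1..n}"
  shows "\<one>\<^bsub>M\<^esub> \<circ> \<rho> = \<one>\<^bsub>M\<^esub>"
  using permutes_in_image[OF \<rho>] permutes_not_in[OF \<rho>]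
  by (auto simp: tuples_simps fun_eq_iff restrict_def)

lemma perm_ext: "\<rho> permutes {1..n} \<Longrightarrow> tpow_ext R C n T (\<lambda>t. pt (t \<circ> inv' \<rho>))"
proof (intro tpow_ext.intro tpow_axioms tpow_ext_axioms.intro T.module_axioms)
  assume \<rho>: "\<rho> permutes {1..n}"
  note inv = permutes_inv[OF \<rho>]
  have s: "\<rho> i \<in> {1..n}" if "i \<in> {1..n}" for i using that permutes_in_image[OF \<rho>] by blast
  show "(\<lambda>t. pt (t \<circ> inv' \<rho>)) \<in> carrier M \<rightarrow> carrier T" using comp_closed[OF inv] by auto
  fix t i u assume t: "t \<in> carrier M" "i \<in> {1..n}" "u \<in> carrier C"
  show "pt (t(i := u \<oplus>\<^bsub>C\<^esub> v) \<circ> inv' \<rho>) = pt (t(i := u) \<circ> inv' \<rho>) \<oplus>\<^bsub>T\<^esub> pt (t(i := v) \<circ> inv' \<rho>)"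
    if "v \<in> carrier C" for v
    unfolding upd_comp_inv[OF \<rho>] using t that s comp_closed[OF inv] by (intro pt_add) auto
  show "pt (t(i := r \<odot>\<^bsub>C\<^esub> u) \<circ> inv' \<rho>) = r \<odot>\<^bsub>T\<^esub> pt (t(i := u) \<circ> inv' \<rho>)" if "r \<in> carrier R" for r
    unfolding upd_comp_inv[OF \<rho>] using t that s comp_closed[OF inv] by (intro pt_smult) auto
qed

abbreviation pm where "pm \<rho> f \<equiv> (\<lambda>u. f (u \<circ> \<rho>))"

text \<open>The action is defined as the image of a coset under the substitution \<open>pm \<rho>\<close>.  On the quotient this
  substitution is the linear map induced by permuting the slots of pure tensors.\<close>

lemma pm_spec:
  assumes \<rho>: "\<rho> permutes {1..n}" and f: "f \<in> carrier F"
  shows "pm \<rho> f \<in> carrier F \<and> J +>\<^bsub>F\<^esub> pm \<rho> f = tensor_ext R T (\<lambda>t. pt (t \<circ> inv' \<rho>)) (J +>\<^bsub>F\<^esub> f)"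
proof -
  interpret e: tpow_ext R C n T "\<lambda>t. pt (t \<circ> inv' \<rho>)" by (rule perm_ext[OF \<rho>])
  show ?thesis using f
  proof (induction f rule: mon.basis_induct)
    case zero
    have "pm \<rho> \<zero>\<^bsub>F\<^esub> = \<zero>\<^bsub>F\<^esub>" by (simp add: mon.F_ops)
    then show ?case
      by (simp only: q_zero e.tensor_ext_zero mon.F.zero_closed simp_thms)
  next
    case (basis s m)
    have "pm \<rho> (s \<odot>\<^bsub>F\<^esub> basis_elt R m) = s \<odot>\<^bsub>F\<^esub> basis_elt R (m \<circ> inv' \<rho>)"
      by (auto simp: mon.F_ops basis_elt_def comp_eq_iff[OF \<rho>])
    then show ?case
      using basis comp_closed[OF permutes_inv[OF \<rho>], of m]
      by (simp only: q_smult e.tensor_ext_smult pt_eq[symmetric] e.tensor_ext_pure pt_closed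
          mon.F.smult_closed mon.basis_elt_closed simp_thms)
  next
    case (add f g)
    have "pm \<rho> (f \<oplus>\<^bsub>F\<^esub> g) = pm \<rho> f \<oplus>\<^bsub>F\<^esub> pm \<rho> g" by (simp add: mon.F_ops)
    then show ?case using add
      by (simp only: q_add e.tensor_ext_add q_closed mon.F.a_closed simp_thms)
  qed
qed

text \<open>As \<open>pm \<rho>\<close> is invertible, it maps a coset onto a whole coset, and not just into one.\<close>

lemma perm_act_eq:
  assumes \<rho>: "\<rho> permutes {1..n}" and z: "z \<in> carrier T"
  shows "perm_act \<rho> z = tensor_ext R T (\<lambda>t. pt (t \<circ> inv' \<rho>)) z"
proof -
  obtain f where f: "f \<in> carrier F" and z: "z = J +>\<^bsub>F\<^esub> f" using q_surj[OF z] by blast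
  have coset: "J +>\<^bsub>F\<^esub> g = {y \<in> carrier F. J +>\<^bsub>F\<^esub> y = J +>\<^bsub>F\<^esub> g}" if "g \<in> carrier F" for g
    using quo.q_mem[OF that] quo.q_self by blast
  note inv = permutes_inv[OF \<rho>]
  have pp: "pm \<rho> (pm (inv' \<rho>) g) = g" "pm (inv' \<rho>) (pm \<rho> g) = g" for g :: "(nat \<Rightarrow> 'c) \<Rightarrow> 'r"
    by (simp_all add: o_assoc[symmetric] permutes_inv_o[OF \<rho>])
  have "pm \<rho> ` (J +>\<^bsub>F\<^esub> f) = J +>\<^bsub>F\<^esub> pm \<rho> f"
  proof (rule Set.set_eqI)
    fix y
    show "y \<in> pm \<rho> ` (J +>\<^bsub>F\<^esub> f) \<longleftrightarrow> y \<in> J +>\<^bsub>F\<^esub> pm \<rho> f"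
    proof
      assume "y \<in> pm \<rho> ` (J +>\<^bsub>F\<^esub> f)"
      then obtain x where x: "x \<in> carrier F" "J +>\<^bsub>F\<^esub> x = J +>\<^bsub>F\<^esub> f" and y: "y = pm \<rho> x"
        using coset[OF f] by blast
      show "y \<in> J +>\<^bsub>F\<^esub> pm \<rho> f"
        unfolding y using pm_spec[OF \<rho> x(1)] pm_spec[OF \<rho> f] x(2)
        by (metis quo.q_self)
    next
      assume "y \<in> J +>\<^bsub>F\<^esub> pm \<rho> f"
      then have y: "y \<in> carrier F" "J +>\<^bsub>F\<^esub> y = J +>\<^bsub>F\<^esub> pm \<rho> f"
        using quo.q_mem pm_spec[OF \<rho> f] by blast+
      have "J +>\<^bsub>F\<^esub> pm (inv' \<rho>) y = J +>\<^bsub>F\<^esub> pm (inv' \<rho>) (pm \<rho> f)"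
        using pm_spec[OF inv y(1)] pm_spec[OF \<rho> f] pm_spec[OF inv, of "pm \<rho> f"] y(2) by simp
      then have "pm (inv' \<rho>) y \<in> J +>\<^bsub>F\<^esub> f"
        unfolding pp using quo.q_self[of "pm (inv' \<rho>) y"] pm_spec[OF inv y(1)] by simp
      then have "pm \<rho> (pm (inv' \<rho>) y) \<in> pm \<rho> ` (J +>\<^bsub>F\<^esub> f)" by (rule imageI)
      then show "y \<in> pm \<rho> ` (J +>\<^bsub>F\<^esub> f)" unfolding pp .
    qed
  qed
  then show ?thesis unfolding perm_act_def z using pm_spec[OF \<rho> f] by simp
qed

lemma perm_act_pure: "\<rho> permutes {1..n} \<Longrightarrow> t \<in> carrier M \<Longrightarrow> perm_act \<rho> (pt t) = pt (t \<circ> inv' \<rho>)"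
  by (simp add: perm_act_eq tpow_ext.tensor_ext_pure[OF perm_ext])

lemma perm_act_smult:
  "\<rho> permutes {1..n} \<Longrightarrow> s \<in> carrier R \<Longrightarrow> z \<in> carrier T \<Longrightarrow> perm_act \<rho> (s \<odot>\<^bsub>T\<^esub> z) = s \<odot>\<^bsub>T\<^esub> perm_act \<rho> z"
  by (simp add: perm_act_eq tpow_ext.tensor_ext_smult[OF perm_ext])

lemma perm_act_hom:
  assumes \<rho>: "\<rho> permutes {1..n}"
  shows "perm_act \<rho> \<in> ring_hom T T"
proof -
  have "tensor_ext R T (\<lambda>t. pt (t \<circ> inv' \<rho>)) \<in> ring_hom T T"
  proof (rule tpow_ext.tensor_ext_ring_hom[OF perm_ext[OF \<rho>] T.algebra_axioms])
    fix x y assume "x \<in> carrier M" "y \<in> carrier M"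
    then show "pt (x \<otimes>\<^bsub>M\<^esub> y \<circ> inv' \<rho>) = pt (x \<circ> inv' \<rho>) \<otimes>\<^bsub>T\<^esub> pt (y \<circ> inv' \<rho>)"
      by (simp add: tuple_mult_comp[OF permutes_inv[OF \<rho>]] pt_mult comp_closed[OF permutes_inv[OF \<rho>]])
  next
    show "pt (\<one>\<^bsub>M\<^esub> \<circ> inv' \<rho>) = \<one>\<^bsub>T\<^esub>" by (simp add: tuple_one_comp[OF permutes_inv[OF \<rho>]] pt_one)
  qed
  then show ?thesis
    by (simp add: ring_hom_def perm_act_eq[OF \<rho>] Pi_def)
qed

lemma perm_act_comp: "perm_act (\<rho> \<circ> \<tau>) z = perm_act \<rho> (perm_act \<tau> z)"
  by (simp add: perm_act_def image_image o_assoc)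

lemma perm_act_id: "perm_act id z = z"
  by (simp add: perm_act_def)

subsection \<open>The embeddings of the factors\<close>

abbreviation "emb \<equiv> tensor_at R C n"

lemma emb_eq: "emb c i = pt (\<one>\<^bsub>M\<^esub>(i := c))" if "i \<in> {1..n}"
  unfolding tensor_at_def using that by (intro arg_cong[where f=pt]) (auto simp: tuples_simps fun_eq_iff)

lemma emb_closed [simp]: "i \<in> {1..n} \<Longrightarrow> c \<in> carrier C \<Longrightarrow> emb c i \<in> carrier T"
  by (simp add: emb_eq)

lemma emb_smult: "i \<in> {1..n} \<Longrightarrow> s \<in> carrier R \<Longrightarrow> c \<in> carrier C \<Longrightarrow> emb (s \<odot>\<^bsub>C\<^esub> c) i = s \<odot>\<^bsub>T\<^esub> emb c i"
  by (simp add: emb_eq pt_smult)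

lemma emb_hom:
  assumes i: "i \<in> {1..n}"
  shows "(\<lambda>c. emb c i) \<in> ring_hom C T"
proof (rule ring_hom_memI)
  fix x y assume xy: "x \<in> carrier C" "y \<in> carrier C"
  show "emb (x \<oplus>\<^bsub>C\<^esub> y) i = emb x i \<oplus>\<^bsub>T\<^esub> emb y i"
    using xy i by (simp add: emb_eq pt_add)
  have "\<one>\<^bsub>M\<^esub>(i := x \<otimes>\<^bsub>C\<^esub> y) = \<one>\<^bsub>M\<^esub>(i := x) \<otimes>\<^bsub>M\<^esub> \<one>\<^bsub>M\<^esub>(i := y)"
    using xy i by (auto simp: tuples_simps fun_eq_iff)
  then show "emb (x \<otimes>\<^bsub>C\<^esub> y) i = emb x i \<otimes>\<^bsub>T\<^esub> emb y i"
    using xy i by (simp add: emb_eq pt_mult)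
next
  have "\<one>\<^bsub>M\<^esub>(i := \<one>\<^bsub>C\<^esub>) = \<one>\<^bsub>M\<^esub>" using i by (auto simp: tuples_simps fun_eq_iff)
  then show "emb \<one>\<^bsub>C\<^esub> i = \<one>\<^bsub>T\<^esub>" using i by (simp add: emb_eq pt_one)
qed (use i in auto)

lemma pure_eq_prod_emb:
  assumes t: "t \<in> carrier M"
  shows "pt t = (\<Otimes>\<^bsub>T\<^esub>i\<in>{1..n}. emb (t i) i)"
proof -
  have ti: "t i \<in> carrier C" if "i \<in> {1..n}" for i using t that by (auto simp: tuples_simps)
  have "K \<subseteq> {1..n} \<Longrightarrow> (\<Otimes>\<^bsub>T\<^esub>i\<in>K. emb (t i) i) = pt (\<lambda>j\<in>{1..n}. if j \<in> K then t j else \<one>\<^bsub>C\<^esub>)"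
    if "finite K" for K using that
  proof (induction K rule: finite_induct)
    case empty
    have "(\<lambda>j\<in>{1..n}. \<one>\<^bsub>C\<^esub>) = \<one>\<^bsub>M\<^esub>" by (simp add: tuples_simps)
    then show ?case by (simp add: pt_one)
  next
    case (insert i K)
    then have i: "i \<in> {1..n}" and K: "K \<subseteq> {1..n}" by auto
    have eq: "\<one>\<^bsub>M\<^esub>(i := t i) \<otimes>\<^bsub>M\<^esub> (\<lambda>j\<in>{1..n}. if j \<in> K then t j else \<one>\<^bsub>C\<^esub>)
        = (\<lambda>j\<in>{1..n}. if j \<in> insert i K then t j else \<one>\<^bsub>C\<^esub>)"
      using insert.hyps ti i by (auto simp: tuples_simps fun_eq_iff)
    have cl: "(\<lambda>j\<in>{1..n}. if j \<in> K then t j else \<one>\<^bsub>C\<^esub>) \<in> carrier M"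
      using ti by (auto simp: tuples_simps)
    have "(\<Otimes>\<^bsub>T\<^esub>i\<in>insert i K. emb (t i) i) = emb (t i) i \<otimes>\<^bsub>T\<^esub> (\<Otimes>\<^bsub>T\<^esub>i\<in>K. emb (t i) i)"
      using insert.hyps K i ti by (intro T.finprod_insert) auto
    also have "\<dots> = emb (t i) i \<otimes>\<^bsub>T\<^esub> pt (\<lambda>j\<in>{1..n}. if j \<in> K then t j else \<one>\<^bsub>C\<^esub>)"
      by (simp only: insert.IH[OF K])
    also have "\<dots> = pt (\<lambda>j\<in>{1..n}. if j \<in> insert i K then t j else \<one>\<^bsub>C\<^esub>)"
      using ti i cl by (simp add: emb_eq pt_mult eq)
    finally show ?case .
  qed
  from this[of "{1..n}"] show ?thesis
    using t by (simp add: tuples_simps PiE_restrict cong: restrict_cong)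
qed

lemma perm_act_emb:
  assumes \<rho>: "\<rho> permutes {1..n}" and i: "i \<in> {1..n}" and c: "c \<in> carrier C"
  shows "perm_act \<rho> (emb c i) = emb c (\<rho> i)"
proof -
  have "\<rho> i \<in> {1..n}" using i permutes_in_image[OF \<rho>] by blast
  then show ?thesis
    using i c by (simp add: emb_eq perm_act_pure[OF \<rho>] upd_comp_inv[OF \<rho>]
      tuple_one_comp[OF permutes_inv[OF \<rho>]])
qed

lemma elem_sym_closed: "c \<in> carrier C \<Longrightarrow> elem_sym R C n k c \<in> carrier T"
  unfolding elem_sym_eq by (rule T.esym_closed) simp

lemma elem_sym_invariant:
  assumes \<rho>: "\<rho> permutes {1..n}" and c: "c \<in> carrier C"
  shows "perm_act \<rho> (elem_sym R C n k c) = elem_sym R C n k c"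
proof -
  interpret h: ring_hom_cring T T "perm_act \<rho>"
    by (rule ring_hom_cringI[OF T.M_cring T.M_cring perm_act_hom[OF \<rho>]])
  have s: "\<rho> i \<in> {1..n}" if "i \<in> {1..n}" for i using that permutes_in_image[OF \<rho>] by blast
  have "perm_act \<rho> (elem_sym R C n k c) = esym T n k (\<lambda>i. perm_act \<rho> (emb c i))"
    unfolding elem_sym_eq using c by (intro h.esym_hom) auto
  also have "\<dots> = esym T n k (\<lambda>i. emb c (\<rho> i))"
    using c s by (intro T.esym_cong) (auto simp: perm_act_emb[OF \<rho>])
  also have "\<dots> = elem_sym R C n k c"
    unfolding elem_sym_eq using c by (intro T.esym_permute[OF _ \<rho>]) auto
  finally show ?thesis .
qed

end

section \<open>Functoriality of tensor powers\<close>

text \<open>The map \<open>h\<close> is only required to be \<open>R\<close>-linear: the construction is applied to the evaluation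
  \<open>R[x] \<rightarrow> A\<close>, which is a ring homomorphism, and to a section of it, which is not.\<close>

locale tpow_map = C: tpow R C n + D: tpow R D n
  for R :: "('r, 'x) ring_scheme" (structure) and C :: "('r, 'c, 'y) module_scheme" (structure)
    and D :: "('r, 'd, 'z) module_scheme" (structure) and n :: nat +
  fixes h :: "'c \<Rightarrow> 'd"
  assumes h_closed: "h \<in> carrier C \<rightarrow> carrier D"
    and h_add: "\<And>x y. x \<in> carrier C \<Longrightarrow> y \<in> carrier C \<Longrightarrow> h (x \<oplus>\<^bsub>C\<^esub> y) = h x \<oplus>\<^bsub>D\<^esub> h y"
    and h_smult: "\<And>s x. s \<in> carrier R \<Longrightarrow> x \<in> carrier C \<Longrightarrow> h (s \<odot>\<^bsub>C\<^esub> x) = s \<odot>\<^bsub>D\<^esub> h x"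
begin

abbreviation "ht t \<equiv> (\<lambda>i\<in>{1..n}. h (t i))"
abbreviation "hT \<equiv> tpower_map R C D n h"

lemma h_in [simp]: "x \<in> carrier C \<Longrightarrow> h x \<in> carrier D" using h_closed by blast

lemma ht_closed [simp]: "t \<in> carrier C.M \<Longrightarrow> ht t \<in> carrier D.M"
  by (auto simp: tuples_simps PiE_iff intro!: h_in)

lemma ht_upd: "i \<in> {1..n} \<Longrightarrow> ht (t(i := u)) = (ht t)(i := h u)"
  by (auto simp: fun_eq_iff)

sublocale tpow_ext R C n D.T "\<lambda>t. D.pt (ht t)"
proof (intro tpow_ext.intro C.tpow_axioms tpow_ext_axioms.intro D.T.module_axioms)
  show "(\<lambda>t. D.pt (ht t)) \<in> carrier C.M \<rightarrow> carrier D.T" by auto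
  fix t i u assume t: "t \<in> carrier C.M" "i \<in> {1..n}" "u \<in> carrier C"
  show "D.pt (ht (t(i := u \<oplus>\<^bsub>C\<^esub> v))) = D.pt (ht (t(i := u))) \<oplus>\<^bsub>D.T\<^esub> D.pt (ht (t(i := v)))"
    if "v \<in> carrier C" for v
    using t that by (simp only: ht_upd h_add) (intro D.pt_add; simp)
  show "D.pt (ht (t(i := r \<odot>\<^bsub>C\<^esub> u))) = r \<odot>\<^bsub>D.T\<^esub> D.pt (ht (t(i := u)))" if "r \<in> carrier R" for r
    using t that by (simp only: ht_upd h_smult) (intro D.pt_smult; simp)
qed

lemma tpower_map_eq: "hT = E"
  unfolding tpower_map_def tensor_ext_def lin_ext_def by (rule ext) simp

lemmas map_closed = tensor_ext_closed[folded tpower_map_eq]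
  and map_add = tensor_ext_add[folded tpower_map_eq]
  and map_smult = tensor_ext_smult[folded tpower_map_eq]
  and map_pure = tensor_ext_pure[folded tpower_map_eq]
  and map_zero = tensor_ext_zero[folded tpower_map_eq]

lemma map_perm_act:
  assumes \<rho>: "\<rho> permutes {1..n}" and z: "z \<in> carrier C.T"
  shows "hT (perm_act \<rho> z) = perm_act \<rho> (hT z)"
proof -
  interpret pC: ring_hom_cring C.T C.T "perm_act \<rho>"
    by (rule ring_hom_cringI[OF C.T.M_cring C.T.M_cring C.perm_act_hom[OF \<rho>]])
  interpret pD: ring_hom_cring D.T D.T "perm_act \<rho>"
    by (rule ring_hom_cringI[OF D.T.M_cring D.T.M_cring D.perm_act_hom[OF \<rho>]])
  have ht: "(\<lambda>i\<in>{1..n}. h (t (inv' \<rho> i))) = ht t \<circ> inv' \<rho>" for t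
    using permutes_in_image[OF permutes_inv[OF \<rho>]] permutes_not_in[OF permutes_inv[OF \<rho>]]
    by (auto simp: fun_eq_iff restrict_def)
  show ?thesis using z
  proof (induction z rule: C.tpow_induct)
    case zero
    then show ?case by (simp add: map_zero)
  next
    case (pure s t)
    then show ?case
      by (simp add: C.perm_act_smult[OF \<rho>] D.perm_act_smult[OF \<rho>] map_smult map_pure
          C.perm_act_pure[OF \<rho>] D.perm_act_pure[OF \<rho>] C.comp_closed[OF permutes_inv[OF \<rho>]] ht)
  next
    case (add x y)
    then show ?case by (simp add: map_add map_closed)
  qed
qed

lemma map_ring_hom:
  assumes "h \<in> ring_hom C D"
  shows "hT \<in> ring_hom C.T D.T"
  unfolding tpower_map_eq
proof (rule tensor_ext_ring_hom[OF D.T.algebra_axioms])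
  fix x y assume xy: "x \<in> carrier C.M" "y \<in> carrier C.M"
  then have "ht (x \<otimes>\<^bsub>C.M\<^esub> y) = ht x \<otimes>\<^bsub>D.M\<^esub> ht y"
    using ring_hom_mult[OF assms] by (auto simp: tuples_simps fun_eq_iff PiE_iff)
  then show "D.pt (ht (x \<otimes>\<^bsub>C.M\<^esub> y)) = D.pt (ht x) \<otimes>\<^bsub>D.T\<^esub> D.pt (ht y)"
    using xy by (simp add: D.pt_mult)
next
  have "ht \<one>\<^bsub>C.M\<^esub> = \<one>\<^bsub>D.M\<^esub>"
    using ring_hom_one[OF assms] by (auto simp: tuples_simps fun_eq_iff)
  then show "D.pt (ht \<one>\<^bsub>C.M\<^esub>) = \<one>\<^bsub>D.T\<^esub>" by (simp add: D.pt_one)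
qed

lemma map_emb:
  assumes "h \<one>\<^bsub>C\<^esub> = \<one>\<^bsub>D\<^esub>" "i \<in> {1..n}" "c \<in> carrier C"
  shows "hT (C.emb c i) = D.emb (h c) i"
proof -
  have "ht \<one>\<^bsub>C.M\<^esub> = \<one>\<^bsub>D.M\<^esub>" using assms by (auto simp: tuples_simps fun_eq_iff)
  moreover have "\<one>\<^bsub>C.M\<^esub>(i := c) \<in> carrier C.M" using assms by simp
  ultimately show ?thesis
    by (simp only: C.emb_eq[OF assms(2)] D.emb_eq[OF assms(2)] map_pure ht_upd[OF assms(2)])
qed

lemma map_elem_sym:
  assumes hom: "h \<in> ring_hom C D" and c: "c \<in> carrier C"
  shows "hT (elem_sym R C n k c) = elem_sym R D n k (h c)"
proof -
  interpret m: ring_hom_cring C.T D.T hT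
    by (rule ring_hom_cringI[OF C.T.M_cring D.T.M_cring map_ring_hom[OF hom]])
  have "hT (elem_sym R C n k c) = esym D.T n k (\<lambda>i. hT (C.emb c i))"
    unfolding elem_sym_eq using c by (intro m.esym_hom) auto
  also have "\<dots> = elem_sym R D n k (h c)"
    unfolding elem_sym_eq using c map_emb[OF ring_hom_one[OF hom]] by (intro D.T.esym_cong) auto
  finally show ?thesis .
qed

end

lemma tpower_map_retract:
  assumes s: "tpow_map R C D s" and h: "tpow_map R D C h"
    and hs: "\<And>c. c \<in> carrier C \<Longrightarrow> h (s c) = c" and z: "z \<in> carrier (tpower R C n)"
  shows "tpower_map R D C n h (tpower_map R C D n s z) = z"
proof -
  interpret s: tpow_map R C D n s by (rule s)
  interpret h: tpow_map R D C n h by (rule h)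
  have "h.ht (s.ht t) = t" if "t \<in> carrier s.C.M" for t
    using that hs by (auto simp: tuples_simps fun_eq_iff PiE_iff extensional_def)
  with z show ?thesis
    by (induction z rule: s.C.tpow_induct)
       (simp_all add: s.map_zero h.map_zero s.map_smult h.map_smult s.map_pure h.map_pure
          s.map_add h.map_add s.map_closed)
qed

section \<open>Determinants over a commutative ring with carrier\<close>

locale class_hom = S?: cring S for S :: "('s, 'x) ring_scheme" (structure) +
  fixes h :: "'a::comm_ring_1 \<Rightarrow> 's"
  assumes h_closed [simp]: "h x \<in> carrier S"
    and h_plus: "h (x + y) = h x \<oplus>\<^bsub>S\<^esub> h y"
    and h_times: "h (x * y) = h x \<otimes>\<^bsub>S\<^esub> h y"
    and h_1: "h 1 = \<one>\<^bsub>S\<^esub>"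
begin

lemma h_0: "h 0 = \<zero>\<^bsub>S\<^esub>"
  using h_plus[of 0 0] by (metis S.add.r_cancel_one' add_0 h_closed)

lemma h_uminus: "h (- x) = \<ominus>\<^bsub>S\<^esub> h x"
  using S.minus_equality[of "h (- x)" "h x"] h_plus[of "- x" x, symmetric] by (simp add: h_0)

lemma h_minus: "h (x - y) = h x \<ominus>\<^bsub>S\<^esub> h y"
  using h_plus[of x "- y"] by (simp add: h_uminus S.minus_eq)

lemma h_power: "h (x ^ k) = h x [^]\<^bsub>S\<^esub> k"
  by (induction k) (simp_all add: h_1 h_times S.m_comm)

lemma h_sum: "h (sum f A) = (\<Oplus>\<^bsub>S\<^esub>i\<in>A. h (f i))"
  by (induction A rule: infinite_finite_induct) (simp_all add: h_0 h_plus)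

lemma h_prod: "h (prod f A) = (\<Otimes>\<^bsub>S\<^esub>i\<in>A. h (f i))"
  by (induction A rule: infinite_finite_induct) (simp_all add: h_1 h_times)

lemma h_of_int: "h (of_int k * x) = add_pow S k (h x)"
proof -
  have nat: "h (of_nat m * x) = add_pow S m (h x)" for m
    by (induction m) (simp_all add: h_0 h_plus distrib_right S.a_comm)
  show ?thesis
  proof (cases "k \<ge> 0")
    case True
    then show ?thesis using nat[of "nat k"] by (simp add: add_pow_int_ge)
  next
    case False
    then have "of_int k * x = - (of_nat (nat (- k)) * x)" by simp
    then show ?thesis using False nat[of "nat (- k)"] by (simp add: add_pow_int_lt h_uminus del: of_nat_nat)
  qed
qed

end

text \<open>Every commutative ring is a quotient of a polynomial ring over the integers in as many
  variables as the type has elements, and that polynomial ring is an instance of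
  \<open>comm_ring_1\<close>.  Polynomial identities between the entries of matrices pass to the quotient.\<close>

lemma ex_class_hom:
  fixes S :: "('s, 'x) ring_scheme"
  assumes "cring S"
  shows "\<exists>h :: (('s \<Rightarrow>\<^sub>0 nat) \<Rightarrow>\<^sub>0 int) \<Rightarrow> 's. class_hom S h \<and> carrier S \<subseteq> range h"
proof -
  interpret S: cring S by fact
  define val where "val x = (if x \<in> carrier S then x else \<one>\<^bsub>S\<^esub>)" for x
  have val [simp]: "val x \<in> carrier S" for x by (simp add: val_def)
  define mono where "mono m = (\<Otimes>\<^bsub>S\<^esub>x\<in>Poly_Mapping.keys m. val x [^]\<^bsub>S\<^esub> Poly_Mapping.lookup m x)"
    for m :: "'s \<Rightarrow>\<^sub>0 nat"
  have mono_closed [simp]: "mono m \<in> carrier S" for m unfolding mono_def by (rule S.finprod_closed) auto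
  have mono_alt: "mono m = (\<Otimes>\<^bsub>S\<^esub>x\<in>U. val x [^]\<^bsub>S\<^esub> Poly_Mapping.lookup m x)"
    if "finite U" "Poly_Mapping.keys m \<subseteq> U" for U m
    unfolding mono_def using that
    by (intro S.finprod_mono_neutral_cong_left) (auto simp: in_keys_iff)
  have mono_add: "mono (k + m) = mono k \<otimes>\<^bsub>S\<^esub> mono m" for k m
  proof -
    let ?X = "Poly_Mapping.keys k \<union> Poly_Mapping.keys m"
    have U: "finite ?X" "Poly_Mapping.keys k \<subseteq> ?X" "Poly_Mapping.keys m \<subseteq> ?X" "Poly_Mapping.keys (k + m) \<subseteq> ?X"
      using keys_add[of k m] by auto
    show ?thesis
      unfolding mono_alt[OF U(1,2)] mono_alt[OF U(1,3)] mono_alt[OF U(1,4)]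
      by (subst S.finprod_multf[symmetric]) (auto simp: lookup_add S.nat_pow_mult simp del: S.finprod_multf)
  qed
  have mono_0: "mono 0 = \<one>\<^bsub>S\<^esub>" by (simp add: mono_def)
  define iv where "iv k = add_pow S (k::int) \<one>\<^bsub>S\<^esub>" for k
  have iv_closed [simp]: "iv k \<in> carrier S" for k by (simp add: iv_def)
  have iv_add: "iv (a + b) = iv a \<oplus>\<^bsub>S\<^esub> iv b" for a b
    unfolding iv_def add_pow_def using group.int_pow_mult[OF S.a_group, of "\<one>\<^bsub>S\<^esub>" a b] by simp
  have iv_mult: "iv (a * b) = iv a \<otimes>\<^bsub>S\<^esub> iv b" for a b
  proof -
    have "iv (a * b) = add_pow S a (iv b)"
      unfolding iv_def add_pow_def using group.int_pow_pow[OF S.a_group, of "\<one>\<^bsub>S\<^esub>" b a]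
      by (simp add: mult.commute)
    also have "\<dots> = iv a \<otimes>\<^bsub>S\<^esub> iv b" unfolding iv_def by (subst S.add_pow_ldistr_int) simp_all
    finally show ?thesis .
  qed
  have iv_0: "iv 0 = \<zero>\<^bsub>S\<^esub>" by (simp add: iv_def add_pow_def)
  have iv_1: "iv 1 = \<one>\<^bsub>S\<^esub>" by (simp add: iv_def)
  define ev where "ev p = (\<Oplus>\<^bsub>S\<^esub>m\<in>Poly_Mapping.keys p. iv (Poly_Mapping.lookup p m) \<otimes>\<^bsub>S\<^esub> mono m)"
    for p :: "('s \<Rightarrow>\<^sub>0 nat) \<Rightarrow>\<^sub>0 int"
  have ev_closed [simp]: "ev p \<in> carrier S" for p unfolding ev_def by (rule S.finsum_closed) auto
  have ev_alt: "ev p = (\<Oplus>\<^bsub>S\<^esub>m\<in>U. iv (Poly_Mapping.lookup p m) \<otimes>\<^bsub>S\<^esub> mono m)"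
    if "finite U" "Poly_Mapping.keys p \<subseteq> U" for U p
    unfolding ev_def using that
    by (intro S.add.finprod_mono_neutral_cong_left) (auto simp: in_keys_iff iv_0)
  have ev_add: "ev (k + m) = ev k \<oplus>\<^bsub>S\<^esub> ev m" for k m
  proof -
    let ?X = "Poly_Mapping.keys k \<union> Poly_Mapping.keys m"
    have U: "finite ?X" "Poly_Mapping.keys k \<subseteq> ?X" "Poly_Mapping.keys m \<subseteq> ?X" "Poly_Mapping.keys (k + m) \<subseteq> ?X"
      using keys_add[of k m] by auto
    show ?thesis
      unfolding ev_alt[OF U(1,2)] ev_alt[OF U(1,3)] ev_alt[OF U(1,4)]
      by (subst S.finsum_addf[symmetric]) (auto simp: lookup_add iv_add S.l_distr simp del: S.finsum_addf)
  qed
  have ev_single: "ev (Poly_Mapping.single m k) = iv k \<otimes>\<^bsub>S\<^esub> mono m" for m k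
    by (subst ev_alt[of "{m}"]) auto
  have upd: "Poly_Mapping.update a b f = f + Poly_Mapping.single a b" if "a \<notin> Poly_Mapping.keys f"
    for a b and f :: "('s \<Rightarrow>\<^sub>0 nat) \<Rightarrow>\<^sub>0 int"
    using that by (intro poly_mapping_eqI) (auto simp: lookup_update lookup_add lookup_single in_keys_iff when_def)
  have ev_0: "ev 0 = \<zero>\<^bsub>S\<^esub>" by (simp add: ev_def)
  have single: "ev (p * Poly_Mapping.single m k) = ev p \<otimes>\<^bsub>S\<^esub> ev (Poly_Mapping.single m k)" for p m k
  proof (induction p rule: update_induct)
    case const
    then show ?case by (simp add: ev_0)
  next
    case (update f a b)
    have 1: "iv (b * k) \<otimes>\<^bsub>S\<^esub> mono (a + m) = (iv b \<otimes>\<^bsub>S\<^esub> mono a) \<otimes>\<^bsub>S\<^esub> (iv k \<otimes>\<^bsub>S\<^esub> mono m)"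
      by (simp add: iv_mult mono_add S.m_ac)
    show ?case
      using update by (simp add: upd distrib_right ev_add S.l_distr mult_single) (simp add: ev_single 1)
  qed
  have ev_mult: "ev (p * q) = ev p \<otimes>\<^bsub>S\<^esub> ev q" for p q
  proof (induction q rule: update_induct)
    case const
    then show ?case by (simp add: ev_0)
  next
    case (update f a b)
    then show ?case by (simp add: upd distrib_left ev_add S.r_distr single)
  qed
  have ev_1: "ev 1 = \<one>\<^bsub>S\<^esub>"
    using ev_single[of 0 1] by (simp add: iv_1 mono_0)
  have "class_hom S ev"
    by (rule class_hom.intro, rule assms, unfold_locales) (simp_all add: ev_add ev_mult ev_1)
  moreover have "x = ev (Poly_Mapping.single (Poly_Mapping.single x 1) 1)" if "x \<in> carrier S" for x
  proof -
    have "mono (Poly_Mapping.single x 1) = x"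
      using that by (subst mono_alt[of "{x}"]) (auto simp: val_def)
    then show ?thesis using that by (simp add: ev_single iv_1)
  qed
  ultimately show ?thesis by blast
qed

text \<open>The two determinants differ by the index range, \<open>{0..<n}\<close> for matrices of the type class and
  \<open>{1..n}\<close> for those over \<open>S\<close>; conjugation with the successor function matches the permutations.\<close>

lemma (in class_hom) h_det:
  "h (det (mat n n (\<lambda>(i, j). M (Suc i) (Suc j)))) = ring_det S n (\<lambda>i j. h (M i j))"
proof -
  let ?A = "mat n n (\<lambda>(i, j). M (Suc i) (Suc j))"
  have Suc: "bij_betw Suc {0..<n} {1..n}"
    by (rule bij_betw_byWitness[where f' = "\<lambda>x. x - 1"]) auto
  have pred: "bij_betw (\<lambda>x. x - 1) {1..n} {0..<n}"
    by (rule bij_betw_byWitness[where f' = Suc]) auto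
  have "det ?A = (\<Sum>p | p permutes {0..<n}. of_int (sign p) * (\<Prod>i = 0..<n. ?A $$ (i, p i)))"
    by (simp add: det_def)
  also have "\<dots> = (\<Sum>p | p permutes {1..n}. of_int (sign p) * (\<Prod>i = 1..n. M i (p i)))"
  proof (rule sum.reindex_bij_witness[where
        i = "map_permutation {1..n} (\<lambda>x. x - 1)" and j = "map_permutation {0..<n} Suc"], goal_cases)
    case (1 p)
    then show ?case by (intro map_permutation_compose_inv[OF Suc]) auto
  next
    case (2 p)
    then show ?case using map_permutation_permutes[OF Suc] by simp
  next
    case (3 p)
    then show ?case by (intro map_permutation_compose_inv[OF pred]) auto
  next
    case (4 p)
    then show ?case using map_permutation_permutes[OF pred] by simp
  next
    case (5 p)
    then have p: "p permutes {0..<n}" by simp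
    have "(\<Prod>i = 0..<n. ?A $$ (i, p i)) = (\<Prod>i = 0..<n. M (Suc i) (map_permutation {0..<n} Suc p (Suc i)))"
      using permutes_in_image[OF p] by (intro prod.cong) (auto simp: map_permutation_apply)
    also have "\<dots> = (\<Prod>i = 1..n. M i (map_permutation {0..<n} Suc p i))"
      using prod.reindex_bij_betw[OF Suc] .
    finally show ?case by (simp add: sign_map_permutation p)
  qed
  finally show ?thesis by (simp add: ring_det_def h_sum h_of_int h_prod)
qed

lemma ring_det_cong:
  assumes "cring S" and "\<And>i j. i \<in> {1..n} \<Longrightarrow> j \<in> {1..n} \<Longrightarrow> M i j = N i j"
    and "\<And>i j. i \<in> {1..n} \<Longrightarrow> j \<in> {1..n} \<Longrightarrow> N i j \<in> carrier S"
  shows "ring_det S n M = ring_det S n N"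
proof -
  interpret S: cring S by fact
  have "(\<Otimes>\<^bsub>S\<^esub>i\<in>{1..n}. M i (\<sigma> i)) = (\<Otimes>\<^bsub>S\<^esub>i\<in>{1..n}. N i (\<sigma> i))
      \<and> (\<Otimes>\<^bsub>S\<^esub>i\<in>{1..n}. N i (\<sigma> i)) \<in> carrier S" if "\<sigma> permutes {1..n}" for \<sigma>
    using assms(2,3) permutes_in_image[OF that]
    by (intro conjI S.finprod_cong' S.finprod_closed) auto
  then show ?thesis
    unfolding ring_det_def by (intro S.finsum_cong') auto
qed

lemma (in cring) obtain_lift:
  obtains h :: "(('a \<Rightarrow>\<^sub>0 nat) \<Rightarrow>\<^sub>0 int) \<Rightarrow> 'a" and lift
  where "class_hom R h" "\<And>x. x \<in> carrier R \<Longrightarrow> h (lift x) = x"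
proof -
  obtain h :: "(('a \<Rightarrow>\<^sub>0 nat) \<Rightarrow>\<^sub>0 int) \<Rightarrow> 'a" where "class_hom R h" "carrier R \<subseteq> range h"
    using ex_class_hom[OF is_cring] by blast
  then show ?thesis
    by (intro that[of h "inv_into UNIV h"]) (auto simp: f_inv_into_f)
qed

lemma (in class_hom) h_det_lift:
  assumes "\<And>i j. i \<in> {1..n} \<Longrightarrow> j \<in> {1..n} \<Longrightarrow> h (M' i j) = M i j"
  shows "h (det (mat n n (\<lambda>(i, j). M' (Suc i) (Suc j)))) = ring_det S n M"
  unfolding h_det using assms h_closed
  by (intro ring_det_cong) (auto simp: S.is_cring simp flip: assms)

lemma (in ring_hom_cring) ring_det_hom:
  assumes "\<And>i j. i \<in> {1..n} \<Longrightarrow> j \<in> {1..n} \<Longrightarrow> M i j \<in> carrier R"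
  shows "h (ring_det R n M) = ring_det S n (\<lambda>i j. h (M i j))"
proof -
  obtain g :: "(('a \<Rightarrow>\<^sub>0 nat) \<Rightarrow>\<^sub>0 int) \<Rightarrow> 'a" and lift
    where g: "class_hom R g" and l: "\<And>x. x \<in> carrier R \<Longrightarrow> g (lift x) = x"
    using R.obtain_lift by blast
  interpret g: class_hom R g by (rule g)
  interpret hg: class_hom S "h \<circ> g"
    by unfold_locales (simp_all add: g.h_plus g.h_times g.h_1)
  show ?thesis
    using g.h_det_lift[of n "\<lambda>i j. lift (M i j)" M] hg.h_det_lift[of n "\<lambda>i j. lift (M i j)" "\<lambda>i j. h (M i j)"]
      assms l by simp
qed

lemma (in cring) ring_det_closed:
  assumes "\<And>i j. i \<in> {1..n} \<Longrightarrow> j \<in> {1..n} \<Longrightarrow> M i j \<in> carrier R"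
  shows "ring_det R n M \<in> carrier R"
proof -
  obtain g :: "(('a \<Rightarrow>\<^sub>0 nat) \<Rightarrow>\<^sub>0 int) \<Rightarrow> 'a" and lift
    where g: "class_hom R g" and l: "\<And>x. x \<in> carrier R \<Longrightarrow> g (lift x) = x"
    using obtain_lift by blast
  interpret g: class_hom R g by (rule g)
  show ?thesis
    using g.h_det_lift[of n "\<lambda>i j. lift (M i j)" M] assms l g.h_closed by metis
qed

lemma (in cring) ring_det_mult:
  assumes "\<And>i j. i \<in> {1..n} \<Longrightarrow> j \<in> {1..n} \<Longrightarrow> M i j \<in> carrier R"
    and "\<And>i j. i \<in> {1..n} \<Longrightarrow> j \<in> {1..n} \<Longrightarrow> N i j \<in> carrier R"
  shows "ring_det R n (\<lambda>i j. \<Oplus>k\<in>{1..n}. M i k \<otimes> N k j) = ring_det R n M \<otimes> ring_det R n N"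
proof -
  obtain g :: "(('a \<Rightarrow>\<^sub>0 nat) \<Rightarrow>\<^sub>0 int) \<Rightarrow> 'a" and lift
    where g: "class_hom R g" and l: "\<And>x. x \<in> carrier R \<Longrightarrow> g (lift x) = x"
    using obtain_lift by blast
  interpret g: class_hom R g by (rule g)
  let ?m = "\<lambda>M'. mat n n (\<lambda>(i, j). M' (Suc i) (Suc j))"
  let ?M = "\<lambda>i j. lift (M i j)" and ?N = "\<lambda>i j. lift (N i j)"
  have prod: "?m ?M * ?m ?N = ?m (\<lambda>i j. \<Sum>k = 1..n. ?M i k * ?N k j)"
  proof (rule eq_matI)
    fix i j assume ij: "i < dim_row (?m (\<lambda>i j. \<Sum>k = 1..n. ?M i k * ?N k j))"
      "j < dim_col (?m (\<lambda>i j. \<Sum>k = 1..n. ?M i k * ?N k j))"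
    have "(\<Sum>k = 0..<n. ?M (Suc i) (Suc k) * ?N (Suc k) (Suc j)) = (\<Sum>k = 1..n. ?M (Suc i) k * ?N k (Suc j))"
      by (rule sum.reindex_bij_witness[where i = "\<lambda>k. k - 1" and j = Suc]) auto
    then show "(?m ?M * ?m ?N) $$ (i, j) = ?m (\<lambda>i j. \<Sum>k = 1..n. ?M i k * ?N k j) $$ (i, j)"
      using ij by (simp add: scalar_prod_def)
  qed auto
  have "g (det (?m ?M * ?m ?N)) = ring_det R n (\<lambda>i j. \<Oplus>k\<in>{1..n}. M i k \<otimes> N k j)"
    unfolding prod using assms l
    by (intro g.h_det_lift) (auto simp: g.h_sum g.h_times intro!: finsum_cong')
  moreover have "det (?m ?M * ?m ?N) = det (?m ?M) * det (?m ?N)"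
    by (rule det_mult[of _ n]) auto
  ultimately show ?thesis
    using g.h_det_lift[of n ?M M] g.h_det_lift[of n ?N N] assms l by (simp add: g.h_times)
qed

lemma (in cring) obtain_adjugate:
  assumes "\<And>i j. i \<in> {1..n} \<Longrightarrow> j \<in> {1..n} \<Longrightarrow> M i j \<in> carrier R"
  obtains Z where "\<And>i j. Z i j \<in> carrier R"
    and "\<And>i j. i \<in> {1..n} \<Longrightarrow> j \<in> {1..n} \<Longrightarrow>
      (\<Oplus>k\<in>{1..n}. Z i k \<otimes> M k j) = (if i = j then ring_det R n M else \<zero>)"
    and "\<And>i j. i \<in> {1..n} \<Longrightarrow> j \<in> {1..n} \<Longrightarrow>
      (\<Oplus>k\<in>{1..n}. M i k \<otimes> Z k j) = (if i = j then ring_det R n M else \<zero>)"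
proof -
  obtain g :: "(('a \<Rightarrow>\<^sub>0 nat) \<Rightarrow>\<^sub>0 int) \<Rightarrow> 'a" and lift
    where g: "class_hom R g" and l: "\<And>x. x \<in> carrier R \<Longrightarrow> g (lift x) = x"
    using obtain_lift by blast
  interpret g: class_hom R g by (rule g)
  let ?A = "mat n n (\<lambda>(i, j). lift (M (Suc i) (Suc j)))"
  have A: "?A \<in> carrier_mat n n" by simp
  note adj = adj_mat[OF A]
  define Z where "Z i j = g (adj_mat ?A $$ (i - 1, j - 1))" for i j
  have dims: "dim_row (adj_mat ?A) = n" "dim_col (adj_mat ?A) = n" using adj(1) by auto
  have det: "g (det ?A) = ring_det R n M"
    using g.h_det_lift[of n "\<lambda>i j. lift (M i j)" M] assms l by simp
  have "(\<Oplus>k\<in>{1..n}. Z i k \<otimes> M k j) = (if i = j then ring_det R n M else \<zero>)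
      \<and> (\<Oplus>k\<in>{1..n}. M i k \<otimes> Z k j) = (if i = j then ring_det R n M else \<zero>)"
    if ij: "i \<in> {1..n}" "j \<in> {1..n}" for i j
  proof -
    have ij': "i - 1 < n" "j - 1 < n" "Suc (i - 1) = i" "Suc (j - 1) = j" using ij by auto
    have id: "g ((det ?A \<cdot>\<^sub>m 1\<^sub>m n) $$ (i - 1, j - 1)) = (if i = j then ring_det R n M else \<zero>)"
      using ij' det by (auto simp: g.h_0)
    have "(adj_mat ?A * ?A) $$ (i - 1, j - 1) = (\<Sum>k = 0..<n. adj_mat ?A $$ (i - 1, k) * lift (M (Suc k) j))"
      using ij' by (simp add: scalar_prod_def dims)
    also have "\<dots> = (\<Sum>k = 1..n. adj_mat ?A $$ (i - 1, k - 1) * lift (M k j))"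
      by (rule sum.reindex_bij_witness[where i = "\<lambda>k. k - 1" and j = Suc]) auto
    finally have "g ((adj_mat ?A * ?A) $$ (i - 1, j - 1)) = (\<Oplus>k\<in>{1..n}. Z i k \<otimes> g (lift (M k j)))"
      by (simp add: g.h_sum g.h_times Z_def)
    also have "\<dots> = (\<Oplus>k\<in>{1..n}. Z i k \<otimes> M k j)"
      using assms ij l by (intro finsum_cong') (auto simp: Z_def)
    finally have left: "(\<Oplus>k\<in>{1..n}. Z i k \<otimes> M k j) = g ((adj_mat ?A * ?A) $$ (i - 1, j - 1))" ..
    have "(?A * adj_mat ?A) $$ (i - 1, j - 1) = (\<Sum>k = 0..<n. lift (M i (Suc k)) * adj_mat ?A $$ (k, j - 1))"
      using ij' by (simp add: scalar_prod_def dims)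
    also have "\<dots> = (\<Sum>k = 1..n. lift (M i k) * adj_mat ?A $$ (k - 1, j - 1))"
      by (rule sum.reindex_bij_witness[where i = "\<lambda>k. k - 1" and j = Suc]) auto
    finally have "g ((?A * adj_mat ?A) $$ (i - 1, j - 1)) = (\<Oplus>k\<in>{1..n}. g (lift (M i k)) \<otimes> Z k j)"
      by (simp add: g.h_sum g.h_times Z_def)
    also have "\<dots> = (\<Oplus>k\<in>{1..n}. M i k \<otimes> Z k j)"
      using assms ij l by (intro finsum_cong') (auto simp: Z_def)
    finally have right: "(\<Oplus>k\<in>{1..n}. M i k \<otimes> Z k j) = g ((?A * adj_mat ?A) $$ (i - 1, j - 1))" ..
    show ?thesis unfolding left right adj(2,3) id by simp
  qed
  moreover have "Z i j \<in> carrier R" for i j by (simp add: Z_def)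
  ultimately show ?thesis by (intro that[of Z]) simp_all
qed

lemma (in cring) ring_det_lower_triangular:
  assumes cl: "\<And>i j. i \<in> {1..n} \<Longrightarrow> j \<in> {1..n} \<Longrightarrow> M i j \<in> carrier R"
    and z: "\<And>i j. i \<in> {1..n} \<Longrightarrow> j \<in> {1..n} \<Longrightarrow> i < j \<Longrightarrow> M i j = \<zero>"
  shows "ring_det R n M = (\<Otimes>i\<in>{1..n}. M i i)"
proof -
  obtain g :: "(('a \<Rightarrow>\<^sub>0 nat) \<Rightarrow>\<^sub>0 int) \<Rightarrow> 'a" and lift
    where g: "class_hom R g" and l: "\<And>x. x \<in> carrier R \<Longrightarrow> g (lift x) = x"
    using obtain_lift by blast
  interpret g: class_hom R g by (rule g)
  define M' where "M' i j = (if i < j then 0 else lift (M i j))" for i j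
  let ?A = "mat n n (\<lambda>(i, j). M' (Suc i) (Suc j))"
  have "det ?A = prod_list (diag_mat ?A)"
    by (rule det_lower_triangular[of n]) (auto simp: M'_def)
  also have "\<dots> = (\<Prod>i = 0..<n. M' (Suc i) (Suc i))"
    by (simp add: diag_mat_def prod.distinct_set_conv_list[symmetric] cong: map_cong)
  also have "\<dots> = (\<Prod>i = 1..n. M' i i)"
    by (rule prod.reindex_bij_witness[where i = "\<lambda>k. k - 1" and j = Suc]) auto
  finally have "g (det ?A) = (\<Otimes>i\<in>{1..n}. g (M' i i))" by (simp add: g.h_prod)
  also have "\<dots> = (\<Otimes>i\<in>{1..n}. M i i)"
    using cl l by (intro finprod_cong') (auto simp: M'_def)
  finally show ?thesis
    using g.h_det_lift[of n M' M] cl l z by (simp add: M'_def g.h_0)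
qed

section \<open>Characteristic polynomials and Vieta's formula\<close>

lemma UP_coeff [simp]: "p \<in> carrier (UP R) \<Longrightarrow> up_ring.coeff (UP R) p i = p i"
  by (simp add: UP_def)

lemma UP_monom: "a \<in> carrier R \<Longrightarrow> up_ring.monom (UP R) a m = (\<lambda>i. if i = m then a else \<zero>\<^bsub>R\<^esub>)"
  by (auto simp: UP_def)

lemma UP_ops:
  "p \<in> carrier (UP R) \<Longrightarrow> q \<in> carrier (UP R) \<Longrightarrow> p \<oplus>\<^bsub>UP R\<^esub> q = (\<lambda>i. p i \<oplus>\<^bsub>R\<^esub> q i)"
  "p \<in> carrier (UP R) \<Longrightarrow> q \<in> carrier (UP R) \<Longrightarrow>
     p \<otimes>\<^bsub>UP R\<^esub> q = (\<lambda>m. \<Oplus>\<^bsub>R\<^esub>i\<in>{..m}. p i \<otimes>\<^bsub>R\<^esub> q (m - i))"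
  "\<one>\<^bsub>UP R\<^esub> = (\<lambda>i. if i = 0 then \<one>\<^bsub>R\<^esub> else \<zero>\<^bsub>R\<^esub>)" "\<zero>\<^bsub>UP R\<^esub> = (\<lambda>i. \<zero>\<^bsub>R\<^esub>)"
  by (auto simp: UP_def)

context class_hom
begin

text \<open>The coefficientwise map is again a homomorphism from a ring of class \<open>comm_ring_1\<close>.  So the
  transfer principle for determinants also covers characteristic polynomials, which are
  determinants over the polynomial ring.\<close>

definition poly_map :: "'a poly \<Rightarrow> nat \<Rightarrow> 's"
  where "poly_map p = (\<lambda>i. h (Polynomial.coeff p i))"

lemma poly_map_closed [simp]: "poly_map p \<in> carrier (UP S)"
proof -
  have "bound \<zero>\<^bsub>S\<^esub> (Polynomial.degree p) (poly_map p)"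
    by (rule bound.intro) (simp add: poly_map_def Polynomial.coeff_eq_0 h_0)
  then show ?thesis by (auto simp: UP_def up_def poly_map_def)
qed

sublocale UPS: UP_cring S "UP S" by unfold_locales simp

lemma poly_map_hom: "class_hom (UP S) poly_map"
proof unfold_locales
  fix p q :: "'a poly"
  show "poly_map (p + q) = poly_map p \<oplus>\<^bsub>UP S\<^esub> poly_map q"
    by (simp add: UP_ops) (simp add: poly_map_def h_plus)
  show "poly_map (p * q) = poly_map p \<otimes>\<^bsub>UP S\<^esub> poly_map q"
    by (simp add: UP_ops) (simp add: poly_map_def Polynomial.coeff_mult h_sum h_times)
  show "poly_map 1 = \<one>\<^bsub>UP S\<^esub>"
    by (auto simp: UP_ops poly_map_def h_0 h_1)
qed simp

interpretation pm: class_hom "UP S" poly_map by (rule poly_map_hom)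

lemma poly_map_linear: "poly_map [:- c, 1:] = up_ring.monom (UP S) \<one>\<^bsub>S\<^esub> 1 \<ominus>\<^bsub>UP S\<^esub> up_ring.monom (UP S) (h c) 0"
proof -
  have "poly_map [:0, 1:] = up_ring.monom (UP S) \<one>\<^bsub>S\<^esub> 1"
    by (auto simp: UP_monom poly_map_def h_0 h_1 coeff_pCons split: nat.split)
  moreover have "poly_map [:c:] = up_ring.monom (UP S) (h c) 0"
    by (auto simp: UP_monom poly_map_def h_0 coeff_pCons split: nat.split)
  moreover have "[:- c, 1:] = [:0, 1:] - [:c:]" by simp
  ultimately show ?thesis by (simp only: pm.h_minus)
qed

lemma poly_map_const: "poly_map [:c:] = up_ring.monom (UP S) (h c) 0"
  by (auto simp: UP_monom poly_map_def h_0 coeff_pCons split: nat.split)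

end

abbreviation char_matrix :: "('r, 'x) ring_scheme \<Rightarrow> (nat \<Rightarrow> nat \<Rightarrow> 'r) \<Rightarrow> nat \<Rightarrow> nat \<Rightarrow> nat \<Rightarrow> 'r"
  where "char_matrix R M \<equiv> (\<lambda>i j. (if i = j then up_ring.monom (UP R) \<one>\<^bsub>R\<^esub> 1 else \<zero>\<^bsub>UP R\<^esub>)
                             \<ominus>\<^bsub>UP R\<^esub> up_ring.monom (UP R) (M i j) 0)"

lemma (in class_hom) char_poly_lift:
  assumes "\<And>i j. i \<in> {1..n} \<Longrightarrow> j \<in> {1..n} \<Longrightarrow> h (M' i j) = M i j"
  shows "ring_det (UP S) n (char_matrix S M) = poly_map (char_poly (mat n n (\<lambda>(i, j). M' (Suc i) (Suc j))))"
proof -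
  interpret pm: class_hom "UP S" poly_map by (rule poly_map_hom)
  let ?A = "mat n n (\<lambda>(i, j). M' (Suc i) (Suc j))"
  let ?P = "\<lambda>i j. (if i = j then [:0, 1:] else 0) - [:M' i j:]"
  have "char_poly_matrix ?A = mat n n (\<lambda>(i, j). ?P (Suc i) (Suc j))"
    by (rule eq_matI) (auto simp: char_poly_matrix_def)
  moreover have "poly_map (det (mat n n (\<lambda>(i, j). ?P (Suc i) (Suc j)))) = ring_det (UP S) n (char_matrix S M)"
  proof (rule pm.h_det_lift)
    fix i j assume "i \<in> {1..n}" "j \<in> {1..n}"
    moreover have "poly_map [:0, 1:] = up_ring.monom (UP S) \<one>\<^bsub>S\<^esub> 1"
      by (auto simp: UP_monom poly_map_def h_0 h_1 coeff_pCons split: nat.split)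
    ultimately show "poly_map (?P i j) = char_matrix S M i j"
      using assms by (simp add: pm.h_minus poly_map_const pm.h_0)
  qed
  ultimately show ?thesis by (simp add: char_poly_def)
qed

lemma (in cring) char_poly_monic:
  assumes "\<And>i j. i \<in> {1..n} \<Longrightarrow> j \<in> {1..n} \<Longrightarrow> M i j \<in> carrier R"
  shows "monic_of_degree R n (ring_det (UP R) n (char_matrix R M))"
proof -
  obtain g :: "(('a \<Rightarrow>\<^sub>0 nat) \<Rightarrow>\<^sub>0 int) \<Rightarrow> 'a" and lift
    where g: "class_hom R g" and l: "\<And>x. x \<in> carrier R \<Longrightarrow> g (lift x) = x"
    using obtain_lift by blast
  interpret g: class_hom R g by (rule g)
  let ?A = "mat n n (\<lambda>(i, j). lift (M (Suc i) (Suc j)))"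
  have A: "?A \<in> carrier_mat n n" by simp
  have eq: "ring_det (UP R) n (char_matrix R M) = g.poly_map (char_poly ?A)"
    using assms l by (intro g.char_poly_lift) simp
  have "Polynomial.degree (char_poly ?A) = n" "Polynomial.coeff (char_poly ?A) n = 1"
    using degree_monic_char_poly[OF A] by simp_all
  then show ?thesis
    unfolding eq monic_of_degree_def
    by (simp add: g.poly_map_def[of "char_poly ?A"] g.h_1 g.h_0 Polynomial.coeff_eq_0
        g.poly_map_closed[unfolded g.poly_map_def])
qed

lemma (in ring_hom_cring) char_poly_hom:
  assumes "\<And>i j. i \<in> {1..n} \<Longrightarrow> j \<in> {1..n} \<Longrightarrow> M i j \<in> carrier R"
  shows "ring_det (UP S) n (char_matrix S (\<lambda>i j. h (M i j))) = (\<lambda>l. h (ring_det (UP R) n (char_matrix R M) l))"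
proof -
  obtain g :: "(('a \<Rightarrow>\<^sub>0 nat) \<Rightarrow>\<^sub>0 int) \<Rightarrow> 'a" and lift
    where g: "class_hom R g" and l: "\<And>x. x \<in> carrier R \<Longrightarrow> g (lift x) = x"
    using R.obtain_lift by blast
  interpret g: class_hom R g by (rule g)
  interpret hg: class_hom S "h \<circ> g"
    by unfold_locales (simp_all add: g.h_plus g.h_times g.h_1)
  show ?thesis
    using g.char_poly_lift[of n "\<lambda>i j. lift (M i j)" M]
      hg.char_poly_lift[of n "\<lambda>i j. lift (M i j)" "\<lambda>i j. h (M i j)"] assms l
    by (simp add: g.poly_map_def hg.poly_map_def)
qed

text \<open>Vieta's formula, by multiplying out: choosing \<open>- c i\<close> for \<open>i \<in> K\<close> and \<open>X\<close> elsewhere contributes to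
  the coefficient of degree \<open>n - card K\<close>.\<close>

lemma coeff_prod_linear:
  fixes c :: "nat \<Rightarrow> 'a::comm_ring_1"
  assumes "k \<le> n"
  shows "Polynomial.coeff (\<Prod>i = 1..n. [:- c i, 1:]) (n - k)
    = (- 1) ^ k * (\<Sum>K\<in>{K. K \<subseteq> {1..n} \<and> card K = k}. \<Prod>i\<in>K. c i)"
proof -
  have const: "(\<Prod>i\<in>K. [:- c i:]) = [:(- 1) ^ card K * (\<Prod>i\<in>K. c i):]" if "finite K" for K
    using that by (induction K rule: finite_induct) (auto simp: one_pCons algebra_simps)
  have "(\<Prod>i = 1..n. [:- c i, 1:]) = (\<Prod>i = 1..n. [:- c i:] + Polynomial.monom 1 1)"
    by (intro prod.cong) (auto simp: monom_Suc One_nat_def)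
  also have "\<dots> = (\<Sum>K\<in>Pow {1..n}. (\<Prod>i\<in>K. [:- c i:]) * (\<Prod>i\<in>{1..n} - K. Polynomial.monom 1 1))"
    by (rule prod_add) simp
  also have "\<dots> = (\<Sum>K\<in>Pow {1..n}. Polynomial.monom ((- 1) ^ card K * (\<Prod>i\<in>K. c i)) (n - card K))"
  proof (rule sum.cong[OF refl])
    fix K assume "K \<in> Pow {1..n}"
    then have K: "finite K" "card ({1..n} - K) = n - card K"
      using finite_subset[of K "{1..n}"] by (auto simp: card_Diff_subset)
    show "(\<Prod>i\<in>K. [:- c i:]) * (\<Prod>i\<in>{1..n} - K. Polynomial.monom 1 1)
        = Polynomial.monom ((- 1) ^ card K * (\<Prod>i\<in>K. c i)) (n - card K)"
      using K by (simp add: const monom_power smult_monom)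
  qed
  finally have "Polynomial.coeff (\<Prod>i = 1..n. [:- c i, 1:]) (n - k)
    = (\<Sum>K\<in>Pow {1..n}. if n - card K = n - k then (- 1) ^ card K * (\<Prod>i\<in>K. c i) else 0)"
    by (simp add: Polynomial.coeff_sum)
  also have "\<dots> = (\<Sum>K\<in>{K. K \<subseteq> {1..n} \<and> card K = k}. (- 1) ^ card K * (\<Prod>i\<in>K. c i))"
  proof (rule sum.mono_neutral_cong_right)
    show "\<forall>K\<in>Pow {1..n} - {K. K \<subseteq> {1..n} \<and> card K = k}.
      (if n - card K = n - k then (- 1) ^ card K * (\<Prod>i\<in>K. c i) else 0) = 0"
    proof
      fix K assume K: "K \<in> Pow {1..n} - {K. K \<subseteq> {1..n} \<and> card K = k}"
      then have "card K \<le> n" using card_mono[of "{1..n}" K] by auto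
      then show "(if n - card K = n - k then (- 1) ^ card K * (\<Prod>i\<in>K. c i) else 0) = 0"
        using K assms by auto
    qed
  qed auto
  also have "\<dots> = (- 1) ^ k * (\<Sum>K\<in>{K. K \<subseteq> {1..n} \<and> card K = k}. \<Prod>i\<in>K. c i)"
    by (simp add: sum_distrib_left)
  finally show ?thesis .
qed

lemma (in class_hom) vieta:
  assumes "k \<le> n"
  shows "h (Polynomial.coeff (\<Prod>i = 1..n. [:- c i, 1:]) (n - k))
    = (\<ominus>\<^bsub>S\<^esub> \<one>\<^bsub>S\<^esub>) [^]\<^bsub>S\<^esub> k \<otimes>\<^bsub>S\<^esub> esym S n k (\<lambda>i. h (c i))"
  by (simp add: coeff_prod_linear[OF assms] h_times h_power h_uminus h_1 h_sum h_prod esym_def)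

section \<open>Monogenic algebras over a ring in which the characteristic polynomial splits\<close>

text \<open>Division by the linear factors one after the other (Newton interpolation): in the basis
  \<open>w k = (x - q 1) \<dots> (x - q k)\<close> of the polynomials modulo \<open>w n\<close>, multiplication by \<open>p\<close> is lower
  triangular with diagonal \<open>p (q 1), \<dots>, p (q n)\<close>.\<close>

lemma newton_division:
  fixes p :: "'a::comm_ring_1 poly" and q :: "nat \<Rightarrow> 'a"
  defines "w \<equiv> \<lambda>k. \<Prod>i = 1..k. [:- q i, 1:]"
  assumes "1 \<le> m" "m \<le> Suc n"
  shows "\<exists>u t. (\<forall>k<m. u k = 0) \<and> (m \<le> n \<longrightarrow> u m = poly p (q m)) \<and>
    w (m - 1) * p = (\<Sum>k = 1..n. Polynomial.smult (u k) (w (k - 1))) + w n * t"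
  using assms(3,2)
proof (induction m arbitrary: p rule: inc_induct)
  case base
  then show ?case by (intro exI[of _ "\<lambda>_. 0"] exI[of _ p]) simp
next
  case (step m)
  let ?c = "poly p (q m)" and ?p = "synthetic_div p (q m)"
  obtain u t where u: "\<forall>k<Suc m. u k = 0"
    and eq: "w m * ?p = (\<Sum>k = 1..n. Polynomial.smult (u k) (w (k - 1))) + w n * t"
    using step.IH[of ?p] by auto
  have m: "m \<in> {1..n}" using step.hyps step.prems by auto
  have "w m = w (m - 1) * [:- q m, 1:]"
    using m by (cases m) (auto simp: w_def mult.commute)
  then have wm: "w m * ?p = w (m - 1) * ([:- q m, 1:] * ?p)" by (simp only: mult.assoc)
  have c: "w (m - 1) * [:?c:] = Polynomial.smult ?c (w (m - 1))" by simp
  have "p = [:- q m, 1:] * ?p + [:?c:]" by (rule synthetic_div_correct'[symmetric])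
  then have "w (m - 1) * p = w (m - 1) * ([:- q m, 1:] * ?p + [:?c:])" by (rule arg_cong)
  also have "\<dots> = Polynomial.smult ?c (w (m - 1)) + w m * ?p"
    unfolding distrib_left c wm by (rule add.commute)
  also have "\<dots> = (\<Sum>k = 1..n. Polynomial.smult ((u(m := ?c)) k) (w (k - 1))) + w n * t"
  proof -
    have "(\<Sum>k = 1..n. Polynomial.smult ((u(m := ?c)) k) (w (k - 1)))
        = (\<Sum>k = 1..n. (if k = m then Polynomial.smult ?c (w (k - 1)) else 0) + Polynomial.smult (u k) (w (k - 1)))"
      using u by (intro sum.cong) auto
    then show ?thesis using m by (simp add: sum.distrib eq algebra_simps)
  qed
  finally show ?case
    using u by (intro exI[of _ "u(m := ?c)"] exI[of _ t]) auto
qed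

lemma poly_monom_induct:
  fixes p :: "'a::comm_ring_1 poly"
  assumes "\<And>c m. P (Polynomial.monom c m)" and "\<And>p q. P p \<Longrightarrow> P q \<Longrightarrow> P (p + q)"
  shows "P p"
proof -
  have "P (\<Sum>i\<le>k. Polynomial.monom (Polynomial.coeff p i) i)" for k
    by (induction k) (auto intro: assms)
  from this[of "Polynomial.degree p"] show ?thesis by (simp add: poly_as_sum_of_monoms)
qed

lemma (in UP_cring) UP_monom_induct [consumes 1, case_names monom add]:
  assumes "p \<in> carrier P"
    and monom: "\<And>r m. r \<in> carrier R \<Longrightarrow> Q (up_ring.monom P r m)"
    and add: "\<And>p q. p \<in> carrier P \<Longrightarrow> q \<in> carrier P \<Longrightarrow> Q p \<Longrightarrow> Q q \<Longrightarrow> Q (p \<oplus>\<^bsub>P\<^esub> q)"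
  shows "Q p"
proof -
  have cl: "up_ring.monom P (up_ring.coeff P p i) i \<in> carrier P" for i
    using assms(1) by simp
  have "Q (\<Oplus>\<^bsub>P\<^esub>i\<in>{..k}. up_ring.monom P (up_ring.coeff P p i) i)" for k
    by (induction k) (use assms cl in \<open>auto intro!: add monom P.finsum_closed\<close>)
  from this[of "deg R p"] show ?thesis using up_repr[OF assms(1)] by simp
qed

lemma (in abelian_monoid) finsum_swap:
  assumes "finite A" and "\<And>i j. i \<in> A \<Longrightarrow> j \<in> B \<Longrightarrow> f i j \<in> carrier G"
  shows "(\<Oplus>i\<in>A. \<Oplus>j\<in>B. f i j) = (\<Oplus>j\<in>B. \<Oplus>i\<in>A. f i j)"
  using assms
proof (induction A rule: finite_induct)
  case (insert x A)
  have "(\<Oplus>i\<in>insert x A. \<Oplus>j\<in>B. f i j) = (\<Oplus>j\<in>B. f x j) \<oplus> (\<Oplus>j\<in>B. \<Oplus>i\<in>A. f i j)"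
    using insert by (subst finsum_insert) (auto intro!: finsum_closed)
  also have "\<dots> = (\<Oplus>j\<in>B. f x j \<oplus> (\<Oplus>i\<in>A. f i j))"
    using insert by (intro finsum_addf[symmetric]) (auto intro!: finsum_closed)
  also have "\<dots> = (\<Oplus>j\<in>B. \<Oplus>i\<in>insert x A. f i j)"
    using insert by (intro finsum_cong') (auto intro!: finsum_closed)
  finally show ?case .
qed simp

lemma (in abelian_group) add_eq_self_imp_zero:
  "x \<in> carrier G \<Longrightarrow> y \<in> carrier G \<Longrightarrow> x \<oplus> y = y \<Longrightarrow> x = \<zero>"
  by (metis a_assoc a_inv_closed r_neg r_zero)

text \<open>If \<open>M C = C V\<close> for matrices, then \<open>(x - M) C = C (x - V)\<close> for a scalar \<open>x\<close>.  Applied to the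
  variable of a polynomial ring this compares characteristic polynomials.\<close>

lemma (in cring) char_matrix_intertwine:
  fixes n :: nat
  assumes x: "x \<in> carrier R"
    and cl: "\<And>i j. i \<in> {1..n} \<Longrightarrow> j \<in> {1..n} \<Longrightarrow> M i j \<in> carrier R"
      "\<And>i j. i \<in> {1..n} \<Longrightarrow> j \<in> {1..n} \<Longrightarrow> C i j \<in> carrier R"
      "\<And>i j. i \<in> {1..n} \<Longrightarrow> j \<in> {1..n} \<Longrightarrow> V i j \<in> carrier R"
    and eq: "\<And>i j. i \<in> {1..n} \<Longrightarrow> j \<in> {1..n} \<Longrightarrow>
      (\<Oplus>k\<in>{1..n}. M i k \<otimes> C k j) = (\<Oplus>k\<in>{1..n}. C i k \<otimes> V k j)"
    and ij: "i \<in> {1..n}" "j \<in> {1..n}"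
  shows "(\<Oplus>k\<in>{1..n}. ((if i = k then x else \<zero>) \<ominus> M i k) \<otimes> C k j)
    = (\<Oplus>k\<in>{1..n}. C i k \<otimes> ((if k = j then x else \<zero>) \<ominus> V k j))"
proof -
  have diff: "(\<Oplus>k\<in>{1..n}. f k \<ominus> g k) = (\<Oplus>k\<in>{1..n}. f k) \<ominus> (\<Oplus>k\<in>{1..n}. g k)"
    if "f \<in> {1..n} \<rightarrow> carrier R" "g \<in> {1..n} \<rightarrow> carrier R" for f g :: "nat \<Rightarrow> 'a"
  proof -
    have "(\<Oplus>k\<in>{1..n}. f k \<ominus> g k) \<oplus> (\<Oplus>k\<in>{1..n}. g k) = (\<Oplus>k\<in>{1..n}. f k \<ominus> g k \<oplus> g k)"
      using that by (intro finsum_addf[symmetric]) auto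
    also have "\<dots> = (\<Oplus>k\<in>{1..n}. f k)"
      using that by (intro finsum_cong') (auto simp: minus_eq a_assoc l_neg Pi_def)
    finally have s: "(\<Oplus>k\<in>{1..n}. f k \<ominus> g k) \<oplus> (\<Oplus>k\<in>{1..n}. g k) = (\<Oplus>k\<in>{1..n}. f k)" .
    have c: "(\<Oplus>k\<in>{1..n}. f k \<ominus> g k) \<in> carrier R" "(\<Oplus>k\<in>{1..n}. g k) \<in> carrier R"
      using that by (auto intro!: finsum_closed)
    show ?thesis unfolding s[symmetric] using c by (simp add: minus_eq a_assoc r_neg)
  qed
  have "(\<Oplus>k\<in>{1..n}. ((if i = k then x else \<zero>) \<ominus> M i k) \<otimes> C k j)
      = (\<Oplus>k\<in>{1..n}. (if i = k then x \<otimes> C k j else \<zero>) \<ominus> M i k \<otimes> C k j)"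
    using x cl ij by (intro finsum_cong') (auto simp: minus_eq l_distr l_minus)
  also have "\<dots> = (\<Oplus>k\<in>{1..n}. if i = k then x \<otimes> C k j else \<zero>) \<ominus> (\<Oplus>k\<in>{1..n}. M i k \<otimes> C k j)"
    using x cl ij by (intro diff) auto
  also have "(\<Oplus>k\<in>{1..n}. if i = k then x \<otimes> C k j else \<zero>) = x \<otimes> C i j"
    using x cl ij by (intro finsum_singleton) auto
  finally have left: "(\<Oplus>k\<in>{1..n}. ((if i = k then x else \<zero>) \<ominus> M i k) \<otimes> C k j)
      = x \<otimes> C i j \<ominus> (\<Oplus>k\<in>{1..n}. M i k \<otimes> C k j)" .
  have "(\<Oplus>k\<in>{1..n}. C i k \<otimes> ((if k = j then x else \<zero>) \<ominus> V k j))
      = (\<Oplus>k\<in>{1..n}. (if j = k then C i k \<otimes> x else \<zero>) \<ominus> C i k \<otimes> V k j)"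
    using x cl ij by (intro finsum_cong') (auto simp: minus_eq r_distr r_minus)
  also have "\<dots> = (\<Oplus>k\<in>{1..n}. if j = k then C i k \<otimes> x else \<zero>) \<ominus> (\<Oplus>k\<in>{1..n}. C i k \<otimes> V k j)"
    using x cl ij by (intro diff) auto
  also have "(\<Oplus>k\<in>{1..n}. if j = k then C i k \<otimes> x else \<zero>) = C i j \<otimes> x"
    using x cl ij by (intro finsum_singleton) auto
  finally show ?thesis using left eq[OF ij] x cl ij by (simp add: m_comm)
qed

text \<open>A basis \<open>\<epsilon>\<close> of \<open>A\<close> is fixed; \<open>mm b\<close> is the matrix of multiplication by \<open>b\<close>, and \<open>chi b\<close> its
  characteristic polynomial.\<close>

locale mono_alg = A?: algebra R A for R :: "('r, 'x) ring_scheme" (structure)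
    and A :: "('r, 'a, 'y) module_scheme" (structure) +
  fixes n :: nat and \<epsilon> :: "nat \<Rightarrow> 'a" and a :: 'a
  assumes basis: "is_basis R A n \<epsilon>" and gen: "generates R A a"
begin

abbreviation "crd \<equiv> coords R A n \<epsilon>"
abbreviation "ev \<equiv> eval_at R A a"
definition "mm b i j = crd (b \<otimes>\<^bsub>A\<^esub> \<epsilon> j) i"
definition "chi b = ring_det (UP R) n (char_matrix R (mm b))"

sublocale UPR: UP_cring R "UP R" by (intro UP_cring.intro A.R_cring) simp

sublocale pre: UP_pre_univ_prop R A "\<lambda>r. r \<odot>\<^bsub>A\<^esub> \<one>\<^bsub>A\<^esub>" "UP R"
  by (intro UP_pre_univ_prop.intro ring_hom_cringI A.R_cring A.M_cring A.structure_hom UPR.UP_cring_axioms)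

lemma eps_closed [simp]: "i \<in> {1..n} \<Longrightarrow> \<epsilon> i \<in> carrier A"
  using basis by (auto simp: is_basis_def)

lemma crd_spec:
  assumes "x \<in> carrier A"
  shows "crd x \<in> {1..n} \<rightarrow>\<^sub>E carrier R" "x = (\<Oplus>\<^bsub>A\<^esub>i\<in>{1..n}. crd x i \<odot>\<^bsub>A\<^esub> \<epsilon> i)"
  using theI'[of "\<lambda>c. c \<in> {1..n} \<rightarrow>\<^sub>E carrier R \<and> x = (\<Oplus>\<^bsub>A\<^esub>i\<in>{1..n}. c i \<odot>\<^bsub>A\<^esub> \<epsilon> i)"] basis assms
  unfolding coords_def is_basis_def by blast+

lemma crd_closed [simp]: "x \<in> carrier A \<Longrightarrow> i \<in> {1..n} \<Longrightarrow> crd x i \<in> carrier R"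
  using crd_spec(1) by (auto simp: PiE_iff)

lemma crd_unique:
  assumes x: "x \<in> carrier A" and c: "\<And>i. i \<in> {1..n} \<Longrightarrow> c i \<in> carrier R"
    and eq: "x = (\<Oplus>\<^bsub>A\<^esub>i\<in>{1..n}. c i \<odot>\<^bsub>A\<^esub> \<epsilon> i)" and i: "i \<in> {1..n}"
  shows "crd x i = c i"
proof -
  have "x = (\<Oplus>\<^bsub>A\<^esub>i\<in>{1..n}. (\<lambda>i\<in>{1..n}. c i) i \<odot>\<^bsub>A\<^esub> \<epsilon> i)"
    unfolding eq using c by (intro A.M.finsum_cong') auto
  moreover have "(\<lambda>i\<in>{1..n}. c i) \<in> {1..n} \<rightarrow>\<^sub>E carrier R" using c by auto
  ultimately have "crd x = (\<lambda>i\<in>{1..n}. c i)"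
    using basis x crd_spec[OF x] unfolding is_basis_def by blast
  then show ?thesis using i by simp
qed

lemma crd_add:
  assumes "x \<in> carrier A" "y \<in> carrier A" "i \<in> {1..n}"
  shows "crd (x \<oplus>\<^bsub>A\<^esub> y) i = crd x i \<oplus>\<^bsub>R\<^esub> crd y i"
proof (rule crd_unique[where c = "\<lambda>i. crd x i \<oplus>\<^bsub>R\<^esub> crd y i"])
  have "(\<Oplus>\<^bsub>A\<^esub>i\<in>{1..n}. (crd x i \<oplus>\<^bsub>R\<^esub> crd y i) \<odot>\<^bsub>A\<^esub> \<epsilon> i)
      = (\<Oplus>\<^bsub>A\<^esub>i\<in>{1..n}. crd x i \<odot>\<^bsub>A\<^esub> \<epsilon> i) \<oplus>\<^bsub>A\<^esub> (\<Oplus>\<^bsub>A\<^esub>i\<in>{1..n}. crd y i \<odot>\<^bsub>A\<^esub> \<epsilon> i)"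
    using assms by (subst A.M.finsum_addf[symmetric])
      (auto simp: A.smult_l_distr simp del: A.M.finsum_addf intro!: A.M.finsum_cong')
  then show "x \<oplus>\<^bsub>A\<^esub> y = (\<Oplus>\<^bsub>A\<^esub>i\<in>{1..n}. (crd x i \<oplus>\<^bsub>R\<^esub> crd y i) \<odot>\<^bsub>A\<^esub> \<epsilon> i)"
    using crd_spec(2)[OF assms(1)] crd_spec(2)[OF assms(2)] by simp
qed (use assms in auto)

lemma crd_smult:
  assumes "r \<in> carrier R" "x \<in> carrier A" "i \<in> {1..n}"
  shows "crd (r \<odot>\<^bsub>A\<^esub> x) i = r \<otimes>\<^bsub>R\<^esub> crd x i"
proof (rule crd_unique[where c = "\<lambda>i. r \<otimes>\<^bsub>R\<^esub> crd x i"])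
  have "(\<Oplus>\<^bsub>A\<^esub>i\<in>{1..n}. (r \<otimes>\<^bsub>R\<^esub> crd x i) \<odot>\<^bsub>A\<^esub> \<epsilon> i) = r \<odot>\<^bsub>A\<^esub> (\<Oplus>\<^bsub>A\<^esub>i\<in>{1..n}. crd x i \<odot>\<^bsub>A\<^esub> \<epsilon> i)"
    using assms by (subst A.finsum_smult_ldistr) (auto simp: A.smult_assoc1 intro!: A.M.finsum_cong')
  then show "r \<odot>\<^bsub>A\<^esub> x = (\<Oplus>\<^bsub>A\<^esub>i\<in>{1..n}. (r \<otimes>\<^bsub>R\<^esub> crd x i) \<odot>\<^bsub>A\<^esub> \<epsilon> i)"
    using crd_spec(2)[OF assms(2)] by simp
qed (use assms in auto)

lemma crd_zero: "i \<in> {1..n} \<Longrightarrow> crd \<zero>\<^bsub>A\<^esub> i = \<zero>\<^bsub>R\<^esub>"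
  using crd_smult[of "\<zero>\<^bsub>R\<^esub>" "\<zero>\<^bsub>A\<^esub>" i] by simp

lemma crd_eps:
  assumes "k \<in> {1..n}" "i \<in> {1..n}"
  shows "crd (\<epsilon> k) i = (if k = i then \<one>\<^bsub>R\<^esub> else \<zero>\<^bsub>R\<^esub>)"
proof (rule crd_unique[where c = "\<lambda>i. if k = i then \<one>\<^bsub>R\<^esub> else \<zero>\<^bsub>R\<^esub>"])
  have "(\<Oplus>\<^bsub>A\<^esub>i\<in>{1..n}. (if k = i then \<one>\<^bsub>R\<^esub> else \<zero>\<^bsub>R\<^esub>) \<odot>\<^bsub>A\<^esub> \<epsilon> i)
      = (\<Oplus>\<^bsub>A\<^esub>i\<in>{1..n}. if k = i then \<epsilon> i else \<zero>\<^bsub>A\<^esub>)"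
    by (intro A.M.finsum_cong') auto
  also have "\<dots> = \<epsilon> k" using assms by (intro A.M.finsum_singleton) auto
  finally show "\<epsilon> k = (\<Oplus>\<^bsub>A\<^esub>i\<in>{1..n}. (if k = i then \<one>\<^bsub>R\<^esub> else \<zero>\<^bsub>R\<^esub>) \<odot>\<^bsub>A\<^esub> \<epsilon> i)" ..
qed (use assms in auto)

lemma crd_finsum:
  assumes "f \<in> I \<rightarrow> carrier A" "i \<in> {1..n}"
  shows "crd (\<Oplus>\<^bsub>A\<^esub>k\<in>I. f k) i = (\<Oplus>\<^bsub>R\<^esub>k\<in>I. crd (f k) i)"
  using assms(1)
  by (induction I rule: infinite_finite_induct)
     (simp_all add: crd_zero[OF assms(2)] crd_add[OF _ _ assms(2)] crd_closed[OF _ assms(2)] Pi_def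
        A.M.finsum_closed)

lemma mm_closed [simp]: "b \<in> carrier A \<Longrightarrow> i \<in> {1..n} \<Longrightarrow> j \<in> {1..n} \<Longrightarrow> mm b i j \<in> carrier R"
  by (simp add: mm_def)

lemma crd_mult:
  assumes "b \<in> carrier A" "y \<in> carrier A" "i \<in> {1..n}"
  shows "crd (b \<otimes>\<^bsub>A\<^esub> y) i = (\<Oplus>\<^bsub>R\<^esub>k\<in>{1..n}. mm b i k \<otimes>\<^bsub>R\<^esub> crd y k)"
proof -
  have "b \<otimes>\<^bsub>A\<^esub> y = (\<Oplus>\<^bsub>A\<^esub>k\<in>{1..n}. b \<otimes>\<^bsub>A\<^esub> (crd y k \<odot>\<^bsub>A\<^esub> \<epsilon> k))"
    using assms by (subst crd_spec(2)[OF assms(2)]) (intro A.finsum_rdistr, auto)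
  also have "\<dots> = (\<Oplus>\<^bsub>A\<^esub>k\<in>{1..n}. crd y k \<odot>\<^bsub>A\<^esub> (b \<otimes>\<^bsub>A\<^esub> \<epsilon> k))"
  proof (intro A.M.finsum_cong' refl)
    fix k assume k: "k \<in> {1..n}"
    then show "b \<otimes>\<^bsub>A\<^esub> (crd y k \<odot>\<^bsub>A\<^esub> \<epsilon> k) = crd y k \<odot>\<^bsub>A\<^esub> (b \<otimes>\<^bsub>A\<^esub> \<epsilon> k)"
      using assms A.m_comm A.smult_assoc2 by (metis A.smult_closed crd_closed eps_closed)
  qed (use assms in auto)
  finally have eq: "b \<otimes>\<^bsub>A\<^esub> y = (\<Oplus>\<^bsub>A\<^esub>k\<in>{1..n}. crd y k \<odot>\<^bsub>A\<^esub> (b \<otimes>\<^bsub>A\<^esub> \<epsilon> k))" .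
  have "crd (b \<otimes>\<^bsub>A\<^esub> y) i = (\<Oplus>\<^bsub>R\<^esub>k\<in>{1..n}. crd (crd y k \<odot>\<^bsub>A\<^esub> (b \<otimes>\<^bsub>A\<^esub> \<epsilon> k)) i)"
    unfolding eq using assms by (intro crd_finsum) auto
  also have "\<dots> = (\<Oplus>\<^bsub>R\<^esub>k\<in>{1..n}. mm b i k \<otimes>\<^bsub>R\<^esub> crd y k)"
  proof (intro A.R.finsum_cong' refl)
    fix k assume k: "k \<in> {1..n}"
    then have "crd (crd y k \<odot>\<^bsub>A\<^esub> (b \<otimes>\<^bsub>A\<^esub> \<epsilon> k)) i = crd y k \<otimes>\<^bsub>R\<^esub> mm b i k"
      unfolding mm_def using assms by (intro crd_smult) auto
    also have "\<dots> = mm b i k \<otimes>\<^bsub>R\<^esub> crd y k"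
      using assms k by (intro A.R.m_comm) auto
    finally show "crd (crd y k \<odot>\<^bsub>A\<^esub> (b \<otimes>\<^bsub>A\<^esub> \<epsilon> k)) i = mm b i k \<otimes>\<^bsub>R\<^esub> crd y k" .
  qed (use assms in auto)
  finally show ?thesis .
qed

lemma mm_zero: "i \<in> {1..n} \<Longrightarrow> j \<in> {1..n} \<Longrightarrow> mm \<zero>\<^bsub>A\<^esub> i j = \<zero>\<^bsub>R\<^esub>"
  by (simp add: mm_def crd_zero)

lemma a_closed' [simp]: "a \<in> carrier A" using gen by (simp add: generates_def)

lemma ev_surj: "b \<in> carrier A \<Longrightarrow> \<exists>g\<in>carrier (UP R). ev g = b"
proof -
  assume "b \<in> carrier A"
  then have "b \<in> ev ` carrier (UP R)" using gen by (simp add: generates_def)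
  then show ?thesis by auto
qed

lemma ev_hom': "x \<in> carrier A \<Longrightarrow> eval_at R A x \<in> ring_hom (UP R) A"
  unfolding eval_at_def by (rule pre.eval_ring_hom)

lemmas ev_hom = ev_hom'[OF a_closed']

lemma ev_closed [simp]: "g \<in> carrier (UP R) \<Longrightarrow> ev g \<in> carrier A"
  by (rule ring_hom_closed[OF ev_hom])

lemma ev_monom': "x \<in> carrier A \<Longrightarrow> r \<in> carrier R \<Longrightarrow> eval_at R A x (up_ring.monom (UP R) r m) = r \<odot>\<^bsub>A\<^esub> (x [^]\<^bsub>A\<^esub> m)"
  unfolding eval_at_def by (simp add: pre.eval_monom A.smult_assoc2)

lemmas ev_monom = ev_monom'[OF a_closed']

lemma chi_monic: "b \<in> carrier A \<Longrightarrow> monic_of_degree R n (chi b)"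
  unfolding chi_def by (intro A.R.char_poly_monic) simp

lemma chi_closed: "b \<in> carrier A \<Longrightarrow> chi b \<in> carrier (UP R)"
  using chi_monic by (simp add: monic_of_degree_def)

text \<open>Cayley--Hamilton by the determinant trick: the matrix \<open>b \<delta>\<^sub>i\<^sub>j - mm b i j\<close> over \<open>A\<close>
  annihilates the row of basis vectors, so its determinant annihilates each of them.\<close>

lemma cayley_hamilton:
  assumes b: "b \<in> carrier A"
  shows "eval_at R A b (chi b) = \<zero>\<^bsub>A\<^esub>"
proof -
  let ?e = "eval_at R A b"
  interpret e: ring_hom_cring "UP R" A ?e
    by (rule ring_hom_cringI[OF UPR.UP_cring A.M_cring ev_hom'[OF b]])
  define N where "N i j = (if i = j then b else \<zero>\<^bsub>A\<^esub>) \<ominus>\<^bsub>A\<^esub> (mm b i j \<odot>\<^bsub>A\<^esub> \<one>\<^bsub>A\<^esub>)" for i j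
  have N [simp]: "N i j \<in> carrier A" if "i \<in> {1..n}" "j \<in> {1..n}" for i j
    using that b by (simp add: N_def)
  have entry: "?e (char_matrix R (mm b) i j) = N i j" if "i \<in> {1..n}" "j \<in> {1..n}" for i j
  proof -
    have x: "?e (up_ring.monom (UP R) \<one>\<^bsub>R\<^esub> 1) = b" using b by (simp add: ev_monom'[OF b])
    have c: "?e (up_ring.monom (UP R) (mm b i j) 0) = mm b i j \<odot>\<^bsub>A\<^esub> \<one>\<^bsub>A\<^esub>"
      using that b by (simp add: ev_monom'[OF b])
    have m: "mm b i j \<in> carrier R" using that b by simp
    have "?e (char_matrix R (mm b) i j) = ?e (if i = j then up_ring.monom (UP R) \<one>\<^bsub>R\<^esub> 1 else \<zero>\<^bsub>UP R\<^esub>)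
        \<ominus>\<^bsub>A\<^esub> ?e (up_ring.monom (UP R) (mm b i j) 0)"
      using m by (simp add: a_minus_def)
    also have "\<dots> = N i j" unfolding c N_def using x by simp
    finally show ?thesis .
  qed
  have det: "?e (chi b) = ring_det A n N"
  proof -
    have "?e (chi b) = ring_det A n (\<lambda>i j. ?e (char_matrix R (mm b) i j))"
      unfolding chi_def using b by (intro e.ring_det_hom) auto
    also have "\<dots> = ring_det A n N" by (rule ring_det_cong[OF A.M_cring entry N])
    finally show ?thesis .
  qed
  have d: "ring_det A n N \<in> carrier A" by (rule A.ring_det_closed) simp
  have zero: "(\<Oplus>\<^bsub>A\<^esub>i\<in>{1..n}. \<epsilon> i \<otimes>\<^bsub>A\<^esub> N i j) = \<zero>\<^bsub>A\<^esub>" if j: "j \<in> {1..n}" for j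
  proof -
    have "(\<Oplus>\<^bsub>A\<^esub>i\<in>{1..n}. \<epsilon> i \<otimes>\<^bsub>A\<^esub> N i j) \<oplus>\<^bsub>A\<^esub> (\<Oplus>\<^bsub>A\<^esub>i\<in>{1..n}. mm b i j \<odot>\<^bsub>A\<^esub> \<epsilon> i)
        = (\<Oplus>\<^bsub>A\<^esub>i\<in>{1..n}. \<epsilon> i \<otimes>\<^bsub>A\<^esub> N i j \<oplus>\<^bsub>A\<^esub> mm b i j \<odot>\<^bsub>A\<^esub> \<epsilon> i)"
      using b j by (intro A.M.finsum_addf[symmetric]) auto
    also have "\<dots> = (\<Oplus>\<^bsub>A\<^esub>i\<in>{1..n}. if j = i then b \<otimes>\<^bsub>A\<^esub> \<epsilon> i else \<zero>\<^bsub>A\<^esub>)"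
    proof (intro A.M.finsum_cong' refl)
      fix i assume i: "i \<in> {1..n}"
      have "\<epsilon> i \<otimes>\<^bsub>A\<^esub> (mm b i j \<odot>\<^bsub>A\<^esub> \<one>\<^bsub>A\<^esub>) = mm b i j \<odot>\<^bsub>A\<^esub> \<epsilon> i"
        using i j b by (simp add: A.m_comm[of "\<epsilon> i"] A.smult_assoc2)
      then have "\<epsilon> i \<otimes>\<^bsub>A\<^esub> N i j = \<epsilon> i \<otimes>\<^bsub>A\<^esub> (if i = j then b else \<zero>\<^bsub>A\<^esub>) \<ominus>\<^bsub>A\<^esub> mm b i j \<odot>\<^bsub>A\<^esub> \<epsilon> i"
        unfolding N_def using i j b by (subst A.mult_minus_distr) auto
      then have "\<epsilon> i \<otimes>\<^bsub>A\<^esub> N i j \<oplus>\<^bsub>A\<^esub> mm b i j \<odot>\<^bsub>A\<^esub> \<epsilon> i = \<epsilon> i \<otimes>\<^bsub>A\<^esub> (if i = j then b else \<zero>\<^bsub>A\<^esub>)"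
        using i j b by (simp add: a_minus_def A.M.a_assoc A.M.l_neg)
      then show "\<epsilon> i \<otimes>\<^bsub>A\<^esub> N i j \<oplus>\<^bsub>A\<^esub> mm b i j \<odot>\<^bsub>A\<^esub> \<epsilon> i = (if j = i then b \<otimes>\<^bsub>A\<^esub> \<epsilon> i else \<zero>\<^bsub>A\<^esub>)"
        using i b A.m_comm[of "\<epsilon> i" b] by auto
    qed (use b in auto)
    also have "\<dots> = b \<otimes>\<^bsub>A\<^esub> \<epsilon> j" using j b by (intro A.M.finsum_singleton) auto
    also have "\<dots> = (\<Oplus>\<^bsub>A\<^esub>i\<in>{1..n}. mm b i j \<odot>\<^bsub>A\<^esub> \<epsilon> i)"
      unfolding mm_def using b j by (intro crd_spec(2)) auto
    finally show ?thesis
      by (rule A.M.add_eq_self_imp_zero[rotated -1]) (use b j in \<open>auto intro!: A.M.finsum_closed\<close>)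
  qed
  obtain Z where Z: "\<And>i j. Z i j \<in> carrier A"
    and adj: "\<And>i j. i \<in> {1..n} \<Longrightarrow> j \<in> {1..n} \<Longrightarrow>
      (\<Oplus>\<^bsub>A\<^esub>k\<in>{1..n}. N i k \<otimes>\<^bsub>A\<^esub> Z k j) = (if i = j then ring_det A n N else \<zero>\<^bsub>A\<^esub>)"
    by (rule A.obtain_adjugate[of n N]) (use N in auto)
  have kill: "ring_det A n N \<otimes>\<^bsub>A\<^esub> \<epsilon> k = \<zero>\<^bsub>A\<^esub>" if k: "k \<in> {1..n}" for k
  proof -
    have "\<epsilon> k \<otimes>\<^bsub>A\<^esub> ring_det A n N = (\<Oplus>\<^bsub>A\<^esub>i\<in>{1..n}. if k = i then \<epsilon> i \<otimes>\<^bsub>A\<^esub> ring_det A n N else \<zero>\<^bsub>A\<^esub>)"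
      using k d by (intro A.M.finsum_singleton[symmetric]) auto
    also have "\<dots> = (\<Oplus>\<^bsub>A\<^esub>i\<in>{1..n}. \<Oplus>\<^bsub>A\<^esub>j\<in>{1..n}. \<epsilon> i \<otimes>\<^bsub>A\<^esub> (N i j \<otimes>\<^bsub>A\<^esub> Z j k))"
    proof (intro A.M.finsum_cong' refl)
      fix i assume i: "i \<in> {1..n}"
      have "(\<Oplus>\<^bsub>A\<^esub>j\<in>{1..n}. \<epsilon> i \<otimes>\<^bsub>A\<^esub> (N i j \<otimes>\<^bsub>A\<^esub> Z j k)) = \<epsilon> i \<otimes>\<^bsub>A\<^esub> (\<Oplus>\<^bsub>A\<^esub>j\<in>{1..n}. N i j \<otimes>\<^bsub>A\<^esub> Z j k)"
        using i Z by (intro A.finsum_rdistr[symmetric]) auto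
      then show "(if k = i then \<epsilon> i \<otimes>\<^bsub>A\<^esub> ring_det A n N else \<zero>\<^bsub>A\<^esub>) = (\<Oplus>\<^bsub>A\<^esub>j\<in>{1..n}. \<epsilon> i \<otimes>\<^bsub>A\<^esub> (N i j \<otimes>\<^bsub>A\<^esub> Z j k))"
        using adj[OF i k] i by auto
    qed (use Z in \<open>auto intro!: A.M.finsum_closed\<close>)
    also have "\<dots> = (\<Oplus>\<^bsub>A\<^esub>j\<in>{1..n}. \<Oplus>\<^bsub>A\<^esub>i\<in>{1..n}. \<epsilon> i \<otimes>\<^bsub>A\<^esub> (N i j \<otimes>\<^bsub>A\<^esub> Z j k))"
      by (rule A.M.finsum_swap) (use Z in auto)
    also have "\<dots> = (\<Oplus>\<^bsub>A\<^esub>j\<in>{1..n}. \<zero>\<^bsub>A\<^esub>)"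
    proof (intro A.M.finsum_cong' refl)
      fix j assume j: "j \<in> {1..n}"
      have "(\<Oplus>\<^bsub>A\<^esub>i\<in>{1..n}. \<epsilon> i \<otimes>\<^bsub>A\<^esub> (N i j \<otimes>\<^bsub>A\<^esub> Z j k)) = (\<Oplus>\<^bsub>A\<^esub>i\<in>{1..n}. \<epsilon> i \<otimes>\<^bsub>A\<^esub> N i j \<otimes>\<^bsub>A\<^esub> Z j k)"
        using j Z by (intro A.M.finsum_cong') (auto simp: A.m_assoc)
      also have "\<dots> = (\<Oplus>\<^bsub>A\<^esub>i\<in>{1..n}. \<epsilon> i \<otimes>\<^bsub>A\<^esub> N i j) \<otimes>\<^bsub>A\<^esub> Z j k"
        using j Z by (intro A.finsum_ldistr[symmetric]) auto
      finally show "(\<Oplus>\<^bsub>A\<^esub>i\<in>{1..n}. \<epsilon> i \<otimes>\<^bsub>A\<^esub> (N i j \<otimes>\<^bsub>A\<^esub> Z j k)) = \<zero>\<^bsub>A\<^esub>"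
        using zero[OF j] Z by simp
    qed auto
    finally show ?thesis using d k by (simp add: A.m_comm)
  qed
  have one: "(\<Oplus>\<^bsub>A\<^esub>k\<in>{1..n}. crd \<one>\<^bsub>A\<^esub> k \<odot>\<^bsub>A\<^esub> \<epsilon> k) = \<one>\<^bsub>A\<^esub>"
    by (rule crd_spec(2)[symmetric]) simp
  have "ring_det A n N = ring_det A n N \<otimes>\<^bsub>A\<^esub> (\<Oplus>\<^bsub>A\<^esub>k\<in>{1..n}. crd \<one>\<^bsub>A\<^esub> k \<odot>\<^bsub>A\<^esub> \<epsilon> k)"
    unfolding one using d by simp
  also have "\<dots> = (\<Oplus>\<^bsub>A\<^esub>k\<in>{1..n}. ring_det A n N \<otimes>\<^bsub>A\<^esub> (crd \<one>\<^bsub>A\<^esub> k \<odot>\<^bsub>A\<^esub> \<epsilon> k))"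
    using d by (intro A.finsum_rdistr) auto
  also have "\<dots> = (\<Oplus>\<^bsub>A\<^esub>k\<in>{1..n}. \<zero>\<^bsub>A\<^esub>)"
  proof (intro A.M.finsum_cong' refl)
    fix k assume k: "k \<in> {1..n}"
    have "ring_det A n N \<otimes>\<^bsub>A\<^esub> (crd \<one>\<^bsub>A\<^esub> k \<odot>\<^bsub>A\<^esub> \<epsilon> k) = crd \<one>\<^bsub>A\<^esub> k \<odot>\<^bsub>A\<^esub> (ring_det A n N \<otimes>\<^bsub>A\<^esub> \<epsilon> k)"
      using d k by (simp add: A.m_comm[of "ring_det A n N"] A.smult_assoc2)
    then show "ring_det A n N \<otimes>\<^bsub>A\<^esub> (crd \<one>\<^bsub>A\<^esub> k \<odot>\<^bsub>A\<^esub> \<epsilon> k) = \<zero>\<^bsub>A\<^esub>" using k by (simp add: kill)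
  qed auto
  finally show ?thesis unfolding det by simp
qed

end

text \<open>A homomorphism \<open>j: R \<rightarrow> Q\<close> together with elements \<open>q 1, \<dots>, q n\<close> of \<open>Q\<close> that split the
  characteristic polynomial of the generator.  Polynomials over \<open>Q\<close> are handled through lifts to
  the ring \<open>'t\<close> of class \<open>comm_ring_1\<close>, which \<open>h\<close> maps onto \<open>Q\<close>.\<close>

locale split_alg = mono_alg R A n \<epsilon> a + h: class_hom Q h
  for R :: "('r, 'x) ring_scheme" (structure) and A :: "('r, 'a, 'y) module_scheme" (structure)
    and n :: nat and \<epsilon> :: "nat \<Rightarrow> 'a" and a :: 'a
    and Q :: "('q, 'z) ring_scheme" (structure) and h :: "'t::comm_ring_1 \<Rightarrow> 'q" +
  fixes lift :: "'q \<Rightarrow> 't" and j :: "'r \<Rightarrow> 'q" and q :: "nat \<Rightarrow> 'q"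
  assumes lift: "\<And>x. x \<in> carrier Q \<Longrightarrow> h (lift x) = x"
    and j_hom: "j \<in> ring_hom R Q"
    and q_closed: "\<And>i. i \<in> {1..n} \<Longrightarrow> q i \<in> carrier Q"
    and roots: "\<And>k. k \<in> {1..n} \<Longrightarrow> esym Q n k q = j ((\<ominus>\<^bsub>R\<^esub> \<one>\<^bsub>R\<^esub>) [^]\<^bsub>R\<^esub> k \<otimes>\<^bsub>R\<^esub> chi a (n - k))"
begin

sublocale j: ring_hom_cring R Q j
  by (rule ring_hom_cringI[OF A.R_cring h.S.is_cring j_hom])

sublocale preQ: UP_pre_univ_prop R Q j "UP R"
  by (intro UP_pre_univ_prop.intro j.ring_hom_cring_axioms UPR.UP_cring_axioms)

text \<open>\<open>V p\<close> is the coordinate vector over \<open>Q\<close> of \<open>p(a) \<in> A \<otimes> Q\<close>, which stands for that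
  element; \<open>w 0, \<dots>, w n\<close> are the Newton polynomials of the roots.\<close>

definition "qt i = lift (q i)"
definition "w k = (\<Prod>i = 1..k. [:- qt i, 1:])"
definition "V p i = (\<Oplus>\<^bsub>Q\<^esub>l\<in>{..Polynomial.degree p}. h (Polynomial.coeff p l) \<otimes>\<^bsub>Q\<^esub> j (crd (a [^]\<^bsub>A\<^esub> l) i))"
definition "lifts p g \<longleftrightarrow> (\<forall>l. h (Polynomial.coeff p l) = j (g l))"

abbreviation "evQ i g \<equiv> UnivPoly.eval R Q j (q i) g"

lemma h_qt: "i \<in> {1..n} \<Longrightarrow> h (qt i) = q i" by (simp add: qt_def lift q_closed)

lemma pow_closed [simp]: "a [^]\<^bsub>A\<^esub> (l::nat) \<in> carrier A" by (rule A.nat_pow_closed) simp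

lemma jc_closed [simp]: "x \<in> carrier A \<Longrightarrow> i \<in> {1..n} \<Longrightarrow> j (crd x i) \<in> carrier Q"
  by (rule j.hom_closed) simp

lemma V_alt:
  assumes "i \<in> {1..n}" "Polynomial.degree p \<le> N"
  shows "V p i = (\<Oplus>\<^bsub>Q\<^esub>l\<in>{..N}. h (Polynomial.coeff p l) \<otimes>\<^bsub>Q\<^esub> j (crd (a [^]\<^bsub>A\<^esub> l) i))"
  unfolding V_def using assms
  by (intro h.S.add.finprod_mono_neutral_cong_left) (auto simp: Polynomial.coeff_eq_0 h.h_0)

lemma V_closed [simp]: "i \<in> {1..n} \<Longrightarrow> V p i \<in> carrier Q"
  unfolding V_def by (intro h.S.finsum_closed) auto

lemma V_cong:
  assumes "i \<in> {1..n}" "\<And>l. h (Polynomial.coeff p l) = h (Polynomial.coeff p' l)"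
  shows "V p i = V p' i"
  using V_alt[OF assms(1), of p "max (Polynomial.degree p) (Polynomial.degree p')"]
    V_alt[OF assms(1), of p' "max (Polynomial.degree p) (Polynomial.degree p')"] assms(2) by simp

lemma V_add:
  assumes i: "i \<in> {1..n}"
  shows "V (p + p') i = V p i \<oplus>\<^bsub>Q\<^esub> V p' i"
proof -
  let ?N = "max (Polynomial.degree p) (Polynomial.degree p')"
  have d: "Polynomial.degree (p + p') \<le> ?N" by (rule degree_add_le_max)
  show ?thesis
    unfolding V_alt[OF i, of p ?N, OF max.cobounded1] V_alt[OF i, of p' ?N, OF max.cobounded2]
      V_alt[OF i d]
    by (subst h.S.finsum_addf[symmetric])
       (use i in \<open>auto simp: h.h_plus h.S.l_distr simp del: h.S.finsum_addf intro!: h.S.finsum_cong'\<close>)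
qed

lemma V_monom:
  assumes i: "i \<in> {1..n}"
  shows "V (Polynomial.monom c m) i = h c \<otimes>\<^bsub>Q\<^esub> j (crd (a [^]\<^bsub>A\<^esub> m) i)"
proof -
  have "V (Polynomial.monom c m) i
      = (\<Oplus>\<^bsub>Q\<^esub>l\<in>{..m}. if m = l then h c \<otimes>\<^bsub>Q\<^esub> j (crd (a [^]\<^bsub>A\<^esub> l) i) else \<zero>\<^bsub>Q\<^esub>)"
    unfolding V_alt[OF i degree_monom_le] using i by (intro h.S.finsum_cong') (auto simp: h.h_0)
  also have "\<dots> = h c \<otimes>\<^bsub>Q\<^esub> j (crd (a [^]\<^bsub>A\<^esub> m) i)"
    using i by (intro h.S.finsum_singleton) auto
  finally show ?thesis .
qed

lemma V_zero: "i \<in> {1..n} \<Longrightarrow> V 0 i = \<zero>\<^bsub>Q\<^esub>"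
  using V_monom[of i 0 0] by (simp add: h.h_0)

lemma V_smult:
  assumes i: "i \<in> {1..n}"
  shows "V (Polynomial.smult c p) i = h c \<otimes>\<^bsub>Q\<^esub> V p i"
proof (induction p rule: poly_monom_induct)
  case (1 d m)
  then show ?case using i by (simp add: Polynomial.smult_monom V_monom h.h_times h.S.m_assoc)
next
  case (2 p p')
  then show ?case using i by (simp add: smult_add_right V_add h.S.r_distr)
qed

lemma V_sum: "i \<in> {1..n} \<Longrightarrow> V (\<Sum>k\<in>I. f k) i = (\<Oplus>\<^bsub>Q\<^esub>k\<in>I. V (f k) i)"
  by (induction I rule: infinite_finite_induct) (auto simp: V_zero V_add)

lemma ex_lifts:
  assumes g: "g \<in> carrier (UP R)"
  shows "\<exists>p. lifts p g \<and> (\<forall>i\<in>{1..n}. h (poly p (qt i)) = evQ i g)"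
proof -
  let ?p = "\<Sum>l\<le>deg R g. Polynomial.monom (lift (j (g l))) l"
  have gl: "g l \<in> carrier R" for l
    using UPR.coeff_closed[OF g, of l] g by simp
  have jl: "h (lift (j (g l))) = j (g l)" for l by (intro lift j.hom_closed gl)
  have above: "g l = \<zero>\<^bsub>R\<^esub>" if "deg R g < l" for l
    using UPR.deg_aboveD[OF that g] g by simp
  have "h (Polynomial.coeff ?p l) = j (g l)" for l
  proof (cases "l \<le> deg R g")
    case True
    then show ?thesis by (simp add: Polynomial.coeff_sum jl)
  next
    case False
    then show ?thesis by (simp add: Polynomial.coeff_sum h.h_0 above)
  qed
  moreover have "h (poly ?p (qt i)) = evQ i g" if i: "i \<in> {1..n}" for i
  proof -
    have "h (poly ?p (qt i)) = (\<Oplus>\<^bsub>Q\<^esub>l\<in>{..deg R g}. j (g l) \<otimes>\<^bsub>Q\<^esub> q i [^]\<^bsub>Q\<^esub> l)"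
      by (simp add: poly_sum poly_monom h.h_sum h.h_times h.h_power jl h_qt[OF i])
    also have "\<dots> = evQ i g" using g by (simp add: UPR.eval_on_carrier)
    finally show ?thesis .
  qed
  ultimately show ?thesis unfolding lifts_def by blast
qed

lemma lifts_mult_cong:
  assumes "lifts p g" "lifts p' g" "i \<in> {1..n}"
  shows "V (p * t) i = V (p' * t) i"
proof (rule V_cong[OF assms(3)])
  show "h (Polynomial.coeff (p * t) l) = h (Polynomial.coeff (p' * t) l)" for l
    using assms(1,2) unfolding lifts_def by (simp add: Polynomial.coeff_mult h.h_sum h.h_times)
qed

lemma mm_add: "b \<in> carrier A \<Longrightarrow> b' \<in> carrier A \<Longrightarrow> i \<in> {1..n} \<Longrightarrow> k \<in> {1..n} \<Longrightarrow>
  mm (b \<oplus>\<^bsub>A\<^esub> b') i k = mm b i k \<oplus>\<^bsub>R\<^esub> mm b' i k"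
  by (simp add: mm_def A.l_distr crd_add)

lemma j_crd_mult:
  assumes "b \<in> carrier A" "y \<in> carrier A" "i \<in> {1..n}"
  shows "j (crd (b \<otimes>\<^bsub>A\<^esub> y) i) = (\<Oplus>\<^bsub>Q\<^esub>k\<in>{1..n}. j (mm b i k) \<otimes>\<^bsub>Q\<^esub> j (crd y k))"
  unfolding crd_mult[OF assms] using assms
  by (subst j.hom_finsum) (auto intro!: h.S.finsum_cong')

text \<open>This is \<open>(g t)(a) = g(a) t(a)\<close> in \<open>A \<otimes> Q\<close>, in coordinates.  Both sides are additive in \<open>g\<close> and \<open>t\<close>,
  which reduces the claim to \<open>a\<^sup>m a\<^sup>l = a\<^sup>m\<^sup>+\<^sup>l\<close>.\<close>

lemma V_mult:
  assumes g: "g \<in> carrier (UP R)" and "lifts p g" and i: "i \<in> {1..n}"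
  shows "V (p * t) i = (\<Oplus>\<^bsub>Q\<^esub>k\<in>{1..n}. j (mm (ev g) i k) \<otimes>\<^bsub>Q\<^esub> V t k)"
  using assms(1,2)
proof (induction g arbitrary: p rule: UPR.UP_monom_induct)
  case (monom r m)
  let ?g = "up_ring.monom (UP R) r m" and ?p = "Polynomial.monom (lift (j r)) m"
  let ?b = "r \<odot>\<^bsub>A\<^esub> (a [^]\<^bsub>A\<^esub> m)"
  have b: "ev ?g = ?b" using monom by (simp add: ev_monom)
  have bc: "?b \<in> carrier A" using monom by simp
  have jr: "h (lift (j r)) = j r" using monom by (intro lift j.hom_closed)
  have "lifts ?p ?g"
    using monom jr unfolding lifts_def by (auto simp: UP_monom h.h_0)
  then have "V (p * t) i = V (?p * t) i" by (rule lifts_mult_cong[OF monom(2) _ i])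
  also have "\<dots> = (\<Oplus>\<^bsub>Q\<^esub>k\<in>{1..n}. j (mm ?b i k) \<otimes>\<^bsub>Q\<^esub> V t k)"
  proof (induction t rule: poly_monom_induct)
    case (1 c l)
    have "V (?p * Polynomial.monom c l) i = h c \<otimes>\<^bsub>Q\<^esub> (j r \<otimes>\<^bsub>Q\<^esub> j (crd (a [^]\<^bsub>A\<^esub> (m + l)) i))"
      using monom(1) i by (simp add: Polynomial.mult_monom V_monom h.h_times jr h.S.m_ac)
    also have "j r \<otimes>\<^bsub>Q\<^esub> j (crd (a [^]\<^bsub>A\<^esub> (m + l)) i) = j (crd (?b \<otimes>\<^bsub>A\<^esub> (a [^]\<^bsub>A\<^esub> l)) i)"
      using monom(1) i by (simp add: A.smult_assoc2 A.nat_pow_mult crd_smult)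
    also have "\<dots> = (\<Oplus>\<^bsub>Q\<^esub>k\<in>{1..n}. j (mm ?b i k) \<otimes>\<^bsub>Q\<^esub> j (crd (a [^]\<^bsub>A\<^esub> l) k))"
      using bc i by (intro j_crd_mult) auto
    also have "h c \<otimes>\<^bsub>Q\<^esub> \<dots> = (\<Oplus>\<^bsub>Q\<^esub>k\<in>{1..n}. h c \<otimes>\<^bsub>Q\<^esub> (j (mm ?b i k) \<otimes>\<^bsub>Q\<^esub> j (crd (a [^]\<^bsub>A\<^esub> l) k)))"
      using bc i by (intro h.S.finsum_rdistr) auto
    also have "\<dots> = (\<Oplus>\<^bsub>Q\<^esub>k\<in>{1..n}. j (mm ?b i k) \<otimes>\<^bsub>Q\<^esub> V (Polynomial.monom c l) k)"
      using bc i by (intro h.S.finsum_cong') (auto simp: V_monom h.S.m_lcomm)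
    finally show ?case .
  next
    case (2 t t')
    have "(\<Oplus>\<^bsub>Q\<^esub>k\<in>{1..n}. j (mm ?b i k) \<otimes>\<^bsub>Q\<^esub> V (t + t') k)
        = (\<Oplus>\<^bsub>Q\<^esub>k\<in>{1..n}. j (mm ?b i k) \<otimes>\<^bsub>Q\<^esub> V t k \<oplus>\<^bsub>Q\<^esub> j (mm ?b i k) \<otimes>\<^bsub>Q\<^esub> V t' k)"
      using bc i by (intro h.S.finsum_cong') (auto simp: V_add h.S.r_distr)
    also have "\<dots> = (\<Oplus>\<^bsub>Q\<^esub>k\<in>{1..n}. j (mm ?b i k) \<otimes>\<^bsub>Q\<^esub> V t k) \<oplus>\<^bsub>Q\<^esub> (\<Oplus>\<^bsub>Q\<^esub>k\<in>{1..n}. j (mm ?b i k) \<otimes>\<^bsub>Q\<^esub> V t' k)"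
      using bc i by (intro h.S.finsum_addf) auto
    finally show ?case using 2 i by (simp add: distrib_left V_add)
  qed
  finally show ?case unfolding b .
next
  case (add g g')
  from ex_lifts[OF add.hyps(1)] obtain p1 where p1: "lifts p1 g" by (elim exE conjE)
  from ex_lifts[OF add.hyps(2)] obtain p2 where p2: "lifts p2 g'" by (elim exE conjE)
  note p = p1 p2
  have "lifts (p1 + p2) (g \<oplus>\<^bsub>UP R\<^esub> g')"
    unfolding lifts_def
  proof
    fix l
    have cl: "g l \<in> carrier R" "g' l \<in> carrier R"
      using UPR.coeff_closed[OF add.hyps(1), of l] UPR.coeff_closed[OF add.hyps(2), of l] add.hyps by simp_all
    have "h (Polynomial.coeff (p1 + p2) l) = j (g l) \<oplus>\<^bsub>Q\<^esub> j (g' l)"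
      using p unfolding lifts_def by (simp add: h.h_plus)
    also have "\<dots> = j ((g \<oplus>\<^bsub>UP R\<^esub> g') l)"
      unfolding UP_ops(1)[OF add.hyps(1,2)] using cl by (intro j.hom_add[symmetric])
    finally show "h (Polynomial.coeff (p1 + p2) l) = j ((g \<oplus>\<^bsub>UP R\<^esub> g') l)" .
  qed
  then have "V (p * t) i = V ((p1 + p2) * t) i" by (rule lifts_mult_cong[OF add.prems _ i])
  also have "\<dots> = (\<Oplus>\<^bsub>Q\<^esub>k\<in>{1..n}. j (mm (ev g) i k) \<otimes>\<^bsub>Q\<^esub> V t k) \<oplus>\<^bsub>Q\<^esub> (\<Oplus>\<^bsub>Q\<^esub>k\<in>{1..n}. j (mm (ev g') i k) \<otimes>\<^bsub>Q\<^esub> V t k)"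
    using p i by (simp add: distrib_right V_add add.IH)
  also have "\<dots> = (\<Oplus>\<^bsub>Q\<^esub>k\<in>{1..n}. j (mm (ev g) i k) \<otimes>\<^bsub>Q\<^esub> V t k \<oplus>\<^bsub>Q\<^esub> j (mm (ev g') i k) \<otimes>\<^bsub>Q\<^esub> V t k)"
    using i add.hyps by (intro h.S.finsum_addf[symmetric]) auto
  also have "\<dots> = (\<Oplus>\<^bsub>Q\<^esub>k\<in>{1..n}. j (mm (ev (g \<oplus>\<^bsub>UP R\<^esub> g')) i k) \<otimes>\<^bsub>Q\<^esub> V t k)"
    using i add.hyps
    by (intro h.S.finsum_cong') (auto simp: mm_add ring_hom_add[OF ev_hom] h.S.l_distr)
  finally show ?case .
qed

lemma V_lifts:
  assumes g: "g \<in> carrier (UP R)" and p: "lifts p g" and i: "i \<in> {1..n}"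
  shows "V p i = j (crd (ev g) i)"
proof -
  have V1: "V 1 k = j (crd \<one>\<^bsub>A\<^esub> k)" if "k \<in> {1..n}" for k
    using V_monom[OF that, of 1 0] that by (simp add: h.h_1)
  have "V (p * 1) i = (\<Oplus>\<^bsub>Q\<^esub>k\<in>{1..n}. j (mm (ev g) i k) \<otimes>\<^bsub>Q\<^esub> V 1 k)"
    by (rule V_mult[OF g p i])
  also have "\<dots> = (\<Oplus>\<^bsub>Q\<^esub>k\<in>{1..n}. j (mm (ev g) i k) \<otimes>\<^bsub>Q\<^esub> j (crd \<one>\<^bsub>A\<^esub> k))"
    using g i by (intro h.S.finsum_cong') (auto simp: V1)
  also have "\<dots> = j (crd (ev g \<otimes>\<^bsub>A\<^esub> \<one>\<^bsub>A\<^esub>) i)"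
    using g i by (intro j_crd_mult[symmetric]) auto
  finally show ?thesis using g by simp
qed

lemma minus_one_pow: "y \<in> carrier Q \<Longrightarrow>
  (\<ominus>\<^bsub>Q\<^esub> \<one>\<^bsub>Q\<^esub>) [^]\<^bsub>Q\<^esub> (k::nat) \<otimes>\<^bsub>Q\<^esub> ((\<ominus>\<^bsub>Q\<^esub> \<one>\<^bsub>Q\<^esub>) [^]\<^bsub>Q\<^esub> k \<otimes>\<^bsub>Q\<^esub> y) = y"
proof -
  assume y: "y \<in> carrier Q"
  have "(\<ominus>\<^bsub>Q\<^esub> \<one>\<^bsub>Q\<^esub>) [^]\<^bsub>Q\<^esub> k \<otimes>\<^bsub>Q\<^esub> (\<ominus>\<^bsub>Q\<^esub> \<one>\<^bsub>Q\<^esub>) [^]\<^bsub>Q\<^esub> k = \<one>\<^bsub>Q\<^esub>"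
    by (induction k) (simp_all add: h.S.m_ac h.S.l_minus h.S.r_minus)
  then show ?thesis using y by (simp add: h.S.m_assoc[symmetric])
qed

lemma j_sign: "x \<in> carrier R \<Longrightarrow>
  j ((\<ominus>\<^bsub>R\<^esub> \<one>\<^bsub>R\<^esub>) [^]\<^bsub>R\<^esub> (k::nat) \<otimes>\<^bsub>R\<^esub> x) = (\<ominus>\<^bsub>Q\<^esub> \<one>\<^bsub>Q\<^esub>) [^]\<^bsub>Q\<^esub> k \<otimes>\<^bsub>Q\<^esub> j x"
  by simp

lemma chi_coeff_closed [simp]: "b \<in> carrier A \<Longrightarrow> chi b l \<in> carrier R"
  using UPR.coeff_closed[OF chi_closed, of b l] chi_closed[of b] by simp

text \<open>Vieta's formula turns the hypothesis on the elementary symmetric functions of the \<open>q i\<close> into an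
  equality of polynomials.\<close>

lemma w_lifts_chi: "lifts (w n) (chi a)"
  unfolding lifts_def
proof
  fix l
  have monic: "chi a n = \<one>\<^bsub>R\<^esub>" "\<And>m. m > n \<Longrightarrow> chi a m = \<zero>\<^bsub>R\<^esub>"
    using chi_monic[of a] chi_closed[of a] by (auto simp: monic_of_degree_def)
  consider "l > n" | "l = n" | "l < n" by linarith
  then show "h (Polynomial.coeff (w n) l) = j (chi a l)"
  proof cases
    case 1
    have "Polynomial.degree (w n) \<le> (\<Sum>i = 1..n. Polynomial.degree [:- qt i, 1:])"
      unfolding w_def using degree_prod_sum_le[of "{1..n}" "\<lambda>i. [:- qt i, 1:]"] by (simp add: comp_def)
    then have "Polynomial.degree (w n) \<le> n" by simp
    then show ?thesis using 1 monic(2)[OF 1] by (simp add: Polynomial.coeff_eq_0 h.h_0)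
  next
    case 2
    have "{K. K \<subseteq> {1..n} \<and> card K = 0} = {{}}" by (auto simp: card_eq_0_iff dest: finite_subset)
    then have "h (Polynomial.coeff (w n) (n - 0)) = \<one>\<^bsub>Q\<^esub>"
      unfolding w_def h.vieta[OF le0] by (simp add: esym_def)
    then show ?thesis using 2 monic(1) by simp
  next
    case 3
    define k where "k = n - l"
    have k: "k \<in> {1..n}" "k \<le> n" "l = n - k" using 3 by (auto simp: k_def)
    have "h (Polynomial.coeff (w n) l) = (\<ominus>\<^bsub>Q\<^esub> \<one>\<^bsub>Q\<^esub>) [^]\<^bsub>Q\<^esub> k \<otimes>\<^bsub>Q\<^esub> esym Q n k (\<lambda>i. h (qt i))"
      unfolding w_def k(3) by (rule h.vieta[OF k(2)])
    also have "esym Q n k (\<lambda>i. h (qt i)) = esym Q n k q"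
      using q_closed h_qt by (intro h.S.esym_cong) auto
    also have "\<dots> = (\<ominus>\<^bsub>Q\<^esub> \<one>\<^bsub>Q\<^esub>) [^]\<^bsub>Q\<^esub> k \<otimes>\<^bsub>Q\<^esub> j (chi a l)"
      unfolding roots[OF k(1)] k(3)[symmetric] by (rule j_sign) simp
    finally show ?thesis by (simp add: minus_one_pow)
  qed
qed

text \<open>Cayley--Hamilton, carried over to \<open>Q\<close>: polynomials can be reduced modulo \<open>w n\<close> without changing
  their value at \<open>a\<close>.\<close>

lemma V_w_n: "i \<in> {1..n} \<Longrightarrow> V (w n * t) i = \<zero>\<^bsub>Q\<^esub>"
proof -
  assume i: "i \<in> {1..n}"
  have "V (w n * t) i = (\<Oplus>\<^bsub>Q\<^esub>k\<in>{1..n}. j (mm (ev (chi a)) i k) \<otimes>\<^bsub>Q\<^esub> V t k)"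
    by (rule V_mult[OF chi_closed w_lifts_chi i]) simp
  also have "\<dots> = (\<Oplus>\<^bsub>Q\<^esub>k\<in>{1..n}. \<zero>\<^bsub>Q\<^esub>)"
    using i by (intro h.S.finsum_cong') (auto simp: cayley_hamilton mm_zero)
  finally show ?thesis by simp
qed

text \<open>The columns of \<open>C\<close> are the values at \<open>a\<close> of the first \<open>n\<close> Newton polynomials.\<close>

definition "C i m = V (w (m - 1)) i"

lemma C_closed [simp]: "i \<in> {1..n} \<Longrightarrow> C i m \<in> carrier Q" by (simp add: C_def)

lemma V_newton:
  assumes "p = (\<Sum>k = 1..n. Polynomial.smult (u k) (w (k - 1))) + w n * t" and i: "i \<in> {1..n}"
  shows "V p i = (\<Oplus>\<^bsub>Q\<^esub>k\<in>{1..n}. C i k \<otimes>\<^bsub>Q\<^esub> h (u k))"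
proof -
  have "V p i = (\<Oplus>\<^bsub>Q\<^esub>k\<in>{1..n}. V (Polynomial.smult (u k) (w (k - 1))) i)"
    unfolding assms(1) using i by (simp add: V_add V_sum V_w_n h.S.finsum_closed)
  also have "\<dots> = (\<Oplus>\<^bsub>Q\<^esub>k\<in>{1..n}. C i k \<otimes>\<^bsub>Q\<^esub> h (u k))"
    using i by (intro h.S.finsum_cong') (auto simp: V_smult C_def h.S.m_comm)
  finally show ?thesis .
qed

text \<open>Column \<open>m\<close> of \<open>U\<close> holds the Newton coefficients of \<open>w (m - 1) g\<close>.  Since this polynomial is
  divisible by \<open>w (m - 1)\<close>, the coefficients before the \<open>m\<close>-th vanish, and the \<open>m\<close>-th is the remainder
  \<open>g (q m)\<close> of \<open>g\<close> on division by \<open>X - q m\<close>.\<close>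

lemma triangularise:
  assumes g: "g \<in> carrier (UP R)"
  obtains U where "\<And>k m. U k m \<in> carrier Q"
    and "\<And>k m. m \<in> {1..n} \<Longrightarrow> k < m \<Longrightarrow> U k m = \<zero>\<^bsub>Q\<^esub>"
    and "\<And>m. m \<in> {1..n} \<Longrightarrow> U m m = evQ m g"
    and "\<And>i m. i \<in> {1..n} \<Longrightarrow> m \<in> {1..n} \<Longrightarrow>
      (\<Oplus>\<^bsub>Q\<^esub>k\<in>{1..n}. j (mm (ev g) i k) \<otimes>\<^bsub>Q\<^esub> C k m) = (\<Oplus>\<^bsub>Q\<^esub>k\<in>{1..n}. C i k \<otimes>\<^bsub>Q\<^esub> U k m)"
proof -
  obtain p where p: "lifts p g" and ev: "\<forall>i\<in>{1..n}. h (poly p (qt i)) = evQ i g"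
    using ex_lifts[OF g] by blast
  have "\<forall>m\<in>{1..n}. \<exists>u. (\<forall>k<m. u k = 0) \<and> u m = poly p (qt m) \<and>
      (\<exists>t. w (m - 1) * p = (\<Sum>k = 1..n. Polynomial.smult (u k) (w (k - 1))) + w n * t)"
  proof
    fix m assume "m \<in> {1..n}"
    then show "\<exists>u. (\<forall>k<m. u k = 0) \<and> u m = poly p (qt m) \<and>
      (\<exists>t. w (m - 1) * p = (\<Sum>k = 1..n. Polynomial.smult (u k) (w (k - 1))) + w n * t)"
      using newton_division[of m n p qt] unfolding w_def by auto
  qed
  from bchoice[OF this] obtain u where u: "\<forall>m\<in>{1..n}. (\<forall>k<m. u m k = 0) \<and> u m m = poly p (qt m) \<and>
      (\<exists>t. w (m - 1) * p = (\<Sum>k = 1..n. Polynomial.smult (u m k) (w (k - 1))) + w n * t)" ..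
  show thesis
  proof (rule that[of "\<lambda>k m. h (u m k)"])
    fix i m assume i: "i \<in> {1..n}" and m: "m \<in> {1..n}"
    obtain t where t: "w (m - 1) * p = (\<Sum>k = 1..n. Polynomial.smult (u m k) (w (k - 1))) + w n * t"
      using bspec[OF u m] by blast
    show "(\<Oplus>\<^bsub>Q\<^esub>k\<in>{1..n}. j (mm (ev g) i k) \<otimes>\<^bsub>Q\<^esub> C k m) = (\<Oplus>\<^bsub>Q\<^esub>k\<in>{1..n}. C i k \<otimes>\<^bsub>Q\<^esub> h (u m k))"
      using V_newton[OF t i] V_mult[OF g p i, of "w (m - 1)"]
      unfolding C_def by (simp add: mult.commute)
  qed (use u ev in \<open>auto simp: h.h_0\<close>)
qed

text \<open>Each basis vector of \<open>A\<close> is a polynomial in the generator, hence by Newton division a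
  combination of the columns of \<open>C\<close>.\<close>

lemma C_right_inverse:
  obtains N where "\<And>k m. N k m \<in> carrier Q"
    and "\<And>i m. i \<in> {1..n} \<Longrightarrow> m \<in> {1..n} \<Longrightarrow>
      (\<Oplus>\<^bsub>Q\<^esub>k\<in>{1..n}. C i k \<otimes>\<^bsub>Q\<^esub> N k m) = (if i = m then \<one>\<^bsub>Q\<^esub> else \<zero>\<^bsub>Q\<^esub>)"
proof -
  have "\<forall>m\<in>{1..n}. \<exists>u. \<forall>i\<in>{1..n}.
    (\<Oplus>\<^bsub>Q\<^esub>k\<in>{1..n}. C i k \<otimes>\<^bsub>Q\<^esub> h (u k)) = (if i = m then \<one>\<^bsub>Q\<^esub> else \<zero>\<^bsub>Q\<^esub>)"
  proof
    fix m assume m: "m \<in> {1..n}"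
    obtain g where g: "g \<in> carrier (UP R)" "ev g = \<epsilon> m" using ev_surj[of "\<epsilon> m"] m by auto
    obtain p where p: "lifts p g" using ex_lifts[OF g(1)] by blast
    obtain u t where t: "p = (\<Sum>k = 1..n. Polynomial.smult (u k) (w (k - 1))) + w n * t"
      using newton_division[of 1 n p qt] unfolding w_def by auto
    show "\<exists>u. \<forall>i\<in>{1..n}.
      (\<Oplus>\<^bsub>Q\<^esub>k\<in>{1..n}. C i k \<otimes>\<^bsub>Q\<^esub> h (u k)) = (if i = m then \<one>\<^bsub>Q\<^esub> else \<zero>\<^bsub>Q\<^esub>)"
    proof (intro exI[of _ u] ballI)
      fix i assume i: "i \<in> {1..n}"
      show "(\<Oplus>\<^bsub>Q\<^esub>k\<in>{1..n}. C i k \<otimes>\<^bsub>Q\<^esub> h (u k)) = (if i = m then \<one>\<^bsub>Q\<^esub> else \<zero>\<^bsub>Q\<^esub>)"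
        unfolding V_newton[OF t i, symmetric] V_lifts[OF g(1) p i] g(2)
        using i m by (auto simp: crd_eps)
    qed
  qed
  from bchoice[OF this] obtain u where u: "\<forall>m\<in>{1..n}. \<forall>i\<in>{1..n}.
    (\<Oplus>\<^bsub>Q\<^esub>k\<in>{1..n}. C i k \<otimes>\<^bsub>Q\<^esub> h (u m k)) = (if i = m then \<one>\<^bsub>Q\<^esub> else \<zero>\<^bsub>Q\<^esub>)" ..
  show thesis
  proof (rule that[of "\<lambda>k m. h (u m k)"])
    fix i m assume "i \<in> {1..n}" "m \<in> {1..n}"
    then show "(\<Oplus>\<^bsub>Q\<^esub>k\<in>{1..n}. C i k \<otimes>\<^bsub>Q\<^esub> h (u m k)) = (if i = m then \<one>\<^bsub>Q\<^esub> else \<zero>\<^bsub>Q\<^esub>)"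
      by (intro u[rule_format])
  qed simp
qed

lemma det_C_unit:
  obtains d where "d \<in> carrier Q" "d \<otimes>\<^bsub>Q\<^esub> ring_det Q n C = \<one>\<^bsub>Q\<^esub>"
proof (rule C_right_inverse)
  fix N assume N: "\<And>k m. N k m \<in> carrier Q" and CN: "\<And>i m. i \<in> {1..n} \<Longrightarrow> m \<in> {1..n} \<Longrightarrow>
      (\<Oplus>\<^bsub>Q\<^esub>k\<in>{1..n}. C i k \<otimes>\<^bsub>Q\<^esub> N k m) = (if i = m then \<one>\<^bsub>Q\<^esub> else \<zero>\<^bsub>Q\<^esub>)"
  have "ring_det Q n C \<otimes>\<^bsub>Q\<^esub> ring_det Q n N = ring_det Q n (\<lambda>i m. \<Oplus>\<^bsub>Q\<^esub>k\<in>{1..n}. C i k \<otimes>\<^bsub>Q\<^esub> N k m)"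
    using N by (intro h.S.ring_det_mult[symmetric]) auto
  also have "\<dots> = ring_det Q n (\<lambda>i m. if i = m then \<one>\<^bsub>Q\<^esub> else \<zero>\<^bsub>Q\<^esub>)"
    by (rule ring_det_cong[OF h.S.is_cring CN]) auto
  also have "\<dots> = \<one>\<^bsub>Q\<^esub>" by (subst h.S.ring_det_lower_triangular) auto
  finally have "ring_det Q n C \<otimes>\<^bsub>Q\<^esub> ring_det Q n N = \<one>\<^bsub>Q\<^esub>" .
  moreover have "ring_det Q n C \<in> carrier Q" "ring_det Q n N \<in> carrier Q"
    using N by (auto intro!: h.S.ring_det_closed)
  ultimately show thesis by (intro that[of "ring_det Q n N"]) (simp_all add: h.S.m_comm)
qed

text \<open>If \<open>g(a) = 0\<close>, then \<open>C U = 0\<close>, and \<open>U = 0\<close> because \<open>C\<close> is invertible.  The diagonal of \<open>U\<close> holds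
  the values of \<open>g\<close> at the roots.\<close>

theorem roots_of_relations:
  assumes g: "g \<in> carrier (UP R)" and "ev g = \<zero>\<^bsub>A\<^esub>" and m: "m \<in> {1..n}"
  shows "evQ m g = \<zero>\<^bsub>Q\<^esub>"
proof (rule triangularise[OF g])
  fix U assume U: "\<And>k m. U k m \<in> carrier Q" and tri: "\<And>k m. m \<in> {1..n} \<Longrightarrow> k < m \<Longrightarrow> U k m = \<zero>\<^bsub>Q\<^esub>"
    and diag: "\<And>m. m \<in> {1..n} \<Longrightarrow> U m m = evQ m g"
    and CU: "\<And>i m. i \<in> {1..n} \<Longrightarrow> m \<in> {1..n} \<Longrightarrow>
      (\<Oplus>\<^bsub>Q\<^esub>k\<in>{1..n}. j (mm (ev g) i k) \<otimes>\<^bsub>Q\<^esub> C k m) = (\<Oplus>\<^bsub>Q\<^esub>k\<in>{1..n}. C i k \<otimes>\<^bsub>Q\<^esub> U k m)"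
  have CU0: "(\<Oplus>\<^bsub>Q\<^esub>k\<in>{1..n}. C i k \<otimes>\<^bsub>Q\<^esub> U k m) = \<zero>\<^bsub>Q\<^esub>" if i: "i \<in> {1..n}" for i
  proof -
    have "(\<Oplus>\<^bsub>Q\<^esub>k\<in>{1..n}. j (mm (ev g) i k) \<otimes>\<^bsub>Q\<^esub> C k m) = (\<Oplus>\<^bsub>Q\<^esub>k\<in>{1..n}. \<zero>\<^bsub>Q\<^esub>)"
      using i assms(2) by (intro h.S.finsum_cong') (auto simp: mm_zero)
    then show ?thesis using CU[OF i m] by simp
  qed
  have "\<exists>Z. (\<forall>i j. Z i j \<in> carrier Q) \<and> (\<forall>i\<in>{1..n}. \<forall>j\<in>{1..n}.
      (\<Oplus>\<^bsub>Q\<^esub>k\<in>{1..n}. Z i k \<otimes>\<^bsub>Q\<^esub> C k j) = (if i = j then ring_det Q n C else \<zero>\<^bsub>Q\<^esub>))"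
  proof (rule h.S.obtain_adjugate[of n C])
    fix Z assume Z: "\<And>i j. Z i j \<in> carrier Q" and ZC: "\<And>i j. i \<in> {1..n} \<Longrightarrow> j \<in> {1..n} \<Longrightarrow>
      (\<Oplus>\<^bsub>Q\<^esub>k\<in>{1..n}. Z i k \<otimes>\<^bsub>Q\<^esub> C k j) = (if i = j then ring_det Q n C else \<zero>\<^bsub>Q\<^esub>)"
    show ?thesis by (intro exI[of _ Z] conjI allI ballI Z ZC)
  qed simp
  then obtain Z where "\<forall>i j. Z i j \<in> carrier Q" and "\<forall>i\<in>{1..n}. \<forall>j\<in>{1..n}.
      (\<Oplus>\<^bsub>Q\<^esub>k\<in>{1..n}. Z i k \<otimes>\<^bsub>Q\<^esub> C k j) = (if i = j then ring_det Q n C else \<zero>\<^bsub>Q\<^esub>)"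
    by (elim exE conjE) (rule that)
  note Z = this(1)[rule_format] and ZC = this(2)[rule_format]
  have dC: "ring_det Q n C \<in> carrier Q" by (rule h.S.ring_det_closed) simp
  have "ring_det Q n C \<otimes>\<^bsub>Q\<^esub> U m m = (\<Oplus>\<^bsub>Q\<^esub>k\<in>{1..n}. if m = k then ring_det Q n C \<otimes>\<^bsub>Q\<^esub> U k m else \<zero>\<^bsub>Q\<^esub>)"
    using m U dC by (intro h.S.finsum_singleton[symmetric]) auto
  also have "\<dots> = (\<Oplus>\<^bsub>Q\<^esub>k\<in>{1..n}. (\<Oplus>\<^bsub>Q\<^esub>l\<in>{1..n}. Z m l \<otimes>\<^bsub>Q\<^esub> (C l k \<otimes>\<^bsub>Q\<^esub> U k m)))"
  proof (intro h.S.finsum_cong' refl)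
    fix k assume k: "k \<in> {1..n}"
    have "(\<Oplus>\<^bsub>Q\<^esub>l\<in>{1..n}. Z m l \<otimes>\<^bsub>Q\<^esub> (C l k \<otimes>\<^bsub>Q\<^esub> U k m)) = (\<Oplus>\<^bsub>Q\<^esub>l\<in>{1..n}. Z m l \<otimes>\<^bsub>Q\<^esub> C l k \<otimes>\<^bsub>Q\<^esub> U k m)"
      using Z U by (intro h.S.finsum_cong') (auto simp: h.S.m_assoc)
    also have "\<dots> = (\<Oplus>\<^bsub>Q\<^esub>l\<in>{1..n}. Z m l \<otimes>\<^bsub>Q\<^esub> C l k) \<otimes>\<^bsub>Q\<^esub> U k m"
      using Z U by (intro h.S.finsum_ldistr[symmetric]) auto
    finally show "(if m = k then ring_det Q n C \<otimes>\<^bsub>Q\<^esub> U k m else \<zero>\<^bsub>Q\<^esub>)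
        = (\<Oplus>\<^bsub>Q\<^esub>l\<in>{1..n}. Z m l \<otimes>\<^bsub>Q\<^esub> (C l k \<otimes>\<^bsub>Q\<^esub> U k m))"
      using ZC[OF m k] U by simp
  qed (use Z U in \<open>auto intro!: h.S.finsum_closed\<close>)
  also have "\<dots> = (\<Oplus>\<^bsub>Q\<^esub>l\<in>{1..n}. (\<Oplus>\<^bsub>Q\<^esub>k\<in>{1..n}. Z m l \<otimes>\<^bsub>Q\<^esub> (C l k \<otimes>\<^bsub>Q\<^esub> U k m)))"
    using Z U by (intro h.S.finsum_swap) auto
  also have "\<dots> = (\<Oplus>\<^bsub>Q\<^esub>l\<in>{1..n}. \<zero>\<^bsub>Q\<^esub>)"
  proof (intro h.S.finsum_cong' refl)
    fix l assume l: "l \<in> {1..n}"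
    have "(\<Oplus>\<^bsub>Q\<^esub>k\<in>{1..n}. Z m l \<otimes>\<^bsub>Q\<^esub> (C l k \<otimes>\<^bsub>Q\<^esub> U k m)) = Z m l \<otimes>\<^bsub>Q\<^esub> (\<Oplus>\<^bsub>Q\<^esub>k\<in>{1..n}. C l k \<otimes>\<^bsub>Q\<^esub> U k m)"
      using Z U l by (intro h.S.finsum_rdistr[symmetric]) auto
    then show "(\<Oplus>\<^bsub>Q\<^esub>k\<in>{1..n}. Z m l \<otimes>\<^bsub>Q\<^esub> (C l k \<otimes>\<^bsub>Q\<^esub> U k m)) = \<zero>\<^bsub>Q\<^esub>"
      using CU0[OF l] Z by simp
  qed auto
  finally have z: "ring_det Q n C \<otimes>\<^bsub>Q\<^esub> U m m = \<zero>\<^bsub>Q\<^esub>" by simp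
  obtain d where d: "d \<in> carrier Q" "d \<otimes>\<^bsub>Q\<^esub> ring_det Q n C = \<one>\<^bsub>Q\<^esub>" by (rule det_C_unit)
  have "U m m = d \<otimes>\<^bsub>Q\<^esub> ring_det Q n C \<otimes>\<^bsub>Q\<^esub> U m m" using d U by simp
  also have "\<dots> = d \<otimes>\<^bsub>Q\<^esub> (ring_det Q n C \<otimes>\<^bsub>Q\<^esub> U m m)" using d dC U by (intro h.S.m_assoc) auto
  finally have "U m m = \<zero>\<^bsub>Q\<^esub>" using z d by simp
  then show ?thesis using diag[OF m] by simp
qed

text \<open>The matrix \<open>C\<close> conjugates multiplication by \<open>g(a)\<close> to the triangular matrix \<open>U\<close>, so both have the
  characteristic polynomial \<open>(X - g(q\<^sub>1)) \<dots> (X - g(q\<^sub>n))\<close>.  The coefficients are read off by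
  Vieta's formula.\<close>

theorem char_poly_splits:
  assumes g: "g \<in> carrier (UP R)" and k: "k \<in> {1..n}"
  shows "j ((\<ominus>\<^bsub>R\<^esub> \<one>\<^bsub>R\<^esub>) [^]\<^bsub>R\<^esub> k \<otimes>\<^bsub>R\<^esub> chi (ev g) (n - k)) = esym Q n k (\<lambda>i. evQ i g)"
proof (rule triangularise[OF g])
  fix U assume U: "\<And>k m. U k m \<in> carrier Q" and tri: "\<And>k m. m \<in> {1..n} \<Longrightarrow> k < m \<Longrightarrow> U k m = \<zero>\<^bsub>Q\<^esub>"
    and diag: "\<And>m. m \<in> {1..n} \<Longrightarrow> U m m = evQ m g"
    and CU: "\<And>i m. i \<in> {1..n} \<Longrightarrow> m \<in> {1..n} \<Longrightarrow>
      (\<Oplus>\<^bsub>Q\<^esub>k\<in>{1..n}. j (mm (ev g) i k) \<otimes>\<^bsub>Q\<^esub> C k m) = (\<Oplus>\<^bsub>Q\<^esub>k\<in>{1..n}. C i k \<otimes>\<^bsub>Q\<^esub> U k m)"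
  define Mb where "Mb i k = j (mm (ev g) i k)" for i k
  have Mb: "Mb i k \<in> carrier Q" if "i \<in> {1..n}" "k \<in> {1..n}" for i k
    using that g by (simp add: Mb_def)
  let ?c = "\<lambda>x. up_ring.monom (UP Q) x 0" and ?x = "up_ring.monom (UP Q) \<one>\<^bsub>Q\<^esub> 1"
  interpret c: ring_hom_cring Q "UP Q" ?c
    by (rule ring_hom_cringI[OF h.S.is_cring h.UPS.UP_cring h.UPS.const_ring_hom])
  have x: "?x \<in> carrier (UP Q)" by simp
  have const_sum: "(\<Oplus>\<^bsub>UP Q\<^esub>k\<in>{1..n}. ?c (f k) \<otimes>\<^bsub>UP Q\<^esub> ?c (f' k)) = ?c (\<Oplus>\<^bsub>Q\<^esub>k\<in>{1..n}. f k \<otimes>\<^bsub>Q\<^esub> f' k)"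
    if "f \<in> {1..n} \<rightarrow> carrier Q" "f' \<in> {1..n} \<rightarrow> carrier Q" for f f'
    using that by (subst c.hom_finsum) (auto intro!: h.UPS.P.finsum_cong' simp: Pi_def simp del: h.UPS.monom_mult)
  let ?M = "char_matrix Q Mb" and ?U = "char_matrix Q U" and ?C = "\<lambda>i m. ?c (C i m)"
  have M_cl: "?M i m \<in> carrier (UP Q)" if "i \<in> {1..n}" "m \<in> {1..n}" for i m using Mb[OF that] by simp
  have U_cl: "?U i m \<in> carrier (UP Q)" for i m using U by simp
  have C_cl: "?C i m \<in> carrier (UP Q)" if "i \<in> {1..n}" for i m using that by simp
  have inter: "(\<Oplus>\<^bsub>UP Q\<^esub>k\<in>{1..n}. ?M i k \<otimes>\<^bsub>UP Q\<^esub> ?C k m) = (\<Oplus>\<^bsub>UP Q\<^esub>k\<in>{1..n}. ?C i k \<otimes>\<^bsub>UP Q\<^esub> ?U k m)"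
    if "i \<in> {1..n}" "m \<in> {1..n}" for i m
  proof (rule h.UPS.P.char_matrix_intertwine[OF x _ _ _ _ that])
    fix i m assume im: "i \<in> {1..n}" "m \<in> {1..n}"
    show "(\<Oplus>\<^bsub>UP Q\<^esub>k\<in>{1..n}. ?c (Mb i k) \<otimes>\<^bsub>UP Q\<^esub> ?c (C k m)) = (\<Oplus>\<^bsub>UP Q\<^esub>k\<in>{1..n}. ?c (C i k) \<otimes>\<^bsub>UP Q\<^esub> ?c (U k m))"
      using im U Mb CU[OF im, folded Mb_def] by (subst (1 2) const_sum) auto
  qed (use Mb U in auto)
  have "ring_det (UP Q) n ?M \<otimes>\<^bsub>UP Q\<^esub> ring_det (UP Q) n ?C
      = ring_det (UP Q) n (\<lambda>i m. \<Oplus>\<^bsub>UP Q\<^esub>k\<in>{1..n}. ?M i k \<otimes>\<^bsub>UP Q\<^esub> ?C k m)"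
    by (rule h.UPS.P.ring_det_mult[symmetric]) (erule (1) M_cl, erule C_cl)
  also have "\<dots> = ring_det (UP Q) n (\<lambda>i m. \<Oplus>\<^bsub>UP Q\<^esub>k\<in>{1..n}. ?C i k \<otimes>\<^bsub>UP Q\<^esub> ?U k m)"
    by (rule ring_det_cong[OF h.UPS.UP_cring inter])
       (use U_cl C_cl in \<open>auto intro!: h.UPS.P.finsum_closed h.UPS.P.m_closed simp del: h.UPS.P.minus_closed\<close>)
  also have "\<dots> = ring_det (UP Q) n ?C \<otimes>\<^bsub>UP Q\<^esub> ring_det (UP Q) n ?U"
    by (rule h.UPS.P.ring_det_mult) (erule C_cl, rule U_cl)
  finally have MU: "ring_det (UP Q) n ?M \<otimes>\<^bsub>UP Q\<^esub> ring_det (UP Q) n ?C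
      = ring_det (UP Q) n ?C \<otimes>\<^bsub>UP Q\<^esub> ring_det (UP Q) n ?U" .
  have dM: "ring_det (UP Q) n ?M \<in> carrier (UP Q)" by (rule h.UPS.P.ring_det_closed[OF M_cl])
  have dU: "ring_det (UP Q) n ?U \<in> carrier (UP Q)" by (rule h.UPS.P.ring_det_closed[OF U_cl])
  have dC: "ring_det (UP Q) n ?C \<in> carrier (UP Q)" by (rule h.UPS.P.ring_det_closed[OF C_cl])
  obtain d where d: "d \<in> carrier Q" "d \<otimes>\<^bsub>Q\<^esub> ring_det Q n C = \<one>\<^bsub>Q\<^esub>" by (rule det_C_unit)
  have "ring_det (UP Q) n ?C = ?c (ring_det Q n C)"
    by (rule c.ring_det_hom[symmetric]) simp
  then have e: "?c d \<otimes>\<^bsub>UP Q\<^esub> ring_det (UP Q) n ?C = \<one>\<^bsub>UP Q\<^esub>"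
    using d c.hom_mult[of d "ring_det Q n C"] h.S.ring_det_closed[of n C] by (simp del: h.UPS.monom_mult)
  have dc: "?c d \<in> carrier (UP Q)" using d by simp
  have "ring_det (UP Q) n ?M = ?c d \<otimes>\<^bsub>UP Q\<^esub> ring_det (UP Q) n ?C \<otimes>\<^bsub>UP Q\<^esub> ring_det (UP Q) n ?M"
    using e dM by simp
  also have "\<dots> = ?c d \<otimes>\<^bsub>UP Q\<^esub> (ring_det (UP Q) n ?M \<otimes>\<^bsub>UP Q\<^esub> ring_det (UP Q) n ?C)"
    using dc dC dM by (simp only: h.UPS.P.m_ac h.UPS.P.m_closed)
  also have "\<dots> = ?c d \<otimes>\<^bsub>UP Q\<^esub> ring_det (UP Q) n ?C \<otimes>\<^bsub>UP Q\<^esub> ring_det (UP Q) n ?U"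
    unfolding MU using dc dC dU by (simp only: h.UPS.P.m_assoc h.UPS.P.m_closed)
  also have "\<dots> = ring_det (UP Q) n ?U" using e dU by simp
  also have "\<dots> = (\<Otimes>\<^bsub>UP Q\<^esub>i\<in>{1..n}. ?U i i)"
  proof (rule h.UPS.P.ring_det_lower_triangular)
    fix i m assume "i \<in> {1..n}" "m \<in> {1..n}" "i < m"
    then show "?U i m = \<zero>\<^bsub>UP Q\<^esub>" using tri by (simp add: a_minus_def)
  qed (rule U_cl)
  also have "\<dots> = (\<Otimes>\<^bsub>UP Q\<^esub>i\<in>{1..n}. h.poly_map [:- lift (U i i), 1:])"
    using U lift by (intro h.UPS.P.finprod_cong') (auto simp: h.poly_map_linear)
  also have "\<dots> = h.poly_map (\<Prod>i = 1..n. [:- lift (U i i), 1:])"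
    by (rule class_hom.h_prod[OF h.poly_map_hom, symmetric])
  finally have split: "ring_det (UP Q) n ?M = h.poly_map (\<Prod>i = 1..n. [:- lift (U i i), 1:])" .
  have "ring_det (UP Q) n ?M = (\<lambda>l. j (chi (ev g) l))"
    unfolding chi_def Mb_def using g by (intro j.char_poly_hom) simp
  then have "j (chi (ev g) (n - k)) = h (Polynomial.coeff (\<Prod>i = 1..n. [:- lift (U i i), 1:]) (n - k))"
    using split by (metis h.poly_map_def)
  also have "\<dots> = (\<ominus>\<^bsub>Q\<^esub> \<one>\<^bsub>Q\<^esub>) [^]\<^bsub>Q\<^esub> k \<otimes>\<^bsub>Q\<^esub> esym Q n k (\<lambda>i. h (lift (U i i)))"
    using k by (intro h.vieta) simp
  also have "esym Q n k (\<lambda>i. h (lift (U i i))) = esym Q n k (\<lambda>i. evQ i g)"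
    using U diag lift by (intro h.S.esym_cong) (auto simp flip: diag)
  finally have chi: "j (chi (ev g) (n - k))
      = (\<ominus>\<^bsub>Q\<^esub> \<one>\<^bsub>Q\<^esub>) [^]\<^bsub>Q\<^esub> k \<otimes>\<^bsub>Q\<^esub> esym Q n k (\<lambda>i. evQ i g)" .
  have "esym Q n k (\<lambda>i. evQ i g) \<in> carrier Q"
    using U diag by (intro h.S.esym_closed) (simp flip: diag)
  then show ?thesis using g by (simp only: j_sign chi_coeff_closed ev_closed chi minus_one_pow)
qed

end

section \<open>Tensor products of two algebras\<close>

locale tens = S?: cring S + B?: algebra S B + C?: algebra S C
  for S :: "('s, 'x) ring_scheme" (structure) and B :: "('s, 'b, 'y) module_scheme" (structure)
    and C :: "('s, 'c, 'z) module_scheme" (structure)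
begin

abbreviation "M \<equiv> B \<times>\<times> C"
abbreviation "F \<equiv> monoid_algebra S M"
abbreviation "J \<equiv> tensor_ideal S B C"
abbreviation "T \<equiv> tensor_prod S B C"
abbreviation "tn \<equiv> tensor S B C"

lemma M_simps: "carrier M = carrier B \<times> carrier C" "\<one>\<^bsub>M\<^esub> = (\<one>\<^bsub>B\<^esub>, \<one>\<^bsub>C\<^esub>)"
  "(b, c) \<otimes>\<^bsub>M\<^esub> (b', c') = (b \<otimes>\<^bsub>B\<^esub> b', c \<otimes>\<^bsub>C\<^esub> c')"
  by (simp_all add: DirProd_def)

lemma M_comm_monoid: "comm_monoid M"
  by (rule comm_monoidI) (auto simp: M_simps B.m_ac C.m_ac)

sublocale mon: mon_alg S M F
  by (intro mon_alg.intro S.is_cring M_comm_monoid) simp_all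

lemma basis_closed [simp]: "b \<in> carrier B \<Longrightarrow> c \<in> carrier C \<Longrightarrow> basis_elt S (b, c) \<in> carrier F"
  by (rule mon.basis_elt_closed) (simp add: M_simps)

lemma rels_closed: "bilinear_rels S B C \<subseteq> carrier F"
  unfolding bilinear_rels_def Let_def
  by (auto intro!: mon.F.minus_closed mon.F.a_closed mon.F.smult_closed)

sublocale quo: quot_alg S F J
  by (intro quot_alg.intro mon.F_algebra)
     (simp add: tensor_ideal_def mon.F.genideal_ideal[OF rels_closed])

lemma T_eq: "alg_quot F J = T" by (simp add: tensor_prod_def)

sublocale T: algebra S T using quo.quot_algebra unfolding T_eq .

lemma tn_eq: "tn b c = J +>\<^bsub>F\<^esub> basis_elt S (b, c)" by (simp add: tensor_def)

lemma tn_closed [simp]: "b \<in> carrier B \<Longrightarrow> c \<in> carrier C \<Longrightarrow> tn b c \<in> carrier T"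
  unfolding tn_eq using quo.q_closed T_eq by simp

lemma rel_in_ideal: "x \<in> bilinear_rels S B C \<Longrightarrow> x \<in> J"
  using mon.F.genideal_self[OF rels_closed] by (auto simp: tensor_ideal_def)

lemma tn_add_left:
  assumes "b \<in> carrier B" "b' \<in> carrier B" "c \<in> carrier C"
  shows "tn (b \<oplus>\<^bsub>B\<^esub> b') c = tn b c \<oplus>\<^bsub>T\<^esub> tn b' c"
proof -
  have "basis_elt S (b \<oplus>\<^bsub>B\<^esub> b', c) \<ominus>\<^bsub>F\<^esub> (basis_elt S (b, c) \<oplus>\<^bsub>F\<^esub> basis_elt S (b', c)) \<in> J"
    by (rule rel_in_ideal) (use assms in \<open>unfold bilinear_rels_def Let_def, blast\<close>)
  then show ?thesis
    unfolding tn_eq T_eq[symmetric] using assms by (subst quo.q_add[symmetric]) (auto simp: quo.q_eq)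
qed

lemma tn_add_right:
  assumes "b \<in> carrier B" "c \<in> carrier C" "c' \<in> carrier C"
  shows "tn b (c \<oplus>\<^bsub>C\<^esub> c') = tn b c \<oplus>\<^bsub>T\<^esub> tn b c'"
proof -
  have "basis_elt S (b, c \<oplus>\<^bsub>C\<^esub> c') \<ominus>\<^bsub>F\<^esub> (basis_elt S (b, c) \<oplus>\<^bsub>F\<^esub> basis_elt S (b, c')) \<in> J"
    by (rule rel_in_ideal) (use assms in \<open>unfold bilinear_rels_def Let_def, blast\<close>)
  then show ?thesis
    unfolding tn_eq T_eq[symmetric] using assms by (subst quo.q_add[symmetric]) (auto simp: quo.q_eq)
qed

lemma tn_smult_left:
  assumes "s \<in> carrier S" "b \<in> carrier B" "c \<in> carrier C"
  shows "tn (s \<odot>\<^bsub>B\<^esub> b) c = s \<odot>\<^bsub>T\<^esub> tn b c"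
proof -
  have "basis_elt S (s \<odot>\<^bsub>B\<^esub> b, c) \<ominus>\<^bsub>F\<^esub> (s \<odot>\<^bsub>F\<^esub> basis_elt S (b, c)) \<in> J"
    by (rule rel_in_ideal) (use assms in \<open>unfold bilinear_rels_def Let_def, blast\<close>)
  then show ?thesis
    unfolding tn_eq T_eq[symmetric] using assms by (subst quo.q_smult[symmetric]) (auto simp: quo.q_eq)
qed

lemma tn_smult_right:
  assumes "s \<in> carrier S" "b \<in> carrier B" "c \<in> carrier C"
  shows "tn b (s \<odot>\<^bsub>C\<^esub> c) = s \<odot>\<^bsub>T\<^esub> tn b c"
proof -
  have "basis_elt S (b, s \<odot>\<^bsub>C\<^esub> c) \<ominus>\<^bsub>F\<^esub> (s \<odot>\<^bsub>F\<^esub> basis_elt S (b, c)) \<in> J"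
    by (rule rel_in_ideal) (use assms in \<open>unfold bilinear_rels_def Let_def, blast\<close>)
  then show ?thesis
    unfolding tn_eq T_eq[symmetric] using assms by (subst quo.q_smult[symmetric]) (auto simp: quo.q_eq)
qed

lemma tn_mult:
  assumes "b \<in> carrier B" "c \<in> carrier C" "b' \<in> carrier B" "c' \<in> carrier C"
  shows "tn b c \<otimes>\<^bsub>T\<^esub> tn b' c' = tn (b \<otimes>\<^bsub>B\<^esub> b') (c \<otimes>\<^bsub>C\<^esub> c')"
  unfolding tn_eq T_eq[symmetric] M_simps(3)[symmetric] using assms
  by (subst quo.q_mult[symmetric]) (simp_all add: mon.basis_mult M_simps)

lemma tn_one: "tn \<one>\<^bsub>B\<^esub> \<one>\<^bsub>C\<^esub> = \<one>\<^bsub>T\<^esub>"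
  unfolding tn_eq T_eq[symmetric] M_simps(2)[symmetric] mon.F_ops(4)[symmetric] by (rule quo.q_one)

lemma left_hom: "(\<lambda>b. tn b \<one>\<^bsub>C\<^esub>) \<in> ring_hom B T"
  by (rule ring_hom_memI) (simp_all add: tn_mult tn_add_left tn_one)

lemma right_hom: "tn \<one>\<^bsub>B\<^esub> \<in> ring_hom C T"
  by (rule ring_hom_memI) (simp_all add: tn_mult tn_add_right tn_one)

lemma tn_base: "s \<in> carrier S \<Longrightarrow> tn (s \<odot>\<^bsub>B\<^esub> \<one>\<^bsub>B\<^esub>) \<one>\<^bsub>C\<^esub> = tn \<one>\<^bsub>B\<^esub> (s \<odot>\<^bsub>C\<^esub> \<one>\<^bsub>C\<^esub>)"
  by (simp add: tn_smult_left tn_smult_right)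

end

section \<open>Benign pairs and algebras on other types\<close>

text \<open>The copy of an algebra along a map that is injective on its carrier with left inverse \<open>e\<close>.\<close>

definition copy_alg :: "('p \<Rightarrow> 'q) \<Rightarrow> ('q \<Rightarrow> 'p) \<Rightarrow> ('r, 'p, 'y) module_scheme \<Rightarrow> ('r, 'q) module"
  where "copy_alg \<iota> e P =
    \<lparr>carrier = \<iota> ` carrier P, monoid.mult = (\<lambda>x y. \<iota> (e x \<otimes>\<^bsub>P\<^esub> e y)), one = \<iota> \<one>\<^bsub>P\<^esub>,
     ring.zero = \<iota> \<zero>\<^bsub>P\<^esub>, add = (\<lambda>x y. \<iota> (e x \<oplus>\<^bsub>P\<^esub> e y)), smult = (\<lambda>r x. \<iota> (r \<odot>\<^bsub>P\<^esub> e x))\<rparr>"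

locale copied = P?: algebra R P for R :: "('r, 'x) ring_scheme" (structure)
    and P :: "('r, 'p, 'y) module_scheme" (structure) +
  fixes \<iota> :: "'p \<Rightarrow> 'q" and e :: "'q \<Rightarrow> 'p"
  assumes e_iota: "\<And>x. x \<in> carrier P \<Longrightarrow> e (\<iota> x) = x"
begin

abbreviation "B \<equiv> copy_alg \<iota> e P"

lemma B_simps [simp]:
  "carrier B = \<iota> ` carrier P" "x \<otimes>\<^bsub>B\<^esub> y = \<iota> (e x \<otimes>\<^bsub>P\<^esub> e y)" "\<one>\<^bsub>B\<^esub> = \<iota> \<one>\<^bsub>P\<^esub>"
  "\<zero>\<^bsub>B\<^esub> = \<iota> \<zero>\<^bsub>P\<^esub>" "x \<oplus>\<^bsub>B\<^esub> y = \<iota> (e x \<oplus>\<^bsub>P\<^esub> e y)" "r \<odot>\<^bsub>B\<^esub> x = \<iota> (r \<odot>\<^bsub>P\<^esub> e x)"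
  by (simp_all add: copy_alg_def)

lemma copy_algebra: "algebra R B"
proof (rule algebraI[OF P.R_cring])
  show "cring B"
  proof (intro cringI abelian_groupI comm_monoidI)
    fix x assume "x \<in> carrier B"
    then obtain y where y: "y \<in> carrier P" "x = \<iota> y" by auto
    then show "\<exists>y\<in>carrier B. y \<oplus>\<^bsub>B\<^esub> x = \<zero>\<^bsub>B\<^esub>"
      by (intro bexI[of _ "\<iota> (\<ominus>\<^bsub>P\<^esub> y)"]) (simp_all add: e_iota P.M.l_neg)
  qed (auto simp: e_iota P.M.a_assoc P.M.a_lcomm P.m_assoc P.l_distr P.r_distr
      intro!: arg_cong[where f = \<iota>] intro: P.M.a_comm P.m_comm)
qed (auto simp: e_iota P.smult_l_distr P.smult_r_distr P.smult_assoc1 P.smult_assoc2)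

lemma iota_hom: "\<iota> \<in> ring_hom P B"
  by (rule ring_hom_memI) (simp_all add: e_iota)

lemma e_closed: "x \<in> carrier B \<Longrightarrow> e x \<in> carrier P" by (auto simp: e_iota)

end

text \<open>The benign condition for an algebra on another type, provided that \<open>(nat \<times> 'r) list\<close> enumerates
  its carrier.  The
  action is restricted to the carrier of the copy, since group actions and algebra homomorphisms
  are extensional functions.  The resulting ring is the tensor product over the invariants, and
  \<open>i z = j (\<psi> z)\<close> says that an invariant may be moved across the tensor sign.\<close>

theorem benign_extension:
  fixes R :: "('r, 'x) ring_scheme" and P :: "('r, 'p, 'y) module_scheme"
    and e :: "(nat \<times> 'r) list \<Rightarrow> 'p" and act :: "(nat \<Rightarrow> nat) \<Rightarrow> 'p \<Rightarrow> 'p"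
  assumes benign: "benign R n G" and P: "algebra R P" and G: "subgroup G (sym_group n)"
    and act_hom: "\<And>g. g \<in> G \<Longrightarrow> act g \<in> ring_hom P P"
    and act_lin: "\<And>g s x. g \<in> G \<Longrightarrow> s \<in> carrier R \<Longrightarrow> x \<in> carrier P \<Longrightarrow> act g (s \<odot>\<^bsub>P\<^esub> x) = s \<odot>\<^bsub>P\<^esub> act g x"
    and act_comp: "\<And>g g' x. g \<in> G \<Longrightarrow> g' \<in> G \<Longrightarrow> x \<in> carrier P \<Longrightarrow> act (g \<circ> g') x = act g (act g' x)"
    and act_id: "\<And>x. x \<in> carrier P \<Longrightarrow> act id x = x"
    and inv: "carrier I = {x \<in> carrier P. \<forall>g\<in>G. act g x = x}"
      "\<And>x y. x \<otimes>\<^bsub>I\<^esub> y = x \<otimes>\<^bsub>P\<^esub> y" "\<And>x y. x \<oplus>\<^bsub>I\<^esub> y = x \<oplus>\<^bsub>P\<^esub> y" "\<one>\<^bsub>I\<^esub> = \<one>\<^bsub>P\<^esub>"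
      "\<And>s x. s \<odot>\<^bsub>I\<^esub> x = s \<odot>\<^bsub>P\<^esub> x"
    and \<psi>: "\<psi> \<in> alg_hom R I (self_alg R)"
    and surj: "carrier P \<subseteq> range e"
  shows "\<exists>(Q :: ((nat \<times> 'r) list, ((nat \<times> 'r) list \<times> 'r \<Rightarrow> (nat \<times> 'r) list) set) module) i j.
    cring Q \<and> i \<in> ring_hom P Q \<and> j \<in> ring_hom R Q \<and> inj_on j (carrier R)
    \<and> (\<forall>z\<in>carrier I. i z = j (\<psi> z))"
proof -
  interpret P: algebra R P by (rule P)
  define \<iota> where "\<iota> = inv_into UNIV e"
  interpret copied R P \<iota> e
    by (intro copied.intro copied_axioms.intro P) (use surj in \<open>auto simp: \<iota>_def f_inv_into_f\<close>)
  define act' where "act' g = (\<lambda>x\<in>carrier B. \<iota> (act g (e x)))" for g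
  define \<psi>' where "\<psi>' = (\<lambda>x\<in>carrier (invariants G act' B). \<psi> (e x))"
  let ?S = "invariants G act' B"
  have act_closed: "act g x \<in> carrier P" if "g \<in> G" "x \<in> carrier P" for g x
    using ring_hom_closed[OF act_hom] that by blast
  have id_G: "id \<in> G" using subgroup.one_closed[OF G] by (simp add: sym_group_def)
  have comp_G: "g \<circ> g' \<in> G" if "g \<in> G" "g' \<in> G" for g g'
    using subgroup.m_closed[OF G that] by (simp add: sym_group_def)
  have inv_G: "\<exists>g'\<in>G. g' \<circ> g = id \<and> g \<circ> g' = id" if "g \<in> G" for g
  proof -
    have "g permutes {1..n}" using that subgroup.subset[OF G] by (auto simp: sym_group_def)
    moreover have "inv\<^bsub>sym_group n\<^esub> g \<in> G" using subgroup.m_inv_closed[OF G that] .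
    ultimately have "inv' g \<in> G" "inv' g \<circ> g = id" "g \<circ> inv' g = id"
      using sym_group_inv_equality[of g n] permutes_inv_o[of g "{1..n}"] by (auto simp: sym_group_carrier)
    then show ?thesis by blast
  qed
  have act'_eq: "act' g (\<iota> x) = \<iota> (act g x)" if "x \<in> carrier P" for g x
    using that by (simp add: act'_def e_iota)
  have act'_hom: "act' g \<in> ring_hom B B" if "g \<in> G" for g
  proof (rule ring_hom_memI)
    fix x y assume "x \<in> carrier B" "y \<in> carrier B"
    then obtain x' y' where xy: "x' \<in> carrier P" "y' \<in> carrier P" "x = \<iota> x'" "y = \<iota> y'" by auto
    then show "act' g x \<in> carrier B" "act' g (x \<otimes>\<^bsub>B\<^esub> y) = act' g x \<otimes>\<^bsub>B\<^esub> act' g y"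
      "act' g (x \<oplus>\<^bsub>B\<^esub> y) = act' g x \<oplus>\<^bsub>B\<^esub> act' g y"
      using that by (simp_all add: act'_eq e_iota act_closed ring_hom_mult[OF act_hom] ring_hom_add[OF act_hom])
  next
    show "act' g \<one>\<^bsub>B\<^esub> = \<one>\<^bsub>B\<^esub>" using that by (simp add: act'_eq ring_hom_one[OF act_hom])
  qed
  have act'_lin: "act' g (s \<odot>\<^bsub>B\<^esub> x) = s \<odot>\<^bsub>B\<^esub> act' g x" if "g \<in> G" "s \<in> carrier R" "x \<in> carrier B" for g s x
    using that by (auto simp: act'_eq e_iota act_closed act_lin)
  have act'_comp: "act' (g \<circ> g') x = act' g (act' g' x)" if "g \<in> G" "g' \<in> G" "x \<in> carrier B" for g g' x
    using that by (auto simp: act'_eq act_closed act_comp)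
  have act'_id: "act' id x = x" if "x \<in> carrier B" for x
    using that act_id by (auto simp: act'_eq)
  have act'_closed: "act' g x \<in> carrier B" if "g \<in> G" "x \<in> carrier B" for g x
    using ring_hom_closed[OF act'_hom] that by blast
  have act'_Bij: "act' g \<in> Bij (carrier B)" if g: "g \<in> G" for g
  proof -
    obtain g' where g': "g' \<in> G" "g' \<circ> g = id" "g \<circ> g' = id" using inv_G[OF g] by blast
    have "bij_betw (act' g) (carrier B) (carrier B)"
    proof (rule bij_betw_byWitness[where f' = "act' g'"])
      show "\<forall>x\<in>carrier B. act' g' (act' g x) = x" "\<forall>x\<in>carrier B. act' g (act' g' x) = x"
        using act'_comp[OF g'(1) g] act'_comp[OF g g'(1)] g' act'_id by auto
      show "act' g ` carrier B \<subseteq> carrier B" "act' g' ` carrier B \<subseteq> carrier B"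
        using act'_closed g g' by blast+
    qed
    then show ?thesis by (simp add: Bij_def act'_def)
  qed
  have ga: "group_action (sym_group n \<lparr>carrier := G\<rparr>) (carrier B) act'"
  proof (intro group_action.intro group_hom.intro group_hom_axioms.intro)
    show "group (sym_group n\<lparr>carrier := G\<rparr>)"
      by (rule subgroup.subgroup_is_group[OF G sym_group_is_group])
    show "group (BijGroup (carrier B))" by (rule group_BijGroup)
    show "act' \<in> hom (sym_group n\<lparr>carrier := G\<rparr>) (BijGroup (carrier B))"
    proof (rule homI)
      fix g g' assume "g \<in> carrier (sym_group n\<lparr>carrier := G\<rparr>)" "g' \<in> carrier (sym_group n\<lparr>carrier := G\<rparr>)"
      then have g: "g \<in> G" "g' \<in> G" by simp_all
      have "act' (g \<circ> g') = compose (carrier B) (act' g) (act' g')"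
        using act'_comp[OF g] by (auto simp: compose_def act'_def fun_eq_iff simp del: B_simps)
      then show "act' (g \<otimes>\<^bsub>sym_group n\<lparr>carrier := G\<rparr>\<^esub> g') = act' g \<otimes>\<^bsub>BijGroup (carrier B)\<^esub> act' g'"
        using act'_Bij[OF g(1)] act'_Bij[OF g(2)] by (simp add: sym_group_def BijGroup_def)
    qed (simp add: BijGroup_def act'_Bij del: B_simps)
  qed
  have act'_alg: "\<forall>g\<in>G. act' g \<in> alg_hom R B B"
    unfolding alg_hom_def using act'_hom act'_lin by (auto simp: act'_def simp del: B_simps)
  have inv_e: "e x \<in> carrier I" if "x \<in> carrier ?S" for x
  proof -
    have x: "x \<in> carrier B" "\<forall>g\<in>G. act' g x = x" using that by (simp_all add: invariants_carrier)
    have "act g (e x) = e x" if g: "g \<in> G" for g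
    proof -
      have "\<iota> (act g (e x)) = x" using x g by (simp add: act'_def)
      then show ?thesis using e_iota[OF act_closed[OF g e_closed[OF x(1)]]] by simp
    qed
    then show ?thesis using e_closed[OF x(1)] by (simp add: inv)
  qed
  have inv_iota: "\<iota> z \<in> carrier ?S" if "z \<in> carrier I" for z
    using that by (auto simp: inv invariants_carrier act'_eq)
  have S_alg: "algebra R ?S" by (rule invariants_algebra[OF copy_algebra act'_hom act'_lin])
  interpret S: algebra R ?S by (rule S_alg)
  have psi_hom: "\<psi> \<in> ring_hom I (self_alg R)" and psi_lin: "\<And>r x. r \<in> carrier R \<Longrightarrow> x \<in> carrier I \<Longrightarrow>
      \<psi> (r \<odot>\<^bsub>I\<^esub> x) = r \<odot>\<^bsub>self_alg R\<^esub> \<psi> x"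
    using \<psi> by (auto simp: alg_hom_def)
  have psi'_hom: "\<psi>' \<in> ring_hom ?S R"
  proof (rule ring_hom_memI)
    fix x y assume xy: "x \<in> carrier ?S" "y \<in> carrier ?S"
    have m: "x \<otimes>\<^bsub>?S\<^esub> y \<in> carrier ?S" "x \<oplus>\<^bsub>?S\<^esub> y \<in> carrier ?S"
      by (rule S.m_closed[OF xy], rule S.a_closed[OF xy])
    have exy: "e x \<in> carrier P" "e y \<in> carrier P" using inv_e[OF xy(1)] inv_e[OF xy(2)] by (simp_all add: inv)
    show "\<psi>' x \<in> carrier R"
      using ring_hom_closed[OF psi_hom inv_e[OF xy(1)]] xy by (simp add: \<psi>'_def)
    show "\<psi>' (x \<otimes>\<^bsub>?S\<^esub> y) = \<psi>' x \<otimes>\<^bsub>R\<^esub> \<psi>' y"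
      using ring_hom_mult[OF psi_hom inv_e[OF xy(1)] inv_e[OF xy(2)]] xy m exy
      by (simp add: \<psi>'_def e_iota inv)
    show "\<psi>' (x \<oplus>\<^bsub>?S\<^esub> y) = \<psi>' x \<oplus>\<^bsub>R\<^esub> \<psi>' y"
      using ring_hom_add[OF psi_hom inv_e[OF xy(1)] inv_e[OF xy(2)]] xy m exy
      by (simp add: \<psi>'_def e_iota inv)
  next
    show "\<psi>' \<one>\<^bsub>?S\<^esub> = \<one>\<^bsub>R\<^esub>"
      using ring_hom_one[OF psi_hom] S.one_closed by (simp add: \<psi>'_def e_iota inv)
  qed
  have psi'_alg: "\<psi>' \<in> alg_hom R ?S (self_alg R)"
  proof -
    have "\<psi>' (r \<odot>\<^bsub>?S\<^esub> x) = r \<otimes>\<^bsub>R\<^esub> \<psi>' x" if "r \<in> carrier R" "x \<in> carrier ?S" for r x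
      using that psi_lin[OF that(1) inv_e[OF that(2)]] S.smult_closed[OF that] inv_e[OF that(2)]
      by (simp add: \<psi>'_def e_iota inv)
    moreover have "\<psi>' \<in> ring_hom ?S (self_alg R)" using psi'_hom by (simp add: ring_hom_def)
    ultimately show ?thesis by (simp add: alg_hom_def \<psi>'_def)
  qed
  have id_hom: "(\<lambda>r. r) \<in> ring_hom ?S B"
    by (rule ring_hom_memI) (simp_all add: invariants_carrier del: B_simps)
  let ?B = "self_alg B" and ?C = "alg_via R \<psi>'"
  interpret t: tens ?S ?B ?C
    by (intro tens.intro alg_via_algebra S.M_cring algebra.M_cring[OF copy_algebra] id_hom P.R_cring psi'_hom)
  have inj: "inj_on (t.tn \<one>\<^bsub>B\<^esub>) (carrier R)"
    using benign copy_algebra ga act'_alg psi'_alg unfolding benign_def by blast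
  have i_hom: "(\<lambda>b. t.tn b \<one>\<^bsub>R\<^esub>) \<circ> \<iota> \<in> ring_hom P t.T"
  proof (rule ring_hom_trans[OF iota_hom])
    show "(\<lambda>b. t.tn b \<one>\<^bsub>R\<^esub>) \<in> ring_hom B t.T"
      using t.left_hom by (simp add: ring_hom_def del: B_simps)
  qed
  have j_hom: "t.tn \<one>\<^bsub>B\<^esub> \<in> ring_hom R t.T"
    using t.right_hom by (simp add: ring_hom_def del: B_simps)
  have "((\<lambda>b. t.tn b \<one>\<^bsub>R\<^esub>) \<circ> \<iota>) z = t.tn \<one>\<^bsub>B\<^esub> (\<psi> z)" if z: "z \<in> carrier I" for z
  proof -
    have zP: "z \<in> carrier P" using z by (simp add: inv)
    have b: "\<iota> z \<in> carrier ?S" by (rule inv_iota[OF z])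
    have "\<iota> z \<otimes>\<^bsub>B\<^esub> \<one>\<^bsub>B\<^esub> = \<iota> z" using zP by (simp add: e_iota)
    moreover have "\<psi>' (\<iota> z) \<otimes>\<^bsub>R\<^esub> \<one>\<^bsub>R\<^esub> = \<psi> z"
      using b zP ring_hom_closed[OF psi_hom z] by (simp add: \<psi>'_def e_iota)
    ultimately show ?thesis using t.tn_base[OF b] by (simp del: B_simps)
  qed
  then show ?thesis
    by (intro exI[of _ t.T] exI[of _ "(\<lambda>b. t.tn b \<one>\<^bsub>R\<^esub>) \<circ> \<iota>"] exI[of _ "t.tn \<one>\<^bsub>B\<^esub>"] conjI ballI
        t.T.M_cring i_hom j_hom inj)
qed

section \<open>Monogenic algebras are free\<close>

context UP_cring
begin

text \<open>Coefficients rather than degrees bound the remainder, because over the zero ring every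
  polynomial has degree 0.  The induction removes the leading term of \<open>g\<close>.\<close>

lemma monic_division:
  assumes f: "monic_of_degree R n f" and "g \<in> carrier (UP R)"
  shows "\<exists>s\<in>carrier (UP R). \<exists>r\<in>carrier (UP R). g = f \<otimes>\<^bsub>UP R\<^esub> s \<oplus>\<^bsub>UP R\<^esub> r \<and> (\<forall>l\<ge>n. r l = \<zero>\<^bsub>R\<^esub>)"
proof -
  have fP: "f \<in> carrier P" and fn: "f n = \<one>\<^bsub>R\<^esub>" and f0: "\<And>l. l > n \<Longrightarrow> f l = \<zero>\<^bsub>R\<^esub>"
    using f by (auto simp: monic_of_degree_def P_def)
  have step: "g \<in> carrier P \<Longrightarrow> \<forall>l\<ge>N. g l = \<zero>\<^bsub>R\<^esub> \<Longrightarrow>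
      \<exists>s\<in>carrier P. \<exists>r\<in>carrier P. g = f \<otimes>\<^bsub>P\<^esub> s \<oplus>\<^bsub>P\<^esub> r \<and> (\<forall>l\<ge>n. r l = \<zero>\<^bsub>R\<^esub>)" for N g
  proof (induction N arbitrary: g)
    case 0
    have "g = f \<otimes>\<^bsub>P\<^esub> \<zero>\<^bsub>P\<^esub> \<oplus>\<^bsub>P\<^esub> g" using 0(1) fP by simp
    moreover have "\<forall>l\<ge>n. g l = \<zero>\<^bsub>R\<^esub>" using 0(2) by simp
    ultimately have "\<exists>r\<in>carrier P. g = f \<otimes>\<^bsub>P\<^esub> \<zero>\<^bsub>P\<^esub> \<oplus>\<^bsub>P\<^esub> r \<and> (\<forall>l\<ge>n. r l = \<zero>\<^bsub>R\<^esub>)"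
      using 0(1) by blast
    then show ?case using P.zero_closed by blast
  next
    case (Suc N)
    show ?case
    proof (cases "N < n")
      case True
      have "g = f \<otimes>\<^bsub>P\<^esub> \<zero>\<^bsub>P\<^esub> \<oplus>\<^bsub>P\<^esub> g" using Suc.prems(1) fP by simp
      moreover have "\<forall>l\<ge>n. g l = \<zero>\<^bsub>R\<^esub>" using True Suc.prems(2) by simp
      ultimately have "\<exists>r\<in>carrier P. g = f \<otimes>\<^bsub>P\<^esub> \<zero>\<^bsub>P\<^esub> \<oplus>\<^bsub>P\<^esub> r \<and> (\<forall>l\<ge>n. r l = \<zero>\<^bsub>R\<^esub>)"
        using Suc.prems(1) by blast
      then show ?thesis using P.zero_closed by blast
    next
      case False
      have gN: "g N \<in> carrier R" using coeff_closed[OF Suc.prems(1), of N] Suc.prems(1) by (simp add: P_def)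
      let ?m = "up_ring.monom P (g N) (N - n)"
      let ?g = "g \<ominus>\<^bsub>P\<^esub> f \<otimes>\<^bsub>P\<^esub> ?m"
      have m: "?m \<in> carrier P" using gN by simp
      have g': "?g \<in> carrier P" using Suc.prems fP m by simp
      have co: "up_ring.coeff P (f \<otimes>\<^bsub>P\<^esub> ?m) l = g N \<otimes>\<^bsub>R\<^esub> f (l - (N - n))" if "l \<ge> N" for l
      proof -
        have "l = (l - (N - n)) + (N - n)" using that by simp
        then have "up_ring.coeff P (?m \<otimes>\<^bsub>P\<^esub> f) l = g N \<otimes>\<^bsub>R\<^esub> up_ring.coeff P f (l - (N - n))"
          using coeff_monom_mult[OF gN fP, of "N - n" "l - (N - n)"] by (simp add: add.commute)
        then show ?thesis using fP P.m_comm[OF fP m] by (simp add: P_def)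
      qed
      have "?g l = \<zero>\<^bsub>R\<^esub>" if l: "l \<ge> N" for l
      proof -
        have gl: "g l \<in> carrier R" using coeff_closed[OF Suc.prems(1), of l] Suc.prems(1) by (simp add: P_def)
        have "?g l = up_ring.coeff P ?g l" using g' by (simp add: P_def)
        also have "\<dots> = g l \<ominus>\<^bsub>R\<^esub> g N \<otimes>\<^bsub>R\<^esub> f (l - (N - n))"
          using coeff_minus[OF Suc.prems(1) P.m_closed[OF fP m], of l] co[OF l] Suc.prems(1)
          by (simp only:) (simp add: P_def)
        also have "\<dots> = \<zero>\<^bsub>R\<^esub>"
        proof (cases "l = N")
          case True
          then have "l - (N - n) = n" using False by simp
          then show ?thesis using fn True gN by (simp add: R.minus_eq R.r_neg)
        next
          case ne: False
          then have "l - (N - n) > n" "g l = \<zero>\<^bsub>R\<^esub>" using l False Suc.prems(2) by auto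
          then show ?thesis using f0 gN by (simp add: R.minus_eq)
        qed
        finally show ?thesis .
      qed
      then obtain s r where s: "s \<in> carrier P" "r \<in> carrier P" "?g = f \<otimes>\<^bsub>P\<^esub> s \<oplus>\<^bsub>P\<^esub> r" "\<forall>l\<ge>n. r l = \<zero>\<^bsub>R\<^esub>"
        using Suc.IH[OF g'] by blast
      have "g = ?g \<oplus>\<^bsub>P\<^esub> f \<otimes>\<^bsub>P\<^esub> ?m"
        using Suc.prems(1) fP m by (simp add: P.minus_eq P.a_assoc P.l_neg)
      also have "\<dots> = f \<otimes>\<^bsub>P\<^esub> (s \<oplus>\<^bsub>P\<^esub> ?m) \<oplus>\<^bsub>P\<^esub> r"
        unfolding s(3) using s(1,2) fP m by (simp add: P.r_distr P.a_ac)
      finally show ?thesis using s m by blast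
    qed
  qed
  have gP: "g \<in> carrier P" using assms(2) by (simp add: P_def)
  have "\<forall>l\<ge>Suc (deg R g). g l = \<zero>\<^bsub>R\<^esub>"
    using deg_aboveD[OF _ gP] gP by (simp add: P_def)
  from step[OF gP this] show ?thesis by (simp add: P_def)
qed

text \<open>The leading coefficient of \<open>s\<close> reappears as that of \<open>f s\<close>, since \<open>f\<close> is monic.\<close>

lemma monic_multiple_small:
  assumes f: "monic_of_degree R n f" and s: "s \<in> carrier (UP R)"
    and small: "\<forall>l\<ge>n. (f \<otimes>\<^bsub>UP R\<^esub> s) l = \<zero>\<^bsub>R\<^esub>"
  shows "s = \<zero>\<^bsub>UP R\<^esub>"
proof (rule ccontr)
  assume ne: "s \<noteq> \<zero>\<^bsub>UP R\<^esub>"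
  have fP: "f \<in> carrier P" and fn: "f n = \<one>\<^bsub>R\<^esub>" and f0: "\<And>l. l > n \<Longrightarrow> f l = \<zero>\<^bsub>R\<^esub>"
    using f by (auto simp: monic_of_degree_def P_def)
  have sP: "s \<in> carrier P" using s by (simp add: P_def)
  have cl: "f l \<in> carrier R" "s l \<in> carrier R" for l
    using coeff_closed[OF fP, of l] coeff_closed[OF sP, of l] fP sP by (simp_all add: P_def)
  let ?m = "deg R s"
  have sm: "s ?m \<noteq> \<zero>\<^bsub>R\<^esub>" using lcoeff_nonzero[OF _ sP] ne sP by (simp add: P_def)
  have s0: "s l = \<zero>\<^bsub>R\<^esub>" if "l > ?m" for l using deg_aboveD[OF that sP] sP by (simp add: P_def)
  have "(f \<otimes>\<^bsub>UP R\<^esub> s) (n + ?m) = (\<Oplus>\<^bsub>R\<^esub>i\<in>{..n + ?m}. f i \<otimes>\<^bsub>R\<^esub> s (n + ?m - i))"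
    using fP sP by (simp add: UP_ops P_def)
  also have "\<dots> = (\<Oplus>\<^bsub>R\<^esub>i\<in>{..n + ?m}. if n = i then s ?m else \<zero>\<^bsub>R\<^esub>)"
  proof (intro R.finsum_cong' refl)
    fix i assume i: "i \<in> {..n + ?m}"
    consider "i = n" | "i < n" | "i > n" by linarith
    then show "f i \<otimes>\<^bsub>R\<^esub> s (n + ?m - i) = (if n = i then s ?m else \<zero>\<^bsub>R\<^esub>)"
    proof cases
      case 2
      then have "n + ?m - i > ?m" by simp
      then show ?thesis using 2 cl s0 by simp
    qed (use cl fn f0 in auto)
  qed (use cl in auto)
  also have "\<dots> = s ?m" using cl by (intro R.finsum_singleton) auto
  finally show False using small sm by simp
qed

end

section \<open>Enumerating tensor powers of a polynomial ring\<close>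

text \<open>Lists over \<open>nat \<times> 'r\<close> as linear combinations of monomials, whose exponent vectors are numbered.\<close>

fun comb_of_list :: "('r, 'p, 'y) module_scheme \<Rightarrow> (nat \<Rightarrow> 'p) \<Rightarrow> (nat \<times> 'r) list \<Rightarrow> 'p"
  where "comb_of_list P \<mu> [] = \<zero>\<^bsub>P\<^esub>"
  | "comb_of_list P \<mu> ((k, r) # l) = r \<odot>\<^bsub>P\<^esub> \<mu> k \<oplus>\<^bsub>P\<^esub> comb_of_list P \<mu> l"

lemma (in algebra) comb_of_list_span:
  assumes \<mu>: "\<And>k. \<mu> k \<in> carrier M"
  defines "H \<equiv> comb_of_list M \<mu> ` lists (UNIV \<times> carrier R)"
  shows "H \<subseteq> carrier M" "\<zero>\<^bsub>M\<^esub> \<in> H" "\<mu> k \<in> H"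
    "\<And>x y. x \<in> H \<Longrightarrow> y \<in> H \<Longrightarrow> x \<oplus>\<^bsub>M\<^esub> y \<in> H"
    "\<And>s x. s \<in> carrier R \<Longrightarrow> x \<in> H \<Longrightarrow> s \<odot>\<^bsub>M\<^esub> x \<in> H"
proof -
  let ?c = "comb_of_list M \<mu>"
  have cl: "?c l \<in> carrier M" if "l \<in> lists (UNIV \<times> carrier R)" for l
    using that by (induction l) (auto simp: \<mu>)
  then show sub: "H \<subseteq> carrier M" unfolding H_def by blast
  show "\<zero>\<^bsub>M\<^esub> \<in> H" unfolding H_def by (intro image_eqI[of _ _ "[]"]) auto
  show "\<mu> k \<in> H" unfolding H_def by (intro image_eqI[of _ _ "[(k, \<one>\<^bsub>R\<^esub>)]"]) (auto simp: \<mu>)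
  have app: "?c (l @ l') = ?c l \<oplus>\<^bsub>M\<^esub> ?c l'"
    if "l \<in> lists (UNIV \<times> carrier R)" "l' \<in> lists (UNIV \<times> carrier R)" for l l'
    using that
  proof (induction l)
    case Nil
    then show ?case using cl[of l'] by simp
  next
    case (Cons a l)
    then have "l \<in> lists (UNIV \<times> carrier R)" "snd a \<in> carrier R" by auto
    then show ?case using Cons cl[of l] cl[of l'] \<mu> by (cases a) (simp add: M.a_assoc)
  qed
  show "x \<oplus>\<^bsub>M\<^esub> y \<in> H" if x: "x \<in> H" and y: "y \<in> H" for x y
  proof -
    obtain l l' where l: "l \<in> lists (UNIV \<times> carrier R)" "x = ?c l"
      and l': "l' \<in> lists (UNIV \<times> carrier R)" "y = ?c l'"
      using x y unfolding H_def by blast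
    have "x \<oplus>\<^bsub>M\<^esub> y = ?c (l @ l')" using app[OF l(1) l'(1)] l(2) l'(2) by simp
    moreover have "l @ l' \<in> lists (UNIV \<times> carrier R)" using l(1) l'(1) by simp
    ultimately show ?thesis unfolding H_def by blast
  qed
  show "s \<odot>\<^bsub>M\<^esub> x \<in> H" if s: "s \<in> carrier R" and x: "x \<in> H" for s x
  proof -
    obtain l where l: "l \<in> lists (UNIV \<times> carrier R)" "x = ?c l"
      using x unfolding H_def by blast
    have "s \<odot>\<^bsub>M\<^esub> ?c l = ?c (map (\<lambda>(k, r). (k, s \<otimes>\<^bsub>R\<^esub> r)) l)"
      using l(1)
    proof (induction l)
      case (Cons a l)
      then have "l \<in> lists (UNIV \<times> carrier R)" "snd a \<in> carrier R" by auto
      then show ?case using Cons cl[of l] \<mu> s by (cases a) (simp add: smult_r_distr smult_assoc1)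
    qed (simp add: s)
    moreover have "snd p \<in> carrier R" if "p \<in> set l" for p using l(1) that by auto
    then have "map (\<lambda>(k, r). (k, s \<otimes>\<^bsub>R\<^esub> r)) l \<in> lists (UNIV \<times> carrier R)"
      using s by (auto simp: case_prod_beta)
    ultimately show ?thesis unfolding H_def l(2) by blast
  qed
qed

text \<open>The pure tensors of monomials are countable in number and span the tensor power; an exponent
  vector is coded as a natural number.  To see that they span, the slots of a pure tensor are
  expanded one at a time.\<close>

lemma tpower_UP_enumeration:
  fixes R :: "('r, 'x) ring_scheme"
  assumes "cring R"
  shows "\<exists>e :: (nat \<times> 'r) list \<Rightarrow> _. carrier (tpower R (UP R) n) \<subseteq> range e"
proof -
  interpret U: UP_cring R "UP R" by (intro UP_cring.intro assms) simp
  interpret t: tpow R "UP R" n by (intro tpow.intro U.UP_algebra)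
  define mono where "mono k = (\<lambda>i\<in>{1..n}. up_ring.monom (UP R) \<one>\<^bsub>R\<^esub> ((from_nat k :: nat list) ! (i - 1)))" for k
  have mono: "mono k \<in> carrier t.M" for k by (auto simp: mono_def tuples_simps)
  let ?\<mu> = "\<lambda>k. t.pt (mono k)"
  let ?H = "comb_of_list t.T ?\<mu> ` lists (UNIV \<times> carrier R)"
  have mu: "?\<mu> k \<in> carrier t.T" for k by (rule t.pt_closed[OF mono])
  note H = t.T.comb_of_list_span[of ?\<mu>, OF mu]
  have mono_all: "t.pt u \<in> ?H"
    if u: "u \<in> carrier t.M" and um: "\<forall>i\<in>{1..n}. \<exists>m. u i = up_ring.monom (UP R) \<one>\<^bsub>R\<^esub> m" for u
  proof -
    obtain m where m: "\<forall>i\<in>{1..n}. u i = up_ring.monom (UP R) \<one>\<^bsub>R\<^esub> (m i)" using bchoice[OF um] ..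
    have "u = mono (to_nat (map (\<lambda>i. m (Suc i)) [0..<n]))"
    proof
      fix i
      show "u i = mono (to_nat (map (\<lambda>i. m (Suc i)) [0..<n])) i"
      proof (cases "i \<in> {1..n}")
        case True
        then have "i - 1 < n" "Suc (i - 1) = i" by auto
        then show ?thesis using m True by (simp add: mono_def)
      next
        case False
        then show ?thesis using u by (auto simp: mono_def tuples_simps PiE_iff extensional_def)
      qed
    qed
    then show ?thesis using H(3) by simp
  qed
  have pure_in: "finite K \<Longrightarrow> K \<subseteq> {1..n} \<Longrightarrow> u \<in> carrier t.M \<Longrightarrow>
      \<forall>i\<in>{1..n} - K. \<exists>m. u i = up_ring.monom (UP R) \<one>\<^bsub>R\<^esub> m \<Longrightarrow> t.pt u \<in> ?H" for K u
  proof (induction K arbitrary: u rule: finite_induct)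
    case empty
    then show ?case using mono_all by simp
  next
    case (insert i K)
    have i: "i \<in> {1..n}" and K: "K \<subseteq> {1..n}" using insert.prems by auto
    have "t.pt (u(i := p)) \<in> ?H" if "p \<in> carrier (UP R)" for p using that
    proof (induction p rule: U.UP_monom_induct)
      case (monom r m)
      have eq: "up_ring.monom (UP R) r m = r \<odot>\<^bsub>UP R\<^esub> up_ring.monom (UP R) \<one>\<^bsub>R\<^esub> m"
        using monom U.monom_mult_smult[of r "\<one>\<^bsub>R\<^esub>" m] by simp
      have "t.pt (u(i := up_ring.monom (UP R) \<one>\<^bsub>R\<^esub> m)) \<in> ?H"
        using insert.prems i by (intro insert.IH K t.upd_closed) auto
      then show ?case
        unfolding eq t.pt_smult[OF insert.prems(2) i monom U.monom_closed[OF U.R.one_closed]]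
        by (rule H(5)[OF monom])
    next
      case (add p q)
      show ?case
        unfolding t.pt_add[OF insert.prems(2) i add.hyps] by (rule H(4)[OF add.IH])
    qed
    moreover have "u i \<in> carrier (UP R)" using insert.prems i by (auto simp: tuples_simps)
    ultimately have "t.pt (u(i := u i)) \<in> ?H" by blast
    then show ?case by simp
  qed
  have "z \<in> ?H" if "z \<in> carrier t.T" for z using that
  proof (induction z rule: t.tpow_induct)
    case zero
    show ?case by (rule H(2))
  next
    case (pure s u)
    have "t.pt u \<in> ?H" by (rule pure_in[of "{1..n}"]) (use pure in auto)
    then show ?case by (rule H(5)[OF pure(1)])
  next
    case (add x y)
    show ?case by (rule H(4)[OF add.IH])
  qed
  then have "carrier t.T \<subseteq> range (comb_of_list t.T ?\<mu>)" by blast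
  then show ?thesis by (rule exI[of "\<lambda>e. carrier t.T \<subseteq> range e" "comb_of_list t.T ?\<mu>"])
qed

text \<open>Division by the monic polynomial \<open>f\<close> gives each class modulo \<open>f\<close> a unique representative of
  degree below \<open>n\<close>, so \<open>1, x, \<dots>, x\<^sup>n\<^sup>-\<^sup>1\<close> is a basis; it is indexed from 1.\<close>

lemma monogenic_ex_basis:
  fixes R :: "('r, 'x) ring_scheme" and A :: "('r, 'a, 'y) module_scheme"
  assumes A: "algebra R A" and mono: "monogenic R A n"
  shows "\<exists>\<epsilon>. is_basis R A n \<epsilon>"
proof -
  interpret A: algebra R A by (rule A)
  interpret U: UP_cring R "UP R" by (intro UP_cring.intro A.R_cring) simp
  obtain f h where f: "monic_of_degree R n f"
    and h: "h \<in> alg_hom R (alg_quot (UP R) (PIdl\<^bsub>UP R\<^esub> f)) A"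
    and bij: "bij_betw h (carrier (alg_quot (UP R) (PIdl\<^bsub>UP R\<^esub> f))) (carrier A)"
    using mono unfolding monogenic_def by blast
  let ?I = "PIdl\<^bsub>UP R\<^esub> f"
  have fU: "f \<in> carrier (UP R)" using f by (simp add: monic_of_degree_def)
  interpret q: quot_alg R "UP R" ?I
    by (intro quot_alg.intro U.UP_algebra U.P.cgenideal_ideal fU)
  have I_mem: "z \<in> ?I \<longleftrightarrow> (\<exists>s\<in>carrier (UP R). z = s \<otimes>\<^bsub>UP R\<^esub> f)" for z
    unfolding cgenideal_def by blast
  have h_ring: "h \<in> ring_hom q.Q A" and h_lin: "\<And>r x. r \<in> carrier R \<Longrightarrow> x \<in> carrier q.Q \<Longrightarrow>
      h (r \<odot>\<^bsub>q.Q\<^esub> x) = r \<odot>\<^bsub>A\<^esub> h x"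
    using h unfolding alg_hom_def by blast+
  define p where "p c = (\<lambda>l. if l < n then c (Suc l) else \<zero>\<^bsub>R\<^esub>)" for c :: "nat \<Rightarrow> 'r"
  define \<epsilon> where "\<epsilon> i = h (q.q (up_ring.monom (UP R) \<one>\<^bsub>R\<^esub> (i - 1)))" for i
  interpret hq: ring_hom_cring "UP R" A "\<lambda>g. h (q.q g)"
    by (rule ring_hom_cringI[OF U.UP_cring A.M_cring])
       (use ring_hom_trans[OF q.q_hom h_ring] in \<open>simp add: comp_def\<close>)
  have p_sum: "p c \<in> carrier (UP R) \<and> p c = (\<Oplus>\<^bsub>UP R\<^esub>i\<in>{1..n}. c i \<odot>\<^bsub>UP R\<^esub> up_ring.monom (UP R) \<one>\<^bsub>R\<^esub> (i - 1))"
    if c: "\<And>i. i \<in> {1..n} \<Longrightarrow> c i \<in> carrier R" for c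
  proof -
    let ?s = "\<Oplus>\<^bsub>UP R\<^esub>i\<in>{1..n}. c i \<odot>\<^bsub>UP R\<^esub> up_ring.monom (UP R) \<one>\<^bsub>R\<^esub> (i - 1)"
    have s: "?s \<in> carrier (UP R)" using c by (intro U.P.finsum_closed) auto
    have "?s l = p c l" for l
    proof -
      have "?s l = up_ring.coeff (UP R) ?s l" using s by simp
      also have "\<dots> = (\<Oplus>\<^bsub>R\<^esub>i\<in>{1..n}. up_ring.coeff (UP R) (c i \<odot>\<^bsub>UP R\<^esub> up_ring.monom (UP R) \<one>\<^bsub>R\<^esub> (i - 1)) l)"
        using c by (intro U.coeff_finsum) auto
      also have "\<dots> = (\<Oplus>\<^bsub>R\<^esub>i\<in>{1..n}. if Suc l = i then c i else \<zero>\<^bsub>R\<^esub>)"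
        using c by (intro A.R.finsum_cong') (auto simp del: UP_coeff)
      also have "\<dots> = p c l"
      proof (cases "l < n")
        case True
        then show ?thesis using c by (subst A.R.finsum_singleton) (auto simp: p_def)
      next
        case False
        then show ?thesis by (intro trans[OF A.R.add.finprod_one_eqI]) (auto simp: p_def)
      qed
      finally show ?thesis .
    qed
    then have "?s = p c" by (rule ext)
    then show ?thesis using s by simp
  qed
  have comb: "(\<Oplus>\<^bsub>A\<^esub>i\<in>{1..n}. c i \<odot>\<^bsub>A\<^esub> \<epsilon> i) = h (q.q (p c))" if c: "\<And>i. i \<in> {1..n} \<Longrightarrow> c i \<in> carrier R" for c
  proof -
    have "h (q.q (p c)) = (\<Oplus>\<^bsub>A\<^esub>i\<in>{1..n}. h (q.q (c i \<odot>\<^bsub>UP R\<^esub> up_ring.monom (UP R) \<one>\<^bsub>R\<^esub> (i - 1))))"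
      using p_sum[of c, OF c] c by (subst conjunct2[OF p_sum[of c, OF c]]) (auto simp: comp_def)
    also have "\<dots> = (\<Oplus>\<^bsub>A\<^esub>i\<in>{1..n}. c i \<odot>\<^bsub>A\<^esub> \<epsilon> i)"
    proof (intro A.M.finsum_cong' refl)
      show "(\<lambda>i. c i \<odot>\<^bsub>A\<^esub> \<epsilon> i) \<in> {1..n} \<rightarrow> carrier A"
        using c hq.hom_closed by (auto simp: \<epsilon>_def)
      fix i assume "i \<in> {1..n}"
      then show "h (q.q (c i \<odot>\<^bsub>UP R\<^esub> up_ring.monom (UP R) \<one>\<^bsub>R\<^esub> (i - 1))) = c i \<odot>\<^bsub>A\<^esub> \<epsilon> i"
        using c by (simp add: q.q_smult h_lin \<epsilon>_def)
    qed
    finally show ?thesis ..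
  qed
  have "is_basis R A n \<epsilon>"
    unfolding is_basis_def
  proof (intro conjI ballI)
    show "\<epsilon> \<in> {1..n} \<rightarrow> carrier A" using hq.hom_closed by (auto simp: \<epsilon>_def)
  next
    fix x assume x: "x \<in> carrier A"
    have "x \<in> h ` carrier q.Q" using bij x by (simp add: bij_betw_def)
    then obtain g where g: "g \<in> carrier (UP R)" "x = h (q.q g)" using q.q_surj by blast
    obtain s r where s: "s \<in> carrier (UP R)" "r \<in> carrier (UP R)" "g = f \<otimes>\<^bsub>UP R\<^esub> s \<oplus>\<^bsub>UP R\<^esub> r"
      "\<forall>l\<ge>n. r l = \<zero>\<^bsub>R\<^esub>" using U.monic_division[OF f g(1)] by blast
    have "g \<ominus>\<^bsub>UP R\<^esub> r = f \<otimes>\<^bsub>UP R\<^esub> s"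
      unfolding s(3) using s fU by (simp add: U.P.minus_eq U.P.a_assoc U.P.r_neg)
    then have "g \<ominus>\<^bsub>UP R\<^esub> r \<in> ?I" using s fU U.P.m_comm unfolding I_mem by metis
    then have xr: "x = h (q.q r)" using g s q.q_eq by metis
    have rl: "r l \<in> carrier R" for l using U.coeff_closed[OF s(2), of l] s(2) by simp
    define c where "c = (\<lambda>i\<in>{1..n}. r (i - 1))"
    have c: "c \<in> {1..n} \<rightarrow>\<^sub>E carrier R" using rl by (auto simp: c_def)
    have cR: "\<And>i. i \<in> {1..n} \<Longrightarrow> c i \<in> carrier R" using rl by (simp add: c_def)
    have "p c = r" using s(4) by (auto simp: p_def c_def fun_eq_iff)
    then have xc: "x = (\<Oplus>\<^bsub>A\<^esub>i\<in>{1..n}. c i \<odot>\<^bsub>A\<^esub> \<epsilon> i)" using comb[of c, OF cR] xr by simp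
    show "\<exists>!c. c \<in> {1..n} \<rightarrow>\<^sub>E carrier R \<and> x = (\<Oplus>\<^bsub>A\<^esub>i\<in>{1..n}. c i \<odot>\<^bsub>A\<^esub> \<epsilon> i)"
    proof (rule ex1I[of _ c])
      show "c \<in> {1..n} \<rightarrow>\<^sub>E carrier R \<and> x = (\<Oplus>\<^bsub>A\<^esub>i\<in>{1..n}. c i \<odot>\<^bsub>A\<^esub> \<epsilon> i)" using c xc by simp
      fix d assume d: "d \<in> {1..n} \<rightarrow>\<^sub>E carrier R \<and> x = (\<Oplus>\<^bsub>A\<^esub>i\<in>{1..n}. d i \<odot>\<^bsub>A\<^esub> \<epsilon> i)"
      have dR: "\<And>i. i \<in> {1..n} \<Longrightarrow> d i \<in> carrier R"
        using d by auto
      have pU: "p c \<in> carrier (UP R)" "p d \<in> carrier (UP R)" using conjunct1[OF p_sum[of c, OF cR]] conjunct1[OF p_sum[of d, OF dR]] by blast+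
      have "h (q.q (p c)) = h (q.q (p d))" using comb[of c, OF cR] comb[of d, OF dR] xc d by simp
      then have "q.q (p c) = q.q (p d)"
        using bij pU q.q_closed unfolding bij_betw_def inj_on_def by blast
      then have "p c \<ominus>\<^bsub>UP R\<^esub> p d \<in> ?I" using q.q_eq pU by simp
      then obtain s' where s': "s' \<in> carrier (UP R)" "p c \<ominus>\<^bsub>UP R\<^esub> p d = f \<otimes>\<^bsub>UP R\<^esub> s'"
        unfolding I_mem using U.P.m_comm fU by metis
      have diff: "(p c \<ominus>\<^bsub>UP R\<^esub> p d) l = p c l \<ominus>\<^bsub>R\<^esub> p d l" for l
        using pU U.coeff_minus[OF pU, of l] by (metis U.P.minus_closed UP_coeff)
      have "\<forall>l\<ge>n. (f \<otimes>\<^bsub>UP R\<^esub> s') l = \<zero>\<^bsub>R\<^esub>"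
        unfolding s'(2)[symmetric] diff by (simp add: p_def A.R.minus_eq)
      then have "s' = \<zero>\<^bsub>UP R\<^esub>" by (rule U.monic_multiple_small[OF f s'(1)])
      then have "p c \<ominus>\<^bsub>UP R\<^esub> p d = \<zero>\<^bsub>UP R\<^esub>" using s'(2) fU by simp
      then have pp: "p c = p d" using pU by simp
      show "d = c"
      proof (rule PiE_ext[of d "{1..n}" "\<lambda>_. carrier R"])
        fix i assume "i \<in> {1..n}"
        then have "i - 1 < n" "Suc (i - 1) = i" by auto
        then show "d i = c i" using fun_cong[OF pp, of "i - 1"] by (simp add: p_def)
      qed (use c d in auto)
    qed
  qed
  then show ?thesis by (rule exI[of "\<lambda>\<epsilon>. is_basis R A n \<epsilon>" \<epsilon>])
qed

section \<open>Closure data and homomorphisms of the polynomial invariants\<close>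

lemma (in mono_alg) ev_smult: "r \<in> carrier R \<Longrightarrow> g \<in> carrier (UP R) \<Longrightarrow>
  ev (r \<odot>\<^bsub>UP R\<^esub> g) = r \<odot>\<^bsub>A\<^esub> ev g"
proof -
  assume r: "r \<in> carrier R" and g: "g \<in> carrier (UP R)"
  have "ev (r \<odot>\<^bsub>UP R\<^esub> g) = ev (up_ring.monom (UP R) r 0) \<otimes>\<^bsub>A\<^esub> ev g"
    unfolding UPR.monom_mult_is_smult[OF r g, symmetric]
    by (rule ring_hom_mult[OF ev_hom UPR.monom_closed[OF r] g])
  also have "\<dots> = r \<odot>\<^bsub>A\<^esub> (\<one>\<^bsub>A\<^esub> \<otimes>\<^bsub>A\<^esub> ev g)"
    unfolding ev_monom[OF r] A.nat_pow_0 by (rule A.smult_assoc2[OF r A.one_closed ev_closed[OF g]])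
  finally show ?thesis using g by simp
qed

text \<open>A linear map out of a free module may be prescribed on the basis, here by preimages of the basis
  vectors.\<close>

lemma (in mono_alg) linear_section:
  obtains s where "s \<in> carrier A \<rightarrow> carrier (UP R)"
    and "\<And>x y. x \<in> carrier A \<Longrightarrow> y \<in> carrier A \<Longrightarrow> s (x \<oplus>\<^bsub>A\<^esub> y) = s x \<oplus>\<^bsub>UP R\<^esub> s y"
    and "\<And>r x. r \<in> carrier R \<Longrightarrow> x \<in> carrier A \<Longrightarrow> s (r \<odot>\<^bsub>A\<^esub> x) = r \<odot>\<^bsub>UP R\<^esub> s x"
    and "\<And>x. x \<in> carrier A \<Longrightarrow> ev (s x) = x"
proof -
  have "\<forall>i\<in>{1..n}. \<exists>g. g \<in> carrier (UP R) \<and> ev g = \<epsilon> i"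
  proof
    fix i assume "i \<in> {1..n}"
    from ev_surj[OF eps_closed[OF this]]
    show "\<exists>g. g \<in> carrier (UP R) \<and> ev g = \<epsilon> i" unfolding Bex_def .
  qed
  from bchoice[OF this] obtain g where g: "\<forall>i\<in>{1..n}. g i \<in> carrier (UP R) \<and> ev (g i) = \<epsilon> i" ..
  interpret e: ring_hom_cring "UP R" A ev
    by (rule ring_hom_cringI[OF UPR.UP_cring A.M_cring ev_hom])
  have gc: "g i \<in> carrier (UP R)" if "i \<in> {1..n}" for i using g that by blast
  define s where "s x = (\<Oplus>\<^bsub>UP R\<^esub>i\<in>{1..n}. crd x i \<odot>\<^bsub>UP R\<^esub> g i)" for x
  have cl: "(\<lambda>i. crd x i \<odot>\<^bsub>UP R\<^esub> g i) \<in> {1..n} \<rightarrow> carrier (UP R)" if "x \<in> carrier A" for x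
    using that gc by auto
  show thesis
  proof (rule that[of s])
    show "s \<in> carrier A \<rightarrow> carrier (UP R)"
      unfolding s_def using cl by (auto intro!: UPR.P.finsum_closed)
    fix x assume x: "x \<in> carrier A"
    show "s (x \<oplus>\<^bsub>A\<^esub> y) = s x \<oplus>\<^bsub>UP R\<^esub> s y" if y: "y \<in> carrier A" for y
    proof -
      have "s (x \<oplus>\<^bsub>A\<^esub> y) = (\<Oplus>\<^bsub>UP R\<^esub>i\<in>{1..n}. crd x i \<odot>\<^bsub>UP R\<^esub> g i \<oplus>\<^bsub>UP R\<^esub> crd y i \<odot>\<^bsub>UP R\<^esub> g i)"
        unfolding s_def
      proof (rule UPR.P.finsum_cong'[OF refl])
        fix i assume i: "i \<in> {1..n}"
        show "crd (x \<oplus>\<^bsub>A\<^esub> y) i \<odot>\<^bsub>UP R\<^esub> g i = crd x i \<odot>\<^bsub>UP R\<^esub> g i \<oplus>\<^bsub>UP R\<^esub> crd y i \<odot>\<^bsub>UP R\<^esub> g i"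
          unfolding crd_add[OF x y i]
          by (rule UPR.UP_smult_l_distr[OF crd_closed[OF x i] crd_closed[OF y i] gc[OF i]])
      qed (use cl[OF x] cl[OF y] in auto)
      also have "\<dots> = s x \<oplus>\<^bsub>UP R\<^esub> s y"
        unfolding s_def by (rule UPR.P.finsum_addf[OF cl[OF x] cl[OF y]])
      finally show ?thesis .
    qed
    show "s (r \<odot>\<^bsub>A\<^esub> x) = r \<odot>\<^bsub>UP R\<^esub> s x" if r: "r \<in> carrier R" for r
    proof -
      have "r \<odot>\<^bsub>UP R\<^esub> s x = (\<Oplus>\<^bsub>UP R\<^esub>i\<in>{1..n}. r \<odot>\<^bsub>UP R\<^esub> (crd x i \<odot>\<^bsub>UP R\<^esub> g i))"
        unfolding s_def by (rule module.finsum_smult_ldistr[OF algebra.module[OF UPR.UP_algebra] _ r cl[OF x]]) simp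
      also have "\<dots> = s (r \<odot>\<^bsub>A\<^esub> x)"
        unfolding s_def
      proof (rule UPR.P.finsum_cong'[OF refl])
        fix i assume i: "i \<in> {1..n}"
        show "r \<odot>\<^bsub>UP R\<^esub> (crd x i \<odot>\<^bsub>UP R\<^esub> g i) = crd (r \<odot>\<^bsub>A\<^esub> x) i \<odot>\<^bsub>UP R\<^esub> g i"
          unfolding crd_smult[OF r x i]
          by (rule UPR.UP_smult_assoc1[OF r crd_closed[OF x i] gc[OF i], symmetric])
      qed (use cl[of "r \<odot>\<^bsub>A\<^esub> x"] r x in auto)
      finally show ?thesis ..
    qed
    have "ev (s x) = (\<Oplus>\<^bsub>A\<^esub>i\<in>{1..n}. ev (crd x i \<odot>\<^bsub>UP R\<^esub> g i))"
      unfolding s_def using cl[OF x] by (simp add: comp_def)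
    also have "\<dots> = (\<Oplus>\<^bsub>A\<^esub>i\<in>{1..n}. crd x i \<odot>\<^bsub>A\<^esub> \<epsilon> i)"
    proof (rule A.M.finsum_cong'[OF refl])
      fix i assume i: "i \<in> {1..n}"
      then show "ev (crd x i \<odot>\<^bsub>UP R\<^esub> g i) = crd x i \<odot>\<^bsub>A\<^esub> \<epsilon> i"
        using x g by (simp add: ev_smult)
    qed (use x in auto)
    also have "\<dots> = x" using crd_spec(2)[OF x] ..
    finally show "ev (s x) = x" .
  qed
qed

lemma alg_homI:
  assumes "h \<in> ring_hom A B" "h \<in> extensional (carrier A)"
    and "\<And>r x. r \<in> carrier R \<Longrightarrow> x \<in> carrier A \<Longrightarrow> h (r \<odot>\<^bsub>A\<^esub> x) = r \<odot>\<^bsub>B\<^esub> h x"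
  shows "h \<in> alg_hom R A B"
  using assms unfolding alg_hom_def by blast

lemma alg_homD:
  assumes "h \<in> alg_hom R A B"
  shows "h \<in> ring_hom A B" "h \<in> extensional (carrier A)"
    "\<And>r x. r \<in> carrier R \<Longrightarrow> x \<in> carrier A \<Longrightarrow> h (r \<odot>\<^bsub>A\<^esub> x) = r \<odot>\<^bsub>B\<^esub> h x"
  using assms unfolding alg_hom_def by blast+

text \<open>The basis is the one that the definition of the characteristic polynomial selects: then
  \<open>chi\<close> is that polynomial.\<close>

locale closure = mono_alg R A n \<epsilon> a
  for R :: "('r, 'x) ring_scheme" (structure) and A :: "('r, 'a, 'y) module_scheme" (structure)
    and n :: nat and \<epsilon> :: "nat \<Rightarrow> 'a" and a :: 'a +
  fixes G :: "(nat \<Rightarrow> nat) set"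
  assumes G: "subgroup G (sym_group n)" and eps: "\<epsilon> = (SOME \<epsilon>. is_basis R A n \<epsilon>)"
begin

sublocale pr: tpow_map R "UP R" A n ev
proof (intro tpow_map.intro tpow.intro tpow_map_axioms.intro UPR.UP_algebra A.algebra_axioms)
  show "ev \<in> carrier (UP R) \<rightarrow> carrier A" by simp
qed (simp_all add: ring_hom_add[OF ev_hom] ev_smult)

abbreviation "IU \<equiv> tpower_inv R (UP R) n G"
abbreviation "IA \<equiv> tpower_inv R A n G"
abbreviation "PU \<equiv> tpower R (UP R) n"
abbreviation "PA \<equiv> tpower R A n"
abbreviation "x \<equiv> up_ring.monom (UP R) \<one>\<^bsub>R\<^esub> 1"

lemma x_closed: "x \<in> carrier (UP R)" by simp

lemma ev_x: "ev x = a" by (simp add: ev_monom)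

lemma G_perm: "g \<in> G \<Longrightarrow> g permutes {1..n}"
  using subgroup.subset[OF G] by (auto simp: sym_group_def)

lemma IU_iff: "z \<in> carrier IU \<longleftrightarrow> z \<in> carrier PU \<and> (\<forall>g\<in>G. perm_act g z = z)"
  by (rule invariants_carrier)

lemma IA_iff: "z \<in> carrier IA \<longleftrightarrow> z \<in> carrier PA \<and> (\<forall>g\<in>G. perm_act g z = z)"
  by (rule invariants_carrier)

lemma IU_PU: "z \<in> carrier IU \<Longrightarrow> z \<in> carrier PU" by (simp add: IU_iff)

lemma IA_PA: "z \<in> carrier IA \<Longrightarrow> z \<in> carrier PA" by (simp add: IA_iff)

lemma IU_algebra: "algebra R IU"
  by (rule invariants_algebra[OF pr.C.T.algebra_axioms])
     (use G_perm pr.C.perm_act_hom pr.C.perm_act_smult in auto)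

lemma IA_algebra: "algebra R IA"
  by (rule invariants_algebra[OF pr.D.T.algebra_axioms])
     (use G_perm pr.D.perm_act_hom pr.D.perm_act_smult in auto)

lemma char_coeff_chi:
  assumes b: "b \<in> carrier A"
  shows "char_coeff R A n k b = (\<ominus>\<^bsub>R\<^esub> \<one>\<^bsub>R\<^esub>) [^]\<^bsub>R\<^esub> k \<otimes>\<^bsub>R\<^esub> chi b (n - k)"
proof -
  have "char_poly_mult R A n b = chi b"
    unfolding char_poly_mult_def Let_def eps[symmetric] chi_def mm_def ..
  then show ?thesis unfolding char_coeff_def using chi_closed[OF b] by simp
qed

lemma hT_hom: "pr.hT \<in> ring_hom PU PA" by (rule pr.map_ring_hom[OF ev_hom])

lemma hT_IA: "z \<in> carrier IU \<Longrightarrow> pr.hT z \<in> carrier IA"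
  unfolding IU_iff IA_iff using pr.map_closed pr.map_perm_act[OF G_perm] by metis

lemma projection_eq: "z \<in> carrier IU \<Longrightarrow> projection R A n G a z = pr.hT z"
  by (simp add: projection_def)

lemma projection_hom: "projection R A n G a \<in> alg_hom R IU IA"
proof (rule alg_homI)
  interpret IU: algebra R IU by (rule IU_algebra)
  show "projection R A n G a \<in> ring_hom IU IA"
  proof (rule ring_hom_memI)
    fix y z assume yz: "y \<in> carrier IU" "z \<in> carrier IU"
    note P = IU_PU[OF yz(1)] IU_PU[OF yz(2)]
    show "projection R A n G a y \<in> carrier IA"
      unfolding projection_eq[OF yz(1)] by (rule hT_IA[OF yz(1)])
    show "projection R A n G a (y \<otimes>\<^bsub>IU\<^esub> z) = projection R A n G a y \<otimes>\<^bsub>IA\<^esub> projection R A n G a z"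
      unfolding projection_eq[OF yz(1)] projection_eq[OF yz(2)] projection_eq[OF IU.m_closed[OF yz, unfolded invariants_simps]]
        invariants_simps by (rule ring_hom_mult[OF hT_hom P])
    show "projection R A n G a (y \<oplus>\<^bsub>IU\<^esub> z) = projection R A n G a y \<oplus>\<^bsub>IA\<^esub> projection R A n G a z"
      unfolding projection_eq[OF yz(1)] projection_eq[OF yz(2)] projection_eq[OF IU.a_closed[OF yz, unfolded invariants_simps]]
        invariants_simps by (rule ring_hom_add[OF hT_hom P])
  next
    show "projection R A n G a \<one>\<^bsub>IU\<^esub> = \<one>\<^bsub>IA\<^esub>"
      unfolding projection_eq[OF IU.one_closed[unfolded invariants_simps]] invariants_simps by (rule ring_hom_one[OF hT_hom])
  qed
  show "projection R A n G a \<in> extensional (carrier IU)" by (simp add: projection_def)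
  fix r z assume r: "r \<in> carrier R" and z: "z \<in> carrier IU"
  show "projection R A n G a (r \<odot>\<^bsub>IU\<^esub> z) = r \<odot>\<^bsub>IA\<^esub> projection R A n G a z"
    unfolding projection_eq[OF z] projection_eq[OF IU.smult_closed[OF r z, unfolded invariants_simps]] invariants_simps
    by (rule pr.map_smult[OF r IU_PU[OF z]])
qed

lemma elem_sym_IU: "g \<in> carrier (UP R) \<Longrightarrow> elem_sym R (UP R) n k g \<in> carrier IU"
  unfolding IU_iff using pr.C.elem_sym_closed pr.C.elem_sym_invariant[OF G_perm] by blast

lemma hT_elem_sym: "g \<in> carrier (UP R) \<Longrightarrow> pr.hT (elem_sym R (UP R) n k g) = elem_sym R A n k (ev g)"
  by (rule pr.map_elem_sym[OF ev_hom])

lemma pull_back_eq: "z \<in> carrier IU \<Longrightarrow> pull_back R A n G a \<phi> z = \<phi> (pr.hT z)"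
  by (simp add: pull_back_def compose_def projection_eq)

lemma pull_back_poly_homs:
  assumes "\<phi> \<in> closure_data R A n G"
  shows "pull_back R A n G a \<phi> \<in> poly_homs R A n G a"
proof -
  have \<phi>: "\<phi> \<in> alg_hom R IA (self_alg R)"
    and s: "\<And>b k. b \<in> carrier A \<Longrightarrow> k \<in> {1..n} \<Longrightarrow> \<phi> (elem_sym R A n k b) = char_coeff R A n k b"
    using assms unfolding closure_data_def by blast+
  note hom = alg_homD(1)[OF \<phi>] and lin = alg_homD(3)[OF \<phi>]
  note pr = alg_homD(1)[OF projection_hom] and prl = alg_homD(3)[OF projection_hom]
  interpret IU: algebra R IU by (rule IU_algebra)
  have eq: "pull_back R A n G a \<phi> z = (\<phi> \<circ> projection R A n G a) z" if "z \<in> carrier IU" for z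
    using that by (simp add: pull_back_def compose_def)
  have "\<phi> \<circ> projection R A n G a \<in> ring_hom IU (self_alg R)" by (rule ring_hom_trans[OF pr hom])
  then have "pull_back R A n G a \<phi> \<in> ring_hom IU (self_alg R)"
    using IU.m_closed IU.a_closed IU.one_closed unfolding ring_hom_def by (simp add: eq Pi_def)
  moreover have "pull_back R A n G a \<phi> \<in> extensional (carrier IU)"
    by (simp add: pull_back_def compose_def)
  moreover have "pull_back R A n G a \<phi> (r \<odot>\<^bsub>IU\<^esub> z) = r \<odot>\<^bsub>self_alg R\<^esub> pull_back R A n G a \<phi> z"
    if "r \<in> carrier R" "z \<in> carrier IU" for r z
    unfolding eq[OF that(2)] eq[OF IU.smult_closed[OF that]] comp_apply prl[OF that]
    by (rule lin[OF that(1) ring_hom_closed[OF pr that(2)]])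
  ultimately have "pull_back R A n G a \<phi> \<in> alg_hom R IU (self_alg R)" by (rule alg_homI)
  moreover have "pull_back R A n G a \<phi> (elem_sym R (UP R) n k x) = char_coeff R A n k a" if "k \<in> {1..n}" for k
    unfolding pull_back_eq[OF elem_sym_IU[OF x_closed]] hT_elem_sym[OF x_closed] ev_x
    by (rule s[OF a_closed' that])
  ultimately show ?thesis unfolding poly_homs_def by blast
qed

text \<open>The ring over which the characteristic polynomial of \<open>a\<close> splits: \<open>i\<close> maps the \<open>e\<^sub>k(x)\<close> to
  \<open>j (s\<^sub>k(a))\<close>, since these elements are invariant.\<close>

lemma benign_splitting:
  assumes benign: "benign R n G" and \<psi>: "\<psi> \<in> poly_homs R A n G a"
  obtains Q :: "((nat \<times> 'r) list, ((nat \<times> 'r) list \<times> 'r \<Rightarrow> (nat \<times> 'r) list) set) module"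
    and i :: "((nat \<Rightarrow> nat \<Rightarrow> 'r) \<Rightarrow> 'r) set \<Rightarrow> _" and j :: "'r \<Rightarrow> _"
  where "cring Q" "i \<in> ring_hom PU Q" "j \<in> ring_hom R Q" "inj_on j (carrier R)"
    "\<forall>z\<in>carrier IU. i z = j (\<psi> z)"
proof -
  obtain e :: "(nat \<times> 'r) list \<Rightarrow> ((nat \<Rightarrow> nat \<Rightarrow> 'r) \<Rightarrow> 'r) set" where e: "carrier PU \<subseteq> range e"
    using tpower_UP_enumeration[OF A.R_cring, of n] by (elim exE)
  have inv: "carrier IU = {z \<in> carrier PU. \<forall>g\<in>G. perm_act g z = z}"
    using IU_iff by blast
  have psi: "\<psi> \<in> alg_hom R IU (self_alg R)" using \<psi> unfolding poly_homs_def by blast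
  have "\<exists>(Q :: ((nat \<times> 'r) list, ((nat \<times> 'r) list \<times> 'r \<Rightarrow> (nat \<times> 'r) list) set) module) i j.
    cring Q \<and> i \<in> ring_hom PU Q \<and> j \<in> ring_hom R Q \<and> inj_on j (carrier R)
    \<and> (\<forall>z\<in>carrier IU. i z = j (\<psi> z))"
    by (rule benign_extension[OF benign pr.C.T.algebra_axioms G _ _ _ _ inv _ _ _ _ psi e])
       (simp_all add: pr.C.perm_act_hom G_perm pr.C.perm_act_smult pr.C.perm_act_id
          pr.C.perm_act_comp)
  then show thesis by (elim exE conjE) (rule that)
qed

text \<open>An invariant preimage is obtained from the map of tensor powers that a linear section induces,
  which commutes with permutations.\<close>

lemma hT_surj_invariants:
  assumes "z \<in> carrier IA"
  shows "\<exists>y\<in>carrier IU. pr.hT y = z"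
proof (rule linear_section)
  fix s assume s: "s \<in> carrier A \<rightarrow> carrier (UP R)"
    "\<And>y z. y \<in> carrier A \<Longrightarrow> z \<in> carrier A \<Longrightarrow> s (y \<oplus>\<^bsub>A\<^esub> z) = s y \<oplus>\<^bsub>UP R\<^esub> s z"
    "\<And>r y. r \<in> carrier R \<Longrightarrow> y \<in> carrier A \<Longrightarrow> s (r \<odot>\<^bsub>A\<^esub> y) = r \<odot>\<^bsub>UP R\<^esub> s y"
    and ev_s: "\<And>y. y \<in> carrier A \<Longrightarrow> ev (s y) = y"
  interpret sec: tpow_map R A "UP R" n s
    by (intro tpow_map.intro tpow.intro tpow_map_axioms.intro UPR.UP_algebra A.algebra_axioms s)
  have "sec.hT z \<in> carrier IU"
    unfolding IU_iff
  proof (intro conjI ballI)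
    show "sec.hT z \<in> carrier PU" by (rule sec.map_closed[OF IA_PA[OF assms]])
    fix g assume g: "g \<in> G"
    then have "perm_act g z = z" using assms IA_iff by blast
    then show "perm_act g (sec.hT z) = sec.hT z"
      using sec.map_perm_act[OF G_perm[OF g] IA_PA[OF assms]] by simp
  qed
  moreover have "pr.hT (sec.hT z) = z"
    by (rule tpower_map_retract[OF sec.tpow_map_axioms pr.tpow_map_axioms _ IA_PA[OF assms]])
       (rule ev_s)
  ultimately show ?thesis by (rule bexI[rotated])
qed

lemma pull_back_inj: "inj_on (pull_back R A n G a) (closure_data R A n G)"
proof (rule inj_onI)
  fix \<phi> \<phi>' assume \<phi>: "\<phi> \<in> closure_data R A n G" "\<phi>' \<in> closure_data R A n G"
    and eq: "pull_back R A n G a \<phi> = pull_back R A n G a \<phi>'"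
  have alg: "\<phi> \<in> alg_hom R IA (self_alg R)" "\<phi>' \<in> alg_hom R IA (self_alg R)"
    using \<phi> unfolding closure_data_def by blast+
  show "\<phi> = \<phi>'"
  proof (rule extensionalityI[OF alg_homD(2)[OF alg(1)] alg_homD(2)[OF alg(2)]])
    fix z assume "z \<in> carrier IA"
    then obtain y where y: "y \<in> carrier IU" "pr.hT y = z" using hT_surj_invariants by blast
    show "\<phi> z = \<phi>' z"
      using fun_cong[OF eq, of y] unfolding pull_back_eq[OF y(1)] y(2) .
  qed
qed

text \<open>The candidate is \<open>\<psi>\<close> after the section of tensor powers.  A priori this map is only linear and
  depends on the section; after applying the injective map \<open>j\<close> it agrees with \<open>i\<close> on any
  representative, which gives both multiplicativity and the values on \<open>e\<^sub>k(b)\<close>.\<close>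

lemma pull_back_surj:
  assumes benign: "benign R n G" and \<psi>: "\<psi> \<in> poly_homs R A n G a"
  shows "\<exists>\<phi>\<in>closure_data R A n G. pull_back R A n G a \<phi> = \<psi>"
proof (rule linear_section, rule benign_splitting[OF benign \<psi>])
  fix s assume s: "s \<in> carrier A \<rightarrow> carrier (UP R)"
    "\<And>y z. y \<in> carrier A \<Longrightarrow> z \<in> carrier A \<Longrightarrow> s (y \<oplus>\<^bsub>A\<^esub> z) = s y \<oplus>\<^bsub>UP R\<^esub> s z"
    "\<And>r y. r \<in> carrier R \<Longrightarrow> y \<in> carrier A \<Longrightarrow> s (r \<odot>\<^bsub>A\<^esub> y) = r \<odot>\<^bsub>UP R\<^esub> s y"
    and ev_s: "\<And>y. y \<in> carrier A \<Longrightarrow> ev (s y) = y"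
  fix Q :: "((nat \<times> 'r) list, ((nat \<times> 'r) list \<times> 'r \<Rightarrow> (nat \<times> 'r) list) set) module"
    and i :: "((nat \<Rightarrow> nat \<Rightarrow> 'r) \<Rightarrow> 'r) set \<Rightarrow> ((nat \<times> 'r) list \<times> 'r \<Rightarrow> (nat \<times> 'r) list) set"
    and j :: "'r \<Rightarrow> ((nat \<times> 'r) list \<times> 'r \<Rightarrow> (nat \<times> 'r) list) set"
  assume Q: "cring Q" and i_hom: "i \<in> ring_hom PU Q" and j_hom: "j \<in> ring_hom R Q"
    and j_inj: "inj_on j (carrier R)" and ij0: "\<forall>z\<in>carrier IU. i z = j (\<psi> z)"
  note ij = bspec[OF ij0]
  interpret Q: cring Q by (rule Q)
  interpret i: ring_hom_cring PU Q i by (rule ring_hom_cringI[OF pr.C.T.M_cring Q i_hom])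
  interpret IU: algebra R IU by (rule IU_algebra)
  interpret IA: algebra R IA by (rule IA_algebra)
  interpret sec: tpow_map R A "UP R" n s
    by (intro tpow_map.intro tpow.intro tpow_map_axioms.intro UPR.UP_algebra A.algebra_axioms s)
  have psi: "\<psi> \<in> alg_hom R IU (self_alg R)"
    and psi_e: "\<And>k. k \<in> {1..n} \<Longrightarrow> \<psi> (elem_sym R (UP R) n k x) = char_coeff R A n k a"
    using \<psi> unfolding poly_homs_def by blast+
  note psi_hom = alg_homD(1)[OF psi] and psi_lin = alg_homD(3)[OF psi]
  have psi_closed: "\<psi> z \<in> carrier R" if "z \<in> carrier IU" for z
    using ring_hom_closed[OF psi_hom that] by simp
  \<comment> \<open>the images of the variables, which split the characteristic polynomial of \<open>a\<close>\<close>
  define q where "q l = i (pr.C.emb x l)" for l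
  have emb: "pr.C.emb g l \<in> carrier PU" if "l \<in> {1..n}" "g \<in> carrier (UP R)" for g l
    by (rule pr.C.emb_closed[OF that])
  have i_esym: "i (elem_sym R (UP R) n k g) = esym Q n k (\<lambda>l. i (pr.C.emb g l))"
    if g: "g \<in> carrier (UP R)" for k g
    unfolding elem_sym_eq by (rule i.esym_hom[OF emb[OF _ g]])
  obtain h :: "((((nat \<times> 'r) list \<times> 'r \<Rightarrow> (nat \<times> 'r) list) set \<Rightarrow>\<^sub>0 nat) \<Rightarrow>\<^sub>0 int)
      \<Rightarrow> ((nat \<times> 'r) list \<times> 'r \<Rightarrow> (nat \<times> 'r) list) set" and lift
    where h: "class_hom Q h" and lift: "\<And>x. x \<in> carrier Q \<Longrightarrow> h (lift x) = x"
    using Q.obtain_lift by blast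
  interpret sp: split_alg R A n \<epsilon> a Q h lift j q
  proof (intro split_alg.intro mono_alg_axioms h split_alg_axioms.intro lift j_hom)
    show "q l \<in> carrier Q" if "l \<in> {1..n}" for l
      unfolding q_def by (rule i.hom_closed[OF emb[OF that x_closed]])
    fix k assume k: "k \<in> {1..n}"
    have "esym Q n k q = i (elem_sym R (UP R) n k x)"
      unfolding q_def by (rule i_esym[OF x_closed, symmetric])
    also have "\<dots> = j (\<psi> (elem_sym R (UP R) n k x))" by (rule ij[OF elem_sym_IU[OF x_closed]])
    also have "\<dots> = j ((\<ominus>\<^bsub>R\<^esub> \<one>\<^bsub>R\<^esub>) [^]\<^bsub>R\<^esub> k \<otimes>\<^bsub>R\<^esub> chi a (n - k))"
      unfolding psi_e[OF k] char_coeff_chi[OF a_closed'] ..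
    finally show "esym Q n k q = j ((\<ominus>\<^bsub>R\<^esub> \<one>\<^bsub>R\<^esub>) [^]\<^bsub>R\<^esub> k \<otimes>\<^bsub>R\<^esub> chi a (n - k))" .
  qed
  have i_const: "i (r \<odot>\<^bsub>PU\<^esub> \<one>\<^bsub>PU\<^esub>) = j r" if r: "r \<in> carrier R" for r
  proof -
    have "\<psi> (r \<odot>\<^bsub>IU\<^esub> \<one>\<^bsub>IU\<^esub>) = r"
      unfolding psi_lin[OF r IU.one_closed] ring_hom_one[OF psi_hom] using r by simp
    then show ?thesis
      using ij[OF IU.smult_closed[OF r IU.one_closed]] unfolding invariants_simps by simp
  qed
  have i_smult: "i (r \<odot>\<^bsub>PU\<^esub> z) = j r \<otimes>\<^bsub>Q\<^esub> i z" if r: "r \<in> carrier R" and z: "z \<in> carrier PU" for r z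
  proof -
    have "r \<odot>\<^bsub>PU\<^esub> z = (r \<odot>\<^bsub>PU\<^esub> \<one>\<^bsub>PU\<^esub>) \<otimes>\<^bsub>PU\<^esub> z"
      unfolding pr.C.T.smult_assoc2[OF r pr.C.T.one_closed z] pr.C.T.l_one[OF z] ..
    then have "i (r \<odot>\<^bsub>PU\<^esub> z) = i (r \<odot>\<^bsub>PU\<^esub> \<one>\<^bsub>PU\<^esub>) \<otimes>\<^bsub>Q\<^esub> i z"
      using i.hom_mult[OF pr.C.T.smult_closed[OF r pr.C.T.one_closed] z] by simp
    then show ?thesis unfolding i_const[OF r] .
  qed
  have i_emb: "i (pr.C.emb g l) = sp.evQ l g" if l: "l \<in> {1..n}" and g: "g \<in> carrier (UP R)" for l g
  proof (rule sp.preQ.UP_hom_unique[where Phi = "\<lambda>g. i (pr.C.emb g l)" and s = "q l", OF _ _ _ _ _ _ g])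
    have "(i \<circ> (\<lambda>g. pr.C.emb g l)) \<in> ring_hom (UP R) Q"
      by (rule ring_hom_trans[OF pr.C.emb_hom[OF l] i_hom])
    then show "ring_hom_cring (UP R) Q (\<lambda>g. i (pr.C.emb g l))"
      by (intro ring_hom_cringI UPR.UP_cring Q) (simp add: comp_def)
    show "ring_hom_cring (UP R) Q (sp.evQ l)"
      by (intro ring_hom_cringI UPR.UP_cring Q sp.preQ.eval_ring_hom sp.q_closed l)
    show "i (pr.C.emb (up_ring.monom (UP R) \<one>\<^bsub>R\<^esub> (Suc 0)) l) = q l"
      by (simp add: q_def One_nat_def)
    show "sp.evQ l (up_ring.monom (UP R) \<one>\<^bsub>R\<^esub> (Suc 0)) = q l"
      using sp.preQ.eval_monom1[OF sp.q_closed[OF l]] by (simp add: One_nat_def)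
    show "q l \<in> carrier Q" by (rule sp.q_closed[OF l])
    fix r assume r: "r \<in> carrier R"
    show "sp.evQ l (up_ring.monom (UP R) r 0) = j r"
      by (rule sp.preQ.eval_const[OF sp.q_closed[OF l] r])
    have "up_ring.monom (UP R) r 0 = r \<odot>\<^bsub>UP R\<^esub> \<one>\<^bsub>UP R\<^esub>"
      using UPR.monom_mult_is_smult[OF r UPR.P.one_closed] UPR.monom_closed[OF r, of 0] by simp
    then have "pr.C.emb (up_ring.monom (UP R) r 0) l = r \<odot>\<^bsub>PU\<^esub> \<one>\<^bsub>PU\<^esub>"
      using pr.C.emb_smult[OF l r UPR.P.one_closed] ring_hom_one[OF pr.C.emb_hom[OF l]] by simp
    then show "i (pr.C.emb (up_ring.monom (UP R) r 0) l) = j r" using i_const[OF r] by simp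
  qed
  have evQ_section: "sp.evQ l (s (ev g)) = sp.evQ l g" if l: "l \<in> {1..n}" and g: "g \<in> carrier (UP R)" for l g
  proof -
    interpret E: ring_hom_cring "UP R" Q "sp.evQ l"
      by (intro ring_hom_cringI UPR.UP_cring Q sp.preQ.eval_ring_hom sp.q_closed l)
    interpret e: ring_hom_cring "UP R" A ev
      by (rule ring_hom_cringI[OF UPR.UP_cring A.M_cring ev_hom])
    have sg: "s (ev g) \<in> carrier (UP R)" by (rule sec.h_in[OF ev_closed[OF g]])
    have "ev (s (ev g) \<ominus>\<^bsub>UP R\<^esub> g) = ev (s (ev g)) \<ominus>\<^bsub>A\<^esub> ev g"
      unfolding a_minus_def using sg g by simp
    then have "ev (s (ev g) \<ominus>\<^bsub>UP R\<^esub> g) = \<zero>\<^bsub>A\<^esub>"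
      using ev_s[OF ev_closed[OF g]] ev_closed[OF g] by (simp add: a_minus_def A.M.r_neg)
    then have "sp.evQ l (s (ev g) \<ominus>\<^bsub>UP R\<^esub> g) = \<zero>\<^bsub>Q\<^esub>"
      by (rule sp.roots_of_relations[OF UPR.P.minus_closed[OF sg g] _ l])
    moreover have "sp.evQ l (s (ev g) \<ominus>\<^bsub>UP R\<^esub> g) = sp.evQ l (s (ev g)) \<ominus>\<^bsub>Q\<^esub> sp.evQ l g"
      unfolding a_minus_def using sg g by simp
    ultimately show ?thesis
      using Q.minus_zero_iff[OF E.hom_closed[OF sg] E.hom_closed[OF g]] by simp
  qed
  have i_pure: "i (pr.C.pt t) = (\<Otimes>\<^bsub>Q\<^esub>l\<in>{1..n}. sp.evQ l (t l))" if t: "t \<in> carrier pr.C.M" for t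
  proof -
    have tl: "t l \<in> carrier (UP R)" if "l \<in> {1..n}" for l
      using t that by (auto simp: tuples_simps)
    have "i (pr.C.pt t) = (\<Otimes>\<^bsub>Q\<^esub>l\<in>{1..n}. i (pr.C.emb (t l) l))"
      unfolding pr.C.pure_eq_prod_emb[OF t]
      by (subst i.hom_finprod) (auto intro!: emb tl simp: comp_def)
    also have "\<dots> = (\<Otimes>\<^bsub>Q\<^esub>l\<in>{1..n}. sp.evQ l (t l))"
      using i_emb tl i.hom_closed[OF emb] by (intro Q.finprod_cong' refl) (auto simp flip: i_emb)
    finally show ?thesis .
  qed
  \<comment> \<open>The section is not a left inverse of the evaluation on \<open>R[x]\<close>, but the difference is killed in \<open>Q\<close>.\<close>
  have key: "i (sec.hT (pr.hT z)) = i z" if "z \<in> carrier PU" for z using that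
  proof (induction z rule: pr.C.tpow_induct)
    case zero
    show ?case by (simp only: pr.map_zero sec.map_zero)
  next
    case (pure r t)
    have tl: "t l \<in> carrier (UP R)" if "l \<in> {1..n}" for l
      using pure(2) that by (auto simp: tuples_simps)
    have ht: "pr.ht t \<in> carrier pr.D.M" by (rule pr.ht_closed[OF pure(2)])
    have pt: "pr.C.pt t \<in> carrier PU" by (rule pr.C.pt_closed[OF pure(2)])
    have st: "sec.ht (pr.ht t) \<in> carrier pr.C.M" by (rule sec.ht_closed[OF ht])
    have "i (pr.C.pt (sec.ht (pr.ht t))) = (\<Otimes>\<^bsub>Q\<^esub>l\<in>{1..n}. sp.evQ l (sec.ht (pr.ht t) l))"
      by (rule i_pure[OF st])
    also have "\<dots> = (\<Otimes>\<^bsub>Q\<^esub>l\<in>{1..n}. sp.evQ l (t l))"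
    proof (rule Q.finprod_cong'[OF refl])
      show "(\<lambda>l. sp.evQ l (t l)) \<in> {1..n} \<rightarrow> carrier Q"
        using i.hom_closed[OF emb] tl by (auto simp flip: i_emb)
      fix l assume l: "l \<in> {1..n}"
      then have "sec.ht (pr.ht t) l = s (ev (t l))" by simp
      then show "sp.evQ l (sec.ht (pr.ht t) l) = sp.evQ l (t l)" using evQ_section[OF l tl[OF l]] by simp
    qed
    also have "\<dots> = i (pr.C.pt t)" by (rule i_pure[OF pure(2), symmetric])
    finally have "i (sec.hT (pr.hT (pr.C.pt t))) = i (pr.C.pt t)"
      unfolding pr.map_pure[OF pure(2)] sec.map_pure[OF ht] .
    then show ?case
      unfolding pr.map_smult[OF pure(1) pt] sec.map_smult[OF pure(1) pr.map_closed[OF pt]]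
        i_smult[OF pure(1) pt] i_smult[OF pure(1) sec.map_closed[OF pr.map_closed[OF pt]]] by simp
  next
    case (add y z)
    then show ?case
      by (simp only: pr.map_add sec.map_add pr.map_closed sec.map_closed i.hom_add)
  qed
  have S_IU: "sec.hT z \<in> carrier IU" if z: "z \<in> carrier IA" for z
    unfolding IU_iff
  proof (intro conjI ballI)
    show "sec.hT z \<in> carrier PU" by (rule sec.map_closed[OF IA_PA[OF z]])
    fix g assume g: "g \<in> G"
    then have "perm_act g z = z" using z IA_iff by blast
    then show "perm_act g (sec.hT z) = sec.hT z"
      using sec.map_perm_act[OF G_perm[OF g] IA_PA[OF z]] by simp
  qed
  have retract: "pr.hT (sec.hT z) = z" if "z \<in> carrier PA" for z
    by (rule tpower_map_retract[OF sec.tpow_map_axioms pr.tpow_map_axioms _ that]) (rule ev_s)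
  have psi_section: "\<psi> (sec.hT (pr.hT z)) = \<psi> z" if z: "z \<in> carrier IU" for z
  proof (rule inj_onD[OF j_inj])
    have S: "sec.hT (pr.hT z) \<in> carrier IU" by (rule S_IU[OF hT_IA[OF z]])
    show "j (\<psi> (sec.hT (pr.hT z))) = j (\<psi> z)"
      using key[OF IU_PU[OF z]] ij[OF S] ij[OF z] by simp
    show "\<psi> (sec.hT (pr.hT z)) \<in> carrier R" "\<psi> z \<in> carrier R" by (rule psi_closed[OF S], rule psi_closed[OF z])
  qed
  define \<phi> where "\<phi> = (\<lambda>z\<in>carrier IA. \<psi> (sec.hT z))"
  have phi_eq: "\<phi> z = \<psi> (sec.hT z)" if "z \<in> carrier IA" for z using that by (simp add: \<phi>_def)
  have phi_hT: "\<phi> (pr.hT z) = \<psi> z" if "z \<in> carrier IU" for z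
    unfolding phi_eq[OF hT_IA[OF that]] by (rule psi_section[OF that])
  have phi_alg: "\<phi> \<in> alg_hom R IA (self_alg R)"
  proof (rule alg_homI)
    show "\<phi> \<in> ring_hom IA (self_alg R)"
    proof (rule ring_hom_memI)
      fix y z assume y: "y \<in> carrier IA" and z: "z \<in> carrier IA"
      note S = S_IU[OF y] S_IU[OF z]
      show "\<phi> y \<in> carrier (self_alg R)" unfolding phi_eq[OF y] using psi_closed[OF S(1)] by simp
      have "y \<otimes>\<^bsub>IA\<^esub> z = pr.hT (sec.hT y \<otimes>\<^bsub>IU\<^esub> sec.hT z)"
        unfolding invariants_simps ring_hom_mult[OF hT_hom IU_PU[OF S(1)] IU_PU[OF S(2)]]
          retract[OF IA_PA[OF y]] retract[OF IA_PA[OF z]] ..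
      then have "\<phi> (y \<otimes>\<^bsub>IA\<^esub> z) = \<psi> (sec.hT y \<otimes>\<^bsub>IU\<^esub> sec.hT z)"
        using phi_hT[OF IU.m_closed[OF S]] by simp
      then show "\<phi> (y \<otimes>\<^bsub>IA\<^esub> z) = \<phi> y \<otimes>\<^bsub>self_alg R\<^esub> \<phi> z"
        unfolding phi_eq[OF y] phi_eq[OF z] ring_hom_mult[OF psi_hom S] .
      have "y \<oplus>\<^bsub>IA\<^esub> z = pr.hT (sec.hT y \<oplus>\<^bsub>IU\<^esub> sec.hT z)"
        unfolding invariants_simps ring_hom_add[OF hT_hom IU_PU[OF S(1)] IU_PU[OF S(2)]]
          retract[OF IA_PA[OF y]] retract[OF IA_PA[OF z]] ..
      then have "\<phi> (y \<oplus>\<^bsub>IA\<^esub> z) = \<psi> (sec.hT y \<oplus>\<^bsub>IU\<^esub> sec.hT z)"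
        using phi_hT[OF IU.a_closed[OF S]] by simp
      then show "\<phi> (y \<oplus>\<^bsub>IA\<^esub> z) = \<phi> y \<oplus>\<^bsub>self_alg R\<^esub> \<phi> z"
        unfolding phi_eq[OF y] phi_eq[OF z] ring_hom_add[OF psi_hom S] .
    next
      have "\<one>\<^bsub>IA\<^esub> = pr.hT \<one>\<^bsub>IU\<^esub>" unfolding invariants_simps ring_hom_one[OF hT_hom] ..
      then show "\<phi> \<one>\<^bsub>IA\<^esub> = \<one>\<^bsub>self_alg R\<^esub>"
        using phi_hT[OF IU.one_closed] ring_hom_one[OF psi_hom] by simp
    qed
    show "\<phi> \<in> extensional (carrier IA)" by (simp add: \<phi>_def)
    fix r z assume r: "r \<in> carrier R" and z: "z \<in> carrier IA"
    have "sec.hT (r \<odot>\<^bsub>IA\<^esub> z) = r \<odot>\<^bsub>IU\<^esub> sec.hT z"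
      unfolding invariants_simps by (rule sec.map_smult[OF r IA_PA[OF z]])
    then show "\<phi> (r \<odot>\<^bsub>IA\<^esub> z) = r \<odot>\<^bsub>self_alg R\<^esub> \<phi> z"
      unfolding phi_eq[OF z] phi_eq[OF IA.smult_closed[OF r z]]
      using psi_lin[OF r S_IU[OF z]] by simp
  qed
  have phi_e: "\<phi> (elem_sym R A n k b) = char_coeff R A n k b" if b: "b \<in> carrier A" and k: "k \<in> {1..n}" for b k
  proof (rule inj_onD[OF j_inj])
    obtain g where g: "g \<in> carrier (UP R)" "ev g = b" using ev_surj[OF b] by (elim bexE)
    have phi: "\<phi> (elem_sym R A n k b) = \<psi> (elem_sym R (UP R) n k g)"
      using phi_hT[OF elem_sym_IU[OF g(1)]] unfolding hT_elem_sym[OF g(1)] g(2) .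
    have "j (\<phi> (elem_sym R A n k b)) = i (elem_sym R (UP R) n k g)"
      unfolding phi by (rule ij[OF elem_sym_IU[OF g(1)], symmetric])
    also have "\<dots> = esym Q n k (\<lambda>l. i (pr.C.emb g l))" by (rule i_esym[OF g(1)])
    also have "\<dots> = esym Q n k (\<lambda>l. sp.evQ l g)"
      by (rule Q.esym_cong[symmetric]) (use i.hom_closed[OF emb[OF _ g(1)]] i_emb[OF _ g(1)] in auto)
    also have "\<dots> = j (char_coeff R A n k b)"
      unfolding char_coeff_chi[OF b] sp.char_poly_splits[OF g(1) k, symmetric] g(2) ..
    finally show "j (\<phi> (elem_sym R A n k b)) = j (char_coeff R A n k b)" .
    show "\<phi> (elem_sym R A n k b) \<in> carrier R" unfolding phi by (rule psi_closed[OF elem_sym_IU[OF g(1)]])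
    show "char_coeff R A n k b \<in> carrier R" unfolding char_coeff_chi[OF b] using b by simp
  qed
  have mem: "\<phi> \<in> closure_data R A n G"
    unfolding closure_data_def using phi_alg phi_e by blast
  have "pull_back R A n G a \<phi> = \<psi>"
  proof (rule extensionalityI[OF _ alg_homD(2)[OF psi]])
    show "pull_back R A n G a \<phi> \<in> extensional (carrier IU)" by (simp add: pull_back_def compose_def)
    fix z assume z: "z \<in> carrier IU"
    show "pull_back R A n G a \<phi> z = \<psi> z" unfolding pull_back_eq[OF z] by (rule phi_hT[OF z])
  qed
  then show "\<exists>\<phi>\<in>closure_data R A n G. pull_back R A n G a \<phi> = \<psi>" using mem by (rule bexI)
qed

theorem pull_back_bij:
  assumes "benign R n G"
  shows "bij_betw (pull_back R A n G a) (closure_data R A n G) (poly_homs R A n G a)"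
  unfolding bij_betw_def
proof (intro conjI pull_back_inj Set.set_eqI iffI)
  fix \<psi>
  show "\<psi> \<in> poly_homs R A n G a" if "\<psi> \<in> pull_back R A n G a ` closure_data R A n G"
    using that pull_back_poly_homs by (elim imageE) simp
  show "\<psi> \<in> pull_back R A n G a ` closure_data R A n G" if "\<psi> \<in> poly_homs R A n G a"
    using pull_back_surj[OF assms that] by (elim bexE) (rule image_eqI[OF sym])
qed

end

theorem lemma7p13:
  fixes R :: "('r, 'x) ring_scheme" and A :: "('r, 'a, 'y) module_scheme"
    and n :: nat and a :: 'a and G :: "(nat \<Rightarrow> nat) set"
  assumes "cring R" and "algebra R A"
    and "monogenic R A n" and "generates R A a"
    and "subgroup G (sym_group n)"
  shows "projection R A n G a \<in> alg_hom R (tpower_inv R (UP R) n G) (tpower_inv R A n G)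
       \<and> (\<forall>\<phi> \<in> closure_data R A n G. pull_back R A n G a \<phi> \<in> poly_homs R A n G a)
       \<and> (benign R n G \<longrightarrow>
            bij_betw (pull_back R A n G a) (closure_data R A n G) (poly_homs R A n G a))"
proof -
  define \<epsilon> where "\<epsilon> = (SOME \<epsilon>. is_basis R A n \<epsilon>)"
  have "is_basis R A n \<epsilon>"
    unfolding \<epsilon>_def by (rule someI_ex[OF monogenic_ex_basis[OF assms(2,3)]])
  then interpret closure R A n \<epsilon> a G
    by (intro closure.intro mono_alg.intro mono_alg_axioms.intro closure_axioms.intro assms \<epsilon>_def)
  show ?thesis
    by (intro conjI ballI impI projection_hom pull_back_poly_homs pull_back_bij)
qed

end
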